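(* Let $H$ be a generalised Taft algebra over $k$. Then there exist an integer $N\ge 2$, a parameter matrix $(a_{ij})\in\mathbb Z_N^{2\times 2}$ and a primitive $N$-th root of unity $q\in k$ such that, with $N_x$ and $N_y$ denoting the (additive) orders of $a_{11}a_{12}$ and $a_{21}a_{22}$ in $\mathbb Z_N$, the Hopf algebra $H$ is generated by elements $g,x,y\in H$ subject to the relations $$x^{N_x}=0,\quad y^{N_y}=0,\quad xy=q^{a_{11}a_{22}}yx,\quad g^N=1,\quad gx=q^{a_{12}}xg,\quad gy=q^{a_{22}}yg,$$ with coproduct $$\Delta(g)=g\otimes g,\quad \Delta(x)=1\otimes x+x\otimes g^{a_{11}},\quad \Delta(y)=1\otimes y+y\otimes g^{a_{21}}$$ and antipode $$S(g)=g^{-1},\quad S(x)=-xg^{-a_{11}},\quad S(y)=-yg^{-a_{21}}.$$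
   Context: $k$ is an algebraically closed field of characteristic zero; $\mathbb Z_N=\mathbb Z/N\mathbb Z$. Parameter matrix: a matrix $(a_{ij})\in\mathbb Z_N^{2\times2}$ with $a_{11}a_{12}\neq0$, $a_{21}a_{22}\ne0$, $a_{11}a_{22}+a_{12}a_{21}=0$ in $\mathbb Z_N$. Yetter--Drinfeld modules: over a Hopf algebra $K$ with invertible antipode, a Yetter--Drinfeld module is a vector space $M$ with a left action $\triangleright$ and a left coaction $\delta(m)=m_{(-1)}\otimes m_{(0)}$ such that $\delta(h\triangleright m)=h_{(1)}m_{(-1)}S(h_{(3)})\otimes h_{(2)}\triangleright m_{(0)}$. They form a braided monoidal category (diagonal action and coaction) with braiding $\sigma_{M,N}(m\otimes n)=m_{(-1)}\triangleright n\otimes m_{(0)}$. $D_2$-type: a Yetter--Drinfeld module $V$ is of $D_2$-type if it is two-dimensional and has an ordered basis $\{v_1,v_2\}$ with $\sigma_{V,V}(v_i\otimes v_j)=\mathfrak q_{ij}\,v_j\otimes v_i$, where all $\mathfrak q_{ij}\in k$ are roots of unity, $\mathfrak q_{11},\mathfrak q_{22}\ne1$ and $\mathfrak q_{12}\mathfrak q_{21}=1$. Nichols algebra: $\mathcal B(V)=\bigoplus_{n\ge0}\mathcal B(V)(n)$ is the (unique up to isomorphism) graded Hopf algebra in the braided category of Yetter--Drinfeld modules over $K$ with $\mathcal B(V)(0)=k$, $\mathcal B(V)(1)=\mathrm{Pr}(\mathcal B(V))\cong V$ (the space of primitive elements), and which is generated as an algebra by $\mathcal B(V)(1)$. Bosonisation: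 for a Hopf algebra $R$ in the category of Yetter--Drinfeld modules over $K$, $R\#K$ is the Hopf algebra with underlying vector space $R\otimes K$ and structure $(r\otimes g)(s\otimes h)=r(g_{(1)}\triangleright s)\otimes g_{(2)}h$, $\Delta(r\otimes g)=r^{(1)}\otimes(r^{(2)})_{(-1)}g_{(1)}\otimes(r^{(2)})_{(0)}\otimes g_{(2)}$, where $r^{(1)}\otimes r^{(2)}$ is the coproduct of $R$. Generalised Taft algebra: a Hopf algebra of the form $(\mathcal B(V)\#kG)^{\mathrm{cop}}$ (coopposite coproduct), where $G$ is a finite cyclic group, $kG$ its group algebra and $V$ a Yetter--Drinfeld module of $D_2$-type over $kG$. *)

theory Defs
  imports
    "HOL-Library.Function_Algebras"
    "HOL-Library.Poly_Mapping"
    "HOL-Computational_Algebra.Polynomial"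
    "HOL-Library.Numeral_Type"
    "HOL-Algebra.Elementary_Groups"
    "HOL-Algebra.Multiplicative_Group"
    "HOL-Number_Theory.Residues"
begin

section \<open>Vector spaces and tensor products\<close>

text \<open>A vector space is a subspace \<open>carrier V\<close> of an ambient type which is a vector space under
  \<open>scale V\<close>; addition is that of the ambient type.\<close>

record ('k, 'v) vspace = "'v partial_object" +
  scale :: "'k \<Rightarrow> 'v \<Rightarrow> 'v"

definition is_vspace :: "('k::field, 'v::ab_group_add, 'z) vspace_scheme \<Rightarrow> bool"
  where "is_vspace V \<longleftrightarrow> vector_space (scale V) \<and> module.subspace (scale V) (carrier V)"

definition ground :: "('k::field, 'k) vspace"
  where "ground = \<lparr>carrier = UNIV, scale = (*)\<rparr>"

definition linear_map ::
    "('k::field, 'v::ab_group_add, 'y) vspace_scheme \<Rightarrow> ('k, 'w::ab_group_add, 'z) vspace_scheme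
      \<Rightarrow> ('v \<Rightarrow> 'w) \<Rightarrow> bool"
  where "linear_map V W f \<longleftrightarrow>
    (\<forall>v\<in>carrier V. f v \<in> carrier W) \<and>
    (\<forall>u\<in>carrier V. \<forall>v\<in>carrier V. f (u + v) = f u + f v) \<and>
    (\<forall>c. \<forall>v\<in>carrier V. f (scale V c v) = scale W c (f v))"

definition bilinear_map ::
    "('k::field, 'v::ab_group_add, 'x) vspace_scheme \<Rightarrow> ('k, 'w::ab_group_add, 'y) vspace_scheme
      \<Rightarrow> ('k, 'u::ab_group_add, 'z) vspace_scheme \<Rightarrow> ('v \<Rightarrow> 'w \<Rightarrow> 'u) \<Rightarrow> bool"
  where "bilinear_map V W U f \<longleftrightarrow>
    (\<forall>v\<in>carrier V. linear_map W U (f v)) \<and> (\<forall>w\<in>carrier W. linear_map V U (\<lambda>v. f v w))"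

text \<open>Over a field the canonical map from \<open>V \<otimes> W\<close> to the dual of the space of bilinear forms
  on \<open>V \<times> W\<close> is injective, and \<open>V \<otimes> W\<close> is taken to be its image: the span of the
  evaluations \<open>\<beta> \<mapsto> \<beta> v w\<close>. The universal property is proved below
  (\<open>sweedler_tens\<close>, \<open>linear_map_sweedler\<close>, \<open>tensor_ext\<close>).\<close>

type_synonym ('k, 'v, 'w) tensor = "('v \<Rightarrow> 'w \<Rightarrow> 'k) \<Rightarrow> 'k"

definition tens ::
    "('k::field, 'v::ab_group_add, 'y) vspace_scheme \<Rightarrow> ('k, 'w::ab_group_add, 'z) vspace_scheme
      \<Rightarrow> 'v \<Rightarrow> 'w \<Rightarrow> ('k, 'v, 'w) tensor"
  where "tens V W v w = (\<lambda>\<beta>. if bilinear_map V W ground \<beta> then \<beta> v w else 0)"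

definition tscale :: "'k::field \<Rightarrow> ('b \<Rightarrow> 'k) \<Rightarrow> ('b \<Rightarrow> 'k)"
  where "tscale c t = (\<lambda>\<beta>. c * t \<beta>)"

definition tensor_space ::
    "('k::field, 'v::ab_group_add, 'y) vspace_scheme \<Rightarrow> ('k, 'w::ab_group_add, 'z) vspace_scheme
      \<Rightarrow> ('k, ('k, 'v, 'w) tensor) vspace"
  where "tensor_space V W =
    \<lparr>carrier = module.span tscale {tens V W v w | v w. v \<in> carrier V \<and> w \<in> carrier W},
     scale = tscale\<rparr>"

text \<open>Sweedler notation: \<open>sweedler V W t (\<lambda>v w. f v w)\<close> is the sum of \<open>f v\<^sub>i w\<^sub>i\<close> for any
  expression of \<open>t\<close> as a sum of pure tensors \<open>v\<^sub>i \<otimes> w\<^sub>i\<close>, that is, the value at \<open>t\<close> of the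
  linear map on \<open>V \<otimes> W\<close> induced by the bilinear map \<open>f\<close>.\<close>

definition sweedler ::
    "('k::field, 'v::ab_group_add, 'y) vspace_scheme \<Rightarrow> ('k, 'w::ab_group_add, 'z) vspace_scheme
      \<Rightarrow> ('k, 'v, 'w) tensor \<Rightarrow> ('v \<Rightarrow> 'w \<Rightarrow> 'u::ab_group_add) \<Rightarrow> 'u"
  where "sweedler V W t f =
    (let xs = (SOME xs. set xs \<subseteq> carrier V \<times> carrier W \<and>
                        t = (\<Sum>(v, w)\<leftarrow>xs. tens V W v w))
     in \<Sum>(v, w)\<leftarrow>xs. f v w)"

lemma vector_space_tscale: "vector_space (tscale :: 'k::field \<Rightarrow> ('b \<Rightarrow> 'k) \<Rightarrow> _)"
  by unfold_locales (auto simp: tscale_def fun_eq_iff algebra_simps)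

interpretation tsc: vector_space "tscale :: 'k::field \<Rightarrow> ('b \<Rightarrow> 'k) \<Rightarrow> _"
  by (rule vector_space_tscale)

lemma vector_space_mult: "vector_space ((*) :: 'k::field \<Rightarrow> 'k \<Rightarrow> 'k)"
  by unfold_locales (auto simp: algebra_simps)

lemma is_vspace_tensor_space: "is_vspace (tensor_space V W)"
  by (auto simp: is_vspace_def tensor_space_def vector_space_tscale)

lemma is_vspace_ground: "is_vspace (ground :: ('k::field, 'k) vspace)"
proof -
  interpret vector_space "(*) :: 'k \<Rightarrow> 'k \<Rightarrow> 'k" by (rule vector_space_mult)
  show ?thesis
    by (auto simp: is_vspace_def ground_def vector_space_axioms)
qed

lemma tens_in_tensor_space:
  "v \<in> carrier V \<Longrightarrow> w \<in> carrier W \<Longrightarrow> tens V W v w \<in> carrier (tensor_space V W)"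
  by (auto simp: tensor_space_def intro!: tsc.span_base)

lemma bilinear_map_tens: "bilinear_map V W (tensor_space V W) (tens V W)"
proof -
  have eq: "\<beta> v (w + w') = \<beta> v w + \<beta> v w'" "\<beta> (v + v') w = \<beta> v w + \<beta> v' w"
      "\<beta> v (scale W c w) = c * \<beta> v w" "\<beta> (scale V c v) w = c * \<beta> v w"
    if "bilinear_map V W ground \<beta>" "v \<in> carrier V" "v' \<in> carrier V" "w \<in> carrier W" "w' \<in> carrier W"
    for \<beta> v v' w w' c
    using that by (auto simp: bilinear_map_def linear_map_def ground_def)
  show ?thesis
    unfolding bilinear_map_def linear_map_def
    by (auto simp: tens_in_tensor_space)
       (auto simp: tens_def tensor_space_def tscale_def fun_eq_iff eq)
qed

lemma tensor_space_sum_list: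
  assumes V: "is_vspace V" and t: "t \<in> carrier (tensor_space V W)"
  shows "\<exists>xs. set xs \<subseteq> carrier V \<times> carrier W \<and> t = (\<Sum>(v, w)\<leftarrow>xs. tens V W v w)"
proof -
  interpret V: vector_space "scale V" using V by (simp add: is_vspace_def)
  have sub: "V.subspace (carrier V)" using V by (simp add: is_vspace_def)
  have "t \<in> tsc.span {tens V W v w | v w. v \<in> carrier V \<and> w \<in> carrier W}"
    using t by (simp add: tensor_space_def)
  then show ?thesis
  proof (induction rule: tsc.span_induct_alt)
    case base
    show ?case by (rule exI[of _ "[]"]) simp
  next
    case (step c x y)
    then obtain v w xs where x: "x = tens V W v w" "v \<in> carrier V" "w \<in> carrier W"
      and xs: "set xs \<subseteq> carrier V \<times> carrier W" "y = (\<Sum>(v, w)\<leftarrow>xs. tens V W v w)" by blast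
    have "tscale c x = tens V W (scale V c v) w"
      using bilinear_map_tens[of V W] x
      by (auto simp: bilinear_map_def linear_map_def tensor_space_def)
    then show ?case using x xs sub
      by (intro exI[of _ "(scale V c v, w) # xs"]) (auto simp: V.subspace_scale)
  qed
qed

lemma sum_list_pairing:
  assumes "bilinear_map V W ground \<beta>"
  shows "(\<Sum>(v, w)\<leftarrow>xs. tens V W v w) \<beta> = (\<Sum>(v, w)\<leftarrow>xs. \<beta> v w)"
  using assms by (induction xs) (auto simp: tens_def)

lemma sum_list_tens_unique:
  fixes f :: "'v::ab_group_add \<Rightarrow> 'w::ab_group_add \<Rightarrow> 'u::ab_group_add"
    and V :: "('k::field, 'v, 'x) vspace_scheme" and W :: "('k, 'w, 'y) vspace_scheme"
    and U :: "('k, 'u, 'z) vspace_scheme"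
  assumes f: "bilinear_map V W U f" and U: "is_vspace U"
    and xs: "set xs \<subseteq> carrier V \<times> carrier W" and ys: "set ys \<subseteq> carrier V \<times> carrier W"
    and eq: "(\<Sum>(v, w)\<leftarrow>xs. tens V W v w) = (\<Sum>(v, w)\<leftarrow>ys. tens V W v w)"
  shows "(\<Sum>(v, w)\<leftarrow>xs. f v w) = (\<Sum>(v, w)\<leftarrow>ys. f v w)"
proof (rule ccontr)
  interpret U: vector_space "scale U" using U by (simp add: is_vspace_def)
  interpret P: vector_space_pair "scale U" "(*) :: 'k \<Rightarrow> 'k \<Rightarrow> 'k"
    by (intro vector_space_pair.intro U.vector_space_axioms vector_space_mult)
  define u where "u = (\<Sum>(v, w)\<leftarrow>xs. f v w) - (\<Sum>(v, w)\<leftarrow>ys. f v w)"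
  assume "(\<Sum>(v, w)\<leftarrow>xs. f v w) \<noteq> (\<Sum>(v, w)\<leftarrow>ys. f v w)"
  then have "u \<noteq> 0" by (simp add: u_def)
  then have "U.independent {u}" by simp
  then obtain \<phi> where \<phi>: "Vector_Spaces.linear (scale U) (*) \<phi>" "\<phi> u = 1"
    using P.linear_independent_extend[of "{u}" "\<lambda>_. 1"] by auto
  interpret \<phi>: Vector_Spaces.linear "scale U" "(*)" \<phi> by (rule \<phi>)
  have b: "bilinear_map V W ground (\<lambda>v w. \<phi> (f v w))"
    using f by (auto simp: bilinear_map_def linear_map_def ground_def \<phi>.add \<phi>.scale)
  have s: "\<phi> (\<Sum>(v, w)\<leftarrow>zs. f v w) = (\<Sum>(v, w)\<leftarrow>zs. \<phi> (f v w))" for zs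
    by (induction zs) (auto simp: \<phi>.add)
  have "\<phi> u = 0"
    unfolding u_def \<phi>.diff s sum_list_pairing[OF b, symmetric] eq by simp
  with \<phi>(2) show False by simp
qed

lemma sweedler_eq:
  assumes "bilinear_map V W U f" "is_vspace U" "set xs \<subseteq> carrier V \<times> carrier W"
  shows "sweedler V W (\<Sum>(v, w)\<leftarrow>xs. tens V W v w) f = (\<Sum>(v, w)\<leftarrow>xs. f v w)"
proof -
  let ?t = "\<Sum>(v, w)\<leftarrow>xs. tens V W v w"
  let ?P = "\<lambda>ys. set ys \<subseteq> carrier V \<times> carrier W \<and> ?t = (\<Sum>(v, w)\<leftarrow>ys. tens V W v w)"
  have "?P (SOME ys. ?P ys)"
    by (rule someI[of ?P xs]) (use assms(3) in simp)
  then show ?thesis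
    unfolding sweedler_def Let_def
    using sum_list_tens_unique[OF assms(1,2), of "SOME ys. ?P ys" xs] assms(3) by auto
qed

lemma sweedler_tens:
  assumes "bilinear_map V W U f" "is_vspace U" "v \<in> carrier V" "w \<in> carrier W"
  shows "sweedler V W (tens V W v w) f = f v w"
  using sweedler_eq[OF assms(1,2), of "[(v, w)]"] assms by simp

lemma linear_map_sweedler:
  fixes f :: "'v::ab_group_add \<Rightarrow> 'w::ab_group_add \<Rightarrow> 'u::ab_group_add"
    and V :: "('k::field, 'v, 'x) vspace_scheme" and W :: "('k, 'w, 'y) vspace_scheme"
    and U :: "('k, 'u, 'z) vspace_scheme"
  assumes f: "bilinear_map V W U f" and V: "is_vspace V" and U: "is_vspace U"
  shows "linear_map (tensor_space V W) U (\<lambda>t. sweedler V W t f)"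
proof -
  interpret V: vector_space "scale V" using V by (simp add: is_vspace_def)
  interpret U: vector_space "scale U" using U by (simp add: is_vspace_def)
  have subV: "V.subspace (carrier V)" using V by (simp add: is_vspace_def)
  have subU: "U.subspace (carrier U)" using U by (simp add: is_vspace_def)
  note rep = tensor_space_sum_list[OF V, of _ W]
  note ev = sweedler_eq[OF f U]
  show ?thesis
    unfolding linear_map_def
  proof (intro conjI ballI allI)
    fix t assume "t \<in> carrier (tensor_space V W)"
    then obtain xs where xs: "set xs \<subseteq> carrier V \<times> carrier W" "t = (\<Sum>(v, w)\<leftarrow>xs. tens V W v w)"
      using rep by blast
    have "(\<Sum>(v, w)\<leftarrow>xs. f v w) \<in> carrier U" using xs(1)
    proof (induction xs)
      case Nil
      show ?case using subU by (simp add: U.subspace_0)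
    next
      case (Cons a xs)
      then show ?case using f subU
        by (auto simp: bilinear_map_def linear_map_def intro!: U.subspace_add)
    qed
    then show "sweedler V W t f \<in> carrier U" using ev[OF xs(1)] xs(2) by simp
    fix c
    let ?ys = "map (\<lambda>(v, w). (scale V c v, w)) xs"
    have 1: "set ?ys \<subseteq> carrier V \<times> carrier W" using xs(1) subV by (auto simp: V.subspace_scale)
    have 2: "tscale c t = (\<Sum>(v, w)\<leftarrow>?ys. tens V W v w)"
      unfolding xs(2) using xs(1)
    proof (induction xs)
      case (Cons a xs)
      obtain v w where a: "a = (v, w)" by (cases a)
      have "v \<in> carrier V" "w \<in> carrier W" using Cons.prems a by auto
      then have "tscale c (tens V W v w) = tens V W (scale V c v) w"
        using bilinear_map_tens[of V W]
        unfolding bilinear_map_def linear_map_def tensor_space_def by simp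
      then show ?case using Cons
        unfolding a list.map sum_list.Cons prod.case tsc.scale_right_distrib by simp
    qed (simp add: tsc.scale_zero_right)
    have 3: "scale U c (\<Sum>(v, w)\<leftarrow>xs. f v w) = (\<Sum>(v, w)\<leftarrow>?ys. f v w)"
      using xs(1)
    proof (induction xs)
      case (Cons a xs)
      then show ?case using f
        by (auto simp: U.scale_right_distrib bilinear_map_def linear_map_def)
    qed simp
    have "scale (tensor_space V W) c t = tscale c t" by (simp add: tensor_space_def)
    then show "sweedler V W (scale (tensor_space V W) c t) f = scale U c (sweedler V W t f)"
      using ev[OF 1] ev[OF xs(1)] 2 3 xs(2) by simp
  next
    fix s t assume "s \<in> carrier (tensor_space V W)" "t \<in> carrier (tensor_space V W)"
    then obtain xs ys where
      xs: "set xs \<subseteq> carrier V \<times> carrier W" "s = (\<Sum>(v, w)\<leftarrow>xs. tens V W v w)" and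
      ys: "set ys \<subseteq> carrier V \<times> carrier W" "t = (\<Sum>(v, w)\<leftarrow>ys. tens V W v w)"
      using rep by metis
    have "s + t = (\<Sum>(v, w)\<leftarrow>xs @ ys. tens V W v w)" using xs ys by simp
    then show "sweedler V W (s + t) f = sweedler V W s f + sweedler V W t f"
      using ev[of "xs @ ys"] ev[OF xs(1)] ev[OF ys(1)] xs ys by simp
  qed
qed

lemma tensor_ext:
  assumes V: "is_vspace V" and U: "is_vspace U"
    and F: "linear_map (tensor_space V W) U F" and G: "linear_map (tensor_space V W) U G"
    and eq: "\<And>v w. v \<in> carrier V \<Longrightarrow> w \<in> carrier W \<Longrightarrow> F (tens V W v w) = G (tens V W v w)"
    and t: "t \<in> carrier (tensor_space V W)"
  shows "F t = G t"
proof -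
  have z: "H 0 = 0" if "linear_map (tensor_space V W) U H" for H
  proof -
    have "0 \<in> carrier (tensor_space V W)" by (simp add: tensor_space_def tsc.span_zero)
    with that have "H (0 + 0) = H 0 + H 0" unfolding linear_map_def by blast
    then show ?thesis by simp
  qed
  obtain xs where xs: "set xs \<subseteq> carrier V \<times> carrier W" "t = (\<Sum>(v, w)\<leftarrow>xs. tens V W v w)"
    using tensor_space_sum_list[OF V t] by blast
  have "F (\<Sum>(v, w)\<leftarrow>xs. tens V W v w) = G (\<Sum>(v, w)\<leftarrow>xs. tens V W v w)
      \<and> (\<Sum>(v, w)\<leftarrow>xs. tens V W v w) \<in> carrier (tensor_space V W)"
    using xs(1)
  proof (induction xs)
    case Nil
    have "0 \<in> carrier (tensor_space V W)"
      unfolding tensor_space_def vspace.simps partial_object.simps by (rule tsc.span_zero)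
    then show ?case unfolding list.map sum_list.Nil z[OF F] z[OF G] by blast
  next
    case (Cons a xs)
    obtain v w where a: "a = (v, w)" by (cases a)
    have vw: "v \<in> carrier V" "w \<in> carrier W" using Cons.prems a by auto
    have m: "tens V W v w \<in> carrier (tensor_space V W)"
      using vw by (rule tens_in_tensor_space)
    let ?s = "\<Sum>(v, w)\<leftarrow>xs. tens V W v w"
    have IH: "F ?s = G ?s" "?s \<in> carrier (tensor_space V W)"
      using Cons by auto
    have "F (tens V W v w + ?s) = F (tens V W v w) + F ?s"
      "G (tens V W v w + ?s) = G (tens V W v w) + G ?s"
      using F G m IH(2) unfolding linear_map_def by blast+
    then have "F (tens V W v w + ?s) = G (tens V W v w + ?s)"
      using IH(1) eq[OF vw] by simp
    moreover have "tens V W v w + ?s \<in> carrier (tensor_space V W)"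
      using m IH(2) unfolding tensor_space_def by (simp only: vspace.simps partial_object.simps tsc.span_add)
    ultimately show ?case unfolding a list.map sum_list.Cons prod.case by blast
  qed
  then show ?thesis using xs by simp
qed


section \<open>Algebras, coalgebras and Hopf algebras\<close>

record ('k, 'a) bialg = "('k, 'a) vspace" +
  mul :: "'a \<Rightarrow> 'a \<Rightarrow> 'a"  (infixl \<open>\<cdot>\<index>\<close> 70)
  unity :: 'a
  comul :: "'a \<Rightarrow> ('k, 'a, 'a) tensor"
  counity :: "'a \<Rightarrow> 'k"

definition mult_monoid :: "('k::field, 'a::ab_group_add, 'z) bialg_scheme \<Rightarrow> 'a monoid"
  where "mult_monoid A = \<lparr>carrier = carrier A, monoid.mult = mul A, one = unity A\<rparr>"

definition is_algebra :: "('k::field, 'a::ab_group_add, 'z) bialg_scheme \<Rightarrow> bool"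
  where "is_algebra A \<longleftrightarrow>
    is_vspace A \<and> bilinear_map A A A (mul A) \<and> Group.monoid (mult_monoid A)"

definition is_coalgebra :: "('k::field, 'a::ab_group_add, 'z) bialg_scheme \<Rightarrow> bool"
  where "is_coalgebra C \<longleftrightarrow>
    is_vspace C \<and>
    linear_map C (tensor_space C C) (comul C) \<and>
    linear_map C ground (counity C) \<and>
    (\<forall>c\<in>carrier C.
      sweedler C C (comul C c) (\<lambda>a b. sweedler C C (comul C a)
        (\<lambda>a1 a2. tens C (tensor_space C C) a1 (tens C C a2 b))) =
      sweedler C C (comul C c) (\<lambda>a b. sweedler C C (comul C b)
        (\<lambda>b1 b2. tens C (tensor_space C C) a (tens C C b1 b2)))) \<and>
    (\<forall>c\<in>carrier C. sweedler C C (comul C c) (\<lambda>a b. scale C (counity C a) b) = c) \<and>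
    (\<forall>c\<in>carrier C. sweedler C C (comul C c) (\<lambda>a b. scale C (counity C b) a) = c)"

definition is_bialgebra :: "('k::field, 'a::ab_group_add, 'z) bialg_scheme \<Rightarrow> bool"
  where "is_bialgebra H \<longleftrightarrow>
    is_algebra H \<and> is_coalgebra H \<and>
    (\<forall>g\<in>carrier H. \<forall>h\<in>carrier H.
      comul H (g \<cdot>\<^bsub>H\<^esub> h) =
      sweedler H H (comul H g) (\<lambda>g1 g2. sweedler H H (comul H h)
        (\<lambda>h1 h2. tens H H (g1 \<cdot>\<^bsub>H\<^esub> h1) (g2 \<cdot>\<^bsub>H\<^esub> h2)))) \<and>
    comul H (unity H) = tens H H (unity H) (unity H) \<and>
    (\<forall>g\<in>carrier H. \<forall>h\<in>carrier H. counity H (g \<cdot>\<^bsub>H\<^esub> h) = counity H g * counity H h) \<and>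
    counity H (unity H) = 1"

definition is_antipode :: "('k::field, 'a::ab_group_add, 'z) bialg_scheme \<Rightarrow> ('a \<Rightarrow> 'a) \<Rightarrow> bool"
  where "is_antipode H S \<longleftrightarrow>
    linear_map H H S \<and>
    (\<forall>h\<in>carrier H.
      sweedler H H (comul H h) (\<lambda>a b. S a \<cdot>\<^bsub>H\<^esub> b) = scale H (counity H h) (unity H) \<and>
      sweedler H H (comul H h) (\<lambda>a b. a \<cdot>\<^bsub>H\<^esub> S b) = scale H (counity H h) (unity H))"

definition is_hopf :: "('k::field, 'a::ab_group_add, 'z) bialg_scheme \<Rightarrow> bool"
  where "is_hopf H \<longleftrightarrow> is_bialgebra H \<and> (\<exists>S. is_antipode H S)"

text \<open>On \<open>carrier H\<close> there is at most one antipode; off the carrier its values are irrelevant.\<close>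

definition antipode :: "('k::field, 'a::ab_group_add, 'z) bialg_scheme \<Rightarrow> 'a \<Rightarrow> 'a"
  where "antipode H = (SOME S. is_antipode H S)"

definition coopposite :: "('k::field, 'a::ab_group_add) bialg \<Rightarrow> ('k, 'a) bialg"
  where "coopposite H = H\<lparr>comul := \<lambda>h. sweedler H H (comul H h) (\<lambda>a b. tens H H b a)\<rparr>"

text \<open>An isomorphism of bialgebras between Hopf algebras also commutes with the antipodes.\<close>

definition hopf_iso ::
    "('k::field, 'a::ab_group_add) bialg \<Rightarrow> ('k, 'b::ab_group_add) bialg \<Rightarrow> ('a \<Rightarrow> 'b) \<Rightarrow> bool"
  where "hopf_iso A B \<phi> \<longleftrightarrow>
    linear_map A B \<phi> \<and> bij_betw \<phi> (carrier A) (carrier B) \<and>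
    (\<forall>a\<in>carrier A. \<forall>a'\<in>carrier A. \<phi> (a \<cdot>\<^bsub>A\<^esub> a') = \<phi> a \<cdot>\<^bsub>B\<^esub> \<phi> a') \<and>
    \<phi> (unity A) = unity B \<and>
    (\<forall>a\<in>carrier A.
      comul B (\<phi> a) = sweedler A A (comul A a) (\<lambda>a1 a2. tens B B (\<phi> a1) (\<phi> a2))) \<and>
    (\<forall>a\<in>carrier A. counity B (\<phi> a) = counity A a)"

definition group_algebra :: "('g, 'm) monoid_scheme \<Rightarrow> ('k::field, 'g \<Rightarrow>\<^sub>0 'k) bialg"
  where "group_algebra G =
    (let V = \<lparr>carrier = {f. Poly_Mapping.keys f \<subseteq> carrier G},
              scale = \<lambda>c. Poly_Mapping.map ((*) c)\<rparr>
     in \<lparr>carrier = carrier V, scale = scale V,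
         mul = \<lambda>f f'. \<Sum>x\<in>Poly_Mapping.keys f. \<Sum>y\<in>Poly_Mapping.keys f'.
           Poly_Mapping.single (x \<otimes>\<^bsub>G\<^esub> y) (Poly_Mapping.lookup f x * Poly_Mapping.lookup f' y),
         unity = Poly_Mapping.single \<one>\<^bsub>G\<^esub> 1,
         comul = \<lambda>f. \<Sum>x\<in>Poly_Mapping.keys f.
           tscale (Poly_Mapping.lookup f x)
             (tens V V (Poly_Mapping.single x 1) (Poly_Mapping.single x 1)),
         counity = \<lambda>f. \<Sum>x\<in>Poly_Mapping.keys f. Poly_Mapping.lookup f x\<rparr>)"


section \<open>Yetter--Drinfeld modules\<close>

record ('k, 'h, 'v) yd = "('k, 'v) vspace" +
  act :: "'h \<Rightarrow> 'v \<Rightarrow> 'v"  (infixr \<open>\<triangleright>\<index>\<close> 75)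
  coact :: "'v \<Rightarrow> ('k, 'h, 'v) tensor"

text \<open>In the last clause \<open>(h\<^sub>(\<^sub>1\<^sub>), h\<^sub>(\<^sub>2\<^sub>), h\<^sub>(\<^sub>3\<^sub>))\<close> is \<open>(h1, h2, h3)\<close>, obtained from
  \<open>(\<Delta> \<otimes> id) \<Delta> h\<close>.\<close>

definition yd_module ::
    "('k::field, 'h::ab_group_add) bialg \<Rightarrow> ('k, 'h, 'v::ab_group_add) yd \<Rightarrow> bool"
  where "yd_module K M \<longleftrightarrow>
    is_hopf K \<and> bij_betw (antipode K) (carrier K) (carrier K) \<and>
    is_vspace M \<and>
    bilinear_map K M M (act M) \<and>
    (\<forall>m\<in>carrier M. unity K \<triangleright>\<^bsub>M\<^esub> m = m) \<and>
    (\<forall>g\<in>carrier K. \<forall>h\<in>carrier K. \<forall>m\<in>carrier M.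
      (g \<cdot>\<^bsub>K\<^esub> h) \<triangleright>\<^bsub>M\<^esub> m = g \<triangleright>\<^bsub>M\<^esub> h \<triangleright>\<^bsub>M\<^esub> m) \<and>
    linear_map M (tensor_space K M) (coact M) \<and>
    (\<forall>m\<in>carrier M. sweedler K M (coact M m) (\<lambda>h m0. scale M (counity K h) m0) = m) \<and>
    (\<forall>m\<in>carrier M.
      sweedler K M (coact M m) (\<lambda>h m0. sweedler K K (comul K h)
        (\<lambda>h1 h2. tens K (tensor_space K M) h1 (tens K M h2 m0))) =
      sweedler K M (coact M m) (\<lambda>h m0. sweedler K M (coact M m0)
        (\<lambda>h' m'. tens K (tensor_space K M) h (tens K M h' m')))) \<and>
    (\<forall>h\<in>carrier K. \<forall>m\<in>carrier M.
      coact M (h \<triangleright>\<^bsub>M\<^esub> m) =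
      sweedler K K (comul K h) (\<lambda>h12 h3. sweedler K K (comul K h12) (\<lambda>h1 h2.
        sweedler K M (coact M m) (\<lambda>b m0.
          tens K M (h1 \<cdot>\<^bsub>K\<^esub> b \<cdot>\<^bsub>K\<^esub> antipode K h3) (h2 \<triangleright>\<^bsub>M\<^esub> m0)))))"

definition yd_morphism ::
    "('k::field, 'h::ab_group_add) bialg \<Rightarrow> ('k, 'h, 'v::ab_group_add) yd
      \<Rightarrow> ('k, 'h, 'w::ab_group_add) yd \<Rightarrow> ('v \<Rightarrow> 'w) \<Rightarrow> bool"
  where "yd_morphism K M N f \<longleftrightarrow>
    linear_map M N f \<and>
    (\<forall>h\<in>carrier K. \<forall>m\<in>carrier M. f (h \<triangleright>\<^bsub>M\<^esub> m) = h \<triangleright>\<^bsub>N\<^esub> f m) \<and>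
    (\<forall>m\<in>carrier M. coact N (f m) = sweedler K M (coact M m) (\<lambda>h m0. tens K N h (f m0)))"

definition yd_unit :: "('k::field, 'h::ab_group_add) bialg \<Rightarrow> ('k, 'h, 'k) yd"
  where "yd_unit K =
    \<lparr>carrier = UNIV, scale = (*), act = \<lambda>h c. counity K h * c,
     coact = \<lambda>c. tens K ground (unity K) c\<rparr>"

definition yd_tensor ::
    "('k::field, 'h::ab_group_add) bialg \<Rightarrow> ('k, 'h, 'v::ab_group_add) yd
      \<Rightarrow> ('k, 'h, 'w::ab_group_add) yd \<Rightarrow> ('k, 'h, ('k, 'v, 'w) tensor) yd"
  where "yd_tensor K M N =
    \<lparr>carrier = carrier (tensor_space M N), scale = tscale,
     act = \<lambda>h t. sweedler K K (comul K h) (\<lambda>h1 h2. sweedler M N t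
       (\<lambda>m n. tens M N (h1 \<triangleright>\<^bsub>M\<^esub> m) (h2 \<triangleright>\<^bsub>N\<^esub> n))),
     coact = \<lambda>t. sweedler M N t (\<lambda>m n.
       sweedler K M (coact M m) (\<lambda>a m0. sweedler K N (coact N n) (\<lambda>b n0.
         tens K (tensor_space M N) (a \<cdot>\<^bsub>K\<^esub> b) (tens M N m0 n0))))\<rparr>"

definition braiding ::
    "('k::field, 'h::ab_group_add) bialg \<Rightarrow> ('k, 'h, 'v::ab_group_add) yd
      \<Rightarrow> ('k, 'h, 'w::ab_group_add) yd \<Rightarrow> ('k, 'v, 'w) tensor \<Rightarrow> ('k, 'w, 'v) tensor"
  where "braiding K M N t =
    sweedler M N t (\<lambda>m n. sweedler K M (coact M m) (\<lambda>h m0. tens N M (h \<triangleright>\<^bsub>N\<^esub> n) m0))"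

definition root_of_unity :: "'k::field \<Rightarrow> bool"
  where "root_of_unity z \<longleftrightarrow> (\<exists>n>0. z ^ n = 1)"

definition D2_type ::
    "('k::field, 'h::ab_group_add) bialg \<Rightarrow> ('k, 'h, 'v::ab_group_add) yd \<Rightarrow> bool"
  where "D2_type K V \<longleftrightarrow>
    yd_module K V \<and>
    (\<exists>(v :: 2 \<Rightarrow> 'v) (\<qq> :: 2 \<Rightarrow> 2 \<Rightarrow> 'k).
      inj v \<and> \<not> module.dependent (scale V) (range v) \<and>
      module.span (scale V) (range v) = carrier V \<and>
      (\<forall>i j. braiding K V V (tens V V (v i) (v j)) =
              scale (tensor_space V V) (\<qq> i j) (tens V V (v j) (v i))) \<and>
      (\<forall>i j. root_of_unity (\<qq> i j)) \<and>
      \<qq> 1 1 \<noteq> 1 \<and> \<qq> 2 2 \<noteq> 1 \<and> \<qq> 1 2 * \<qq> 2 1 = 1)"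


section \<open>Hopf algebras in the category of Yetter--Drinfeld modules\<close>

record ('k, 'h, 'r) braided_bialg = "('k, 'r) bialg" +
  bact :: "'h \<Rightarrow> 'r \<Rightarrow> 'r"
  bcoact :: "'r \<Rightarrow> ('k, 'h, 'r) tensor"

definition yd_of :: "('k, 'h, 'r) braided_bialg \<Rightarrow> ('k, 'h, 'r) yd"
  where "yd_of R = \<lparr>carrier = carrier R, scale = scale R, act = bact R, coact = bcoact R\<rparr>"

text \<open>The multiplicativity of \<open>\<Delta>\<close> refers to the algebra structure
  \<open>(m \<otimes> m) (id \<otimes> \<sigma> \<otimes> id)\<close> on \<open>R \<otimes> R\<close>.\<close>

definition braided_hopf ::
    "('k::field, 'h::ab_group_add) bialg \<Rightarrow> ('k, 'h, 'r::ab_group_add) braided_bialg \<Rightarrow> bool"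
  where "braided_hopf K R \<longleftrightarrow>
    yd_module K (yd_of R) \<and> is_algebra R \<and> is_coalgebra R \<and>
    yd_morphism K (yd_tensor K (yd_of R) (yd_of R)) (yd_of R) (\<lambda>t. sweedler R R t (mul R)) \<and>
    yd_morphism K (yd_unit K) (yd_of R) (\<lambda>c. scale R c (unity R)) \<and>
    yd_morphism K (yd_of R) (yd_tensor K (yd_of R) (yd_of R)) (comul R) \<and>
    yd_morphism K (yd_of R) (yd_unit K) (counity R) \<and>
    (\<forall>r\<in>carrier R. \<forall>s\<in>carrier R.
      comul R (r \<cdot>\<^bsub>R\<^esub> s) =
      sweedler R R (comul R r) (\<lambda>r1 r2. sweedler R R (comul R s) (\<lambda>s1 s2.
        sweedler R R (braiding K (yd_of R) (yd_of R) (tens R R r2 s1))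
          (\<lambda>s1' r2'. tens R R (r1 \<cdot>\<^bsub>R\<^esub> s1') (r2' \<cdot>\<^bsub>R\<^esub> s2))))) \<and>
    comul R (unity R) = tens R R (unity R) (unity R) \<and>
    (\<forall>r\<in>carrier R. \<forall>s\<in>carrier R. counity R (r \<cdot>\<^bsub>R\<^esub> s) = counity R r * counity R s) \<and>
    counity R (unity R) = 1 \<and>
    (\<exists>S. is_antipode R S \<and> yd_morphism K (yd_of R) (yd_of R) S)"

definition direct_sum_decomposition ::
    "('k::field, 'v::ab_group_add, 'z) vspace_scheme \<Rightarrow> (nat \<Rightarrow> 'v set) \<Rightarrow> bool"
  where "direct_sum_decomposition V gr \<longleftrightarrow>
    (\<forall>n. module.subspace (scale V) (gr n) \<and> gr n \<subseteq> carrier V) \<and>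
    (\<forall>v\<in>carrier V. \<exists>!f. (\<forall>n. f n \<in> gr n) \<and> finite {n. f n \<noteq> 0} \<and> v = (\<Sum>n | f n \<noteq> 0. f n))"

definition graded_braided_hopf ::
    "('k::field, 'h::ab_group_add) bialg \<Rightarrow> ('k, 'h, 'r::ab_group_add) braided_bialg
      \<Rightarrow> (nat \<Rightarrow> 'r set) \<Rightarrow> bool"
  where "graded_braided_hopf K R gr \<longleftrightarrow>
    braided_hopf K R \<and>
    direct_sum_decomposition R gr \<and>
    (\<forall>n. \<forall>h\<in>carrier K. \<forall>r\<in>gr n. bact R h r \<in> gr n) \<and>
    (\<forall>n. \<forall>r\<in>gr n. bcoact R r \<in> module.span tscale {tens K R h s | h s. h \<in> carrier K \<and> s \<in> gr n}) \<and>
    unity R \<in> gr 0 \<and>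
    (\<forall>m n. \<forall>r\<in>gr m. \<forall>s\<in>gr n. r \<cdot>\<^bsub>R\<^esub> s \<in> gr (m + n)) \<and>
    (\<forall>n. \<forall>r\<in>gr n.
      comul R r \<in> module.span tscale {tens R R a b | a b i. i \<le> n \<and> a \<in> gr i \<and> b \<in> gr (n - i)}) \<and>
    (\<forall>n>0. \<forall>r\<in>gr n. counity R r = 0) \<and>
    (\<forall>n. \<forall>r\<in>gr n. antipode R r \<in> gr n)"

definition primitives :: "('k::field, 'r::ab_group_add, 'z) bialg_scheme \<Rightarrow> 'r set"
  where "primitives R =
    {r \<in> carrier R. comul R r = tens R R r (unity R) + tens R R (unity R) r}"

definition subalgebra :: "('k::field, 'a::ab_group_add, 'z) bialg_scheme \<Rightarrow> 'a set \<Rightarrow> bool"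
  where "subalgebra A X \<longleftrightarrow>
    module.subspace (scale A) X \<and> X \<subseteq> carrier A \<and> unity A \<in> X \<and>
    (\<forall>x\<in>X. \<forall>y\<in>X. x \<cdot>\<^bsub>A\<^esub> y \<in> X)"

definition generated_as_algebra :: "('k::field, 'a::ab_group_add, 'z) bialg_scheme \<Rightarrow> 'a set \<Rightarrow> bool"
  where "generated_as_algebra A X \<longleftrightarrow> \<Inter> {Y. subalgebra A Y \<and> X \<subseteq> Y} = carrier A"

text \<open>\<open>R\<close> is a Nichols algebra of \<open>V\<close>. The isomorphism \<open>V \<cong> R(1)\<close> of Yetter--Drinfeld modules is
  given as an injective morphism \<open>V \<rightarrow> R\<close> with image \<open>R(1)\<close>.\<close>

definition nichols_algebra ::
    "('k::field, 'h::ab_group_add) bialg \<Rightarrow> ('k, 'h, 'v::ab_group_add) yd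
      \<Rightarrow> ('k, 'h, 'r::ab_group_add) braided_bialg \<Rightarrow> bool"
  where "nichols_algebra K V R \<longleftrightarrow>
    (\<exists>gr. graded_braided_hopf K R gr \<and>
      gr 0 = module.span (scale R) {unity R} \<and>
      gr 1 = primitives R \<and>
      (\<exists>\<iota>. yd_morphism K V (yd_of R) \<iota> \<and> bij_betw \<iota> (carrier V) (gr 1)) \<and>
      generated_as_algebra R (gr 1))"

definition bosonisation ::
    "('k::field, 'h::ab_group_add) bialg \<Rightarrow> ('k, 'h, 'r::ab_group_add) braided_bialg
      \<Rightarrow> ('k, ('k, 'r, 'h) tensor) bialg"
  where "bosonisation K R =
    (let T = tensor_space R K
     in \<lparr>carrier = carrier T, scale = scale T,
         mul = \<lambda>t u. sweedler R K t (\<lambda>r g. sweedler R K u (\<lambda>s h.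
           sweedler K K (comul K g) (\<lambda>g1 g2. tens R K (r \<cdot>\<^bsub>R\<^esub> bact R g1 s) (g2 \<cdot>\<^bsub>K\<^esub> h)))),
         unity = tens R K (unity R) (unity K),
         comul = \<lambda>t. sweedler R K t (\<lambda>r g.
           sweedler R R (comul R r) (\<lambda>r1 r2. sweedler K R (bcoact R r2) (\<lambda>b r20.
             sweedler K K (comul K g) (\<lambda>g1 g2.
               tens T T (tens R K r1 (b \<cdot>\<^bsub>K\<^esub> g1)) (tens R K r20 g2))))),
         counity = \<lambda>t. sweedler R K t (\<lambda>r g. counity R r * counity K g)\<rparr>)"

text \<open>\<open>H\<close> is the generalised Taft algebra built from \<open>G\<close>, \<open>V\<close> and the Nichols algebra \<open>B\<close> of \<open>V\<close>.
  These are arguments because HOL cannot quantify existentially over their types; in a theorem they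
  are to be universally quantified.\<close>

definition generalised_taft_algebra ::
    "'g monoid \<Rightarrow> ('k::field, 'g \<Rightarrow>\<^sub>0 'k, 'v::ab_group_add) yd
      \<Rightarrow> ('k, 'g \<Rightarrow>\<^sub>0 'k, 'r::ab_group_add) braided_bialg \<Rightarrow> ('k, 'a::ab_group_add) bialg \<Rightarrow> bool"
  where "generalised_taft_algebra G V B H \<longleftrightarrow>
    group G \<and> finite (carrier G) \<and> cyclic_group G \<and>
    D2_type (group_algebra G) V \<and>
    nichols_algebra (group_algebra G) V B \<and>
    is_hopf H \<and>
    (\<exists>\<phi>. hopf_iso (coopposite (bosonisation (group_algebra G) B)) H \<phi>)"


section \<open>Presentations by generators and relations\<close>

text \<open>With concatenation as addition, \<open>'i list \<Rightarrow>\<^sub>0 'k\<close> is the free algebra on \<open>'i\<close>.\<close>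

instantiation list :: (type) monoid_add
begin
definition zero_list_def: "0 = []"
definition plus_list_def: "xs + ys = xs @ ys"
instance by standard (simp_all add: zero_list_def plus_list_def)
end

type_synonym ('i, 'k) free_algebra = "'i list \<Rightarrow>\<^sub>0 'k"

definition gen :: "'i \<Rightarrow> ('i, 'k::field) free_algebra"
  where "gen i = Poly_Mapping.single [i] 1"

definition const :: "'k::field \<Rightarrow> ('i, 'k) free_algebra"
  where "const c = Poly_Mapping.single [] c"

inductive_set two_sided_ideal :: "'a::ring_1 set \<Rightarrow> 'a set" for X
  where
    zero: "0 \<in> two_sided_ideal X"
  | base: "x \<in> X \<Longrightarrow> a * x * b \<in> two_sided_ideal X"
  | add: "x \<in> two_sided_ideal X \<Longrightarrow> y \<in> two_sided_ideal X \<Longrightarrow> x + y \<in> two_sided_ideal X"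

definition eval_free ::
    "('k::field, 'a::ab_group_add, 'z) bialg_scheme \<Rightarrow> ('i \<Rightarrow> 'a) \<Rightarrow> ('i, 'k) free_algebra \<Rightarrow> 'a"
  where "eval_free A \<gamma> p =
    (\<Sum>w\<in>Poly_Mapping.keys p.
      scale A (Poly_Mapping.lookup p w) (foldr (\<lambda>i a. \<gamma> i \<cdot>\<^bsub>A\<^esub> a) w (unity A)))"

text \<open>\<open>A\<close> is generated by the elements \<open>\<gamma> i\<close> subject to the relations \<open>l = r\<close> for \<open>(l, r) \<in> rels\<close>:
  evaluation induces an isomorphism from the free algebra modulo the relations to \<open>A\<close>.\<close>

definition presented_by ::
    "('k::field, 'a::ab_group_add, 'z) bialg_scheme \<Rightarrow> ('i \<Rightarrow> 'a)
      \<Rightarrow> (('i, 'k) free_algebra \<times> ('i, 'k) free_algebra) set \<Rightarrow> bool"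
  where "presented_by A \<gamma> rels \<longleftrightarrow>
    (\<forall>i. \<gamma> i \<in> carrier A) \<and>
    eval_free A \<gamma> ` UNIV = carrier A \<and>
    {p. eval_free A \<gamma> p = 0} = two_sided_ideal {l - r | l r. (l, r) \<in> rels}"


section \<open>Parameter matrices\<close>

text \<open>Elements of \<open>\<int>\<^sub>N\<close> are their representatives in \<open>{0..<N}\<close>.\<close>

definition parameter_matrix :: "nat \<Rightarrow> (2 \<Rightarrow> 2 \<Rightarrow> int) \<Rightarrow> bool"
  where "parameter_matrix N a \<longleftrightarrow>
    (let Z = residue_ring (int N)
     in (\<forall>i j. a i j \<in> carrier Z) \<and>
        a 1 1 \<otimes>\<^bsub>Z\<^esub> a 1 2 \<noteq> \<zero>\<^bsub>Z\<^esub> \<and>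
        a 2 1 \<otimes>\<^bsub>Z\<^esub> a 2 2 \<noteq> \<zero>\<^bsub>Z\<^esub> \<and>
        a 1 1 \<otimes>\<^bsub>Z\<^esub> a 2 2 \<oplus>\<^bsub>Z\<^esub> a 1 2 \<otimes>\<^bsub>Z\<^esub> a 2 1 = \<zero>\<^bsub>Z\<^esub>)"

definition additive_order :: "nat \<Rightarrow> int \<Rightarrow> nat"
  where "additive_order N c = group.ord (add_monoid (residue_ring (int N))) c"

definition primitive_root_of_unity :: "nat \<Rightarrow> 'k::field \<Rightarrow> bool"
  where "primitive_root_of_unity N q \<longleftrightarrow> q ^ N = 1 \<and> (\<forall>m. 0 < m \<and> m < N \<longrightarrow> q ^ m \<noteq> 1)"

datatype taft_generator = Gen_g | Gen_x | Gen_y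

end

theory Submission
  imports Defs
begin

text \<open>
  Over the group algebra of a finite cyclic group \<open>G = \<langle>\<gamma>\<rangle>\<close> of order \<open>N\<close>, a coaction is a \<open>G\<close>-grading and the
  action of \<open>\<gamma>\<close> is diagonalisable, because the field contains a primitive \<open>N\<close>-th root of unity \<open>\<zeta>\<close>. Hence
  a module \<open>V\<close> of \<open>D\<^sub>2\<close>-type has a basis \<open>w\<^sub>1, w\<^sub>2\<close> with \<open>w\<^sub>i\<close> of degree \<open>\<gamma>\<^bsup>d i\<^esup>\<close> and of eigenvalue \<open>\<zeta>\<^bsup>c i\<^esup>\<close> under \<open>\<gamma>\<close>.
  The braiding is \<open>\<sigma>(w\<^sub>i \<otimes> w\<^sub>j) = \<zeta>\<^bsup>d i c j\<^esup> w\<^sub>j \<otimes> w\<^sub>i\<close>, and the conditions on a \<open>D\<^sub>2\<close>-type module, which are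
  stated for some basis, carry over to this one (\<open>D2_type_eigenbasis\<close>). They say precisely that the
  exponents \<open>d i\<close> and \<open>c i\<close> modulo \<open>N\<close> form a parameter matrix.

  The Nichols algebra \<open>B\<close> of \<open>V\<close> is a truncated quantum plane. Its primitive elements have degree one, so a
  homogeneous primitive element of another degree vanishes. This applies to \<open>w\<^sub>1 w\<^sub>2 - q\<^sub>1\<^sub>2 w\<^sub>2 w\<^sub>1\<close>, which is
  primitive since \<open>q\<^sub>1\<^sub>2 q\<^sub>2\<^sub>1 = 1\<close> (\<open>skew_commute\<close>), and to \<open>w\<^sub>i\<^sup>n\<close> for \<open>n\<close> the order of \<open>q\<^sub>i\<^sub>i\<close>, whose coproduct
  has Gaussian binomial coefficients that vanish (\<open>pow_order_eq_0\<close>). Conversely, the coproduct gives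
  skew derivations dual to \<open>w\<^sub>1\<close> and \<open>w\<^sub>2\<close>; applying them repeatedly and then the counit produces functionals dual to
  the monomials \<open>w\<^sub>1\<^sup>i w\<^sub>2\<^sup>j\<close> below the orders of \<open>q\<^sub>1\<^sub>1\<close> and \<open>q\<^sub>2\<^sub>2\<close> (\<open>dual_functional\<close>), which are therefore linearly
  independent.

  In the bosonisation put \<open>g = 1 \<otimes> \<gamma>\<close>, \<open>x = w\<^sub>1 \<otimes> 1\<close> and \<open>y = w\<^sub>2 \<otimes> 1\<close>. These elements generate it, satisfy the
  relations, and the monomials \<open>x\<^sup>i y\<^sup>j g\<^sup>l\<close> below the orders are independent. In the free algebra every
  element is congruent to a combination of these monomials modulo the relations, so the relations generate the whole
  kernel (\<open>presented_by_taft_rels\<close>). Passing to the co-opposite exchanges the factors in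
  \<open>\<Delta> w\<^sub>i = w\<^sub>i \<otimes> 1 + \<gamma>\<^bsup>d i\<^esup> \<otimes> w\<^sub>i\<close>, and the antipode is determined on group-like and skew-primitive elements by its
  defining equations.
\<close>

section \<open>Linear algebra on carriers\<close>

lemma is_vspace_add: "is_vspace V \<Longrightarrow> u \<in> carrier V \<Longrightarrow> v \<in> carrier V \<Longrightarrow> u + v \<in> carrier V"
  and is_vspace_scale: "is_vspace V \<Longrightarrow> u \<in> carrier V \<Longrightarrow> scale V c u \<in> carrier V"
  and is_vspace_zero: "is_vspace V \<Longrightarrow> 0 \<in> carrier V"
  using module.subspace_add module.subspace_scale module.subspace_0
  unfolding is_vspace_def module_iff_vector_space[symmetric] by blast+

lemma is_vspace_scale_zero: "is_vspace V \<Longrightarrow> scale V c 0 = 0"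
  using module.scale_zero_right
  unfolding is_vspace_def module_iff_vector_space[symmetric] by blast

lemma is_vspace_sum:
  assumes "is_vspace V" "\<And>i. i \<in> I \<Longrightarrow> f i \<in> carrier V"
  shows "(\<Sum>i\<in>I. f i) \<in> carrier V"
  using assms(2)
  by (induction I rule: infinite_finite_induct)
    (auto simp: is_vspace_zero[OF assms(1)] intro!: is_vspace_add[OF assms(1)])

lemma linear_mapD:
  assumes "linear_map V W f"
  shows "v \<in> carrier V \<Longrightarrow> f v \<in> carrier W"
    and "u \<in> carrier V \<Longrightarrow> v \<in> carrier V \<Longrightarrow> f (u + v) = f u + f v"
    and "v \<in> carrier V \<Longrightarrow> f (scale V c v) = scale W c (f v)"
  using assms by (auto simp: linear_map_def)

lemma linear_map_zero:
  assumes "is_vspace V" "linear_map V W f" shows "f 0 = 0"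
  using linear_mapD(2)[OF assms(2), of 0 0] is_vspace_zero[OF assms(1)] by simp

lemma linear_map_sum:
  assumes "is_vspace V" "linear_map V W f" "\<And>i. i \<in> I \<Longrightarrow> g i \<in> carrier V"
  shows "f (\<Sum>i\<in>I. g i) = (\<Sum>i\<in>I. f (g i))"
  using assms(3)
proof (induction I rule: infinite_finite_induct)
  case (insert x F)
  then show ?case
    using linear_mapD(2)[OF assms(2), of "g x" "\<Sum>i\<in>F. g i"] is_vspace_sum[OF assms(1), of F g] by auto
qed (auto simp: linear_map_zero[OF assms(1,2)])

lemma linear_map_sum_list:
  assumes "is_vspace V" "linear_map V W f" "\<And>i. i \<in> set xs \<Longrightarrow> g i \<in> carrier V"
  shows "f (\<Sum>i\<leftarrow>xs. g i) = (\<Sum>i\<leftarrow>xs. f (g i)) \<and> (\<Sum>i\<leftarrow>xs. g i) \<in> carrier V"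
  using assms(3)
proof (induction xs)
  case (Cons x xs)
  then show ?case
    using linear_mapD(2)[OF assms(2), of "g x" "\<Sum>i\<leftarrow>xs. g i"]
    by (auto intro: is_vspace_add[OF assms(1)])
qed (auto simp: linear_map_zero[OF assms(1,2)] is_vspace_zero[OF assms(1)])

lemma linear_map_id: "linear_map V V (\<lambda>v. v)"
  by (simp add: linear_map_def)

lemma linear_map_comp:
  assumes "linear_map U V f" "linear_map V W g"
  shows "linear_map U W (\<lambda>u. g (f u))"
  using assms by (simp add: linear_map_def)

lemma linear_map_add_fun:
  assumes "is_vspace W" "linear_map V W f" "linear_map V W g"
  shows "linear_map V W (\<lambda>v. f v + g v)"
proof -
  interpret vector_space "scale W" using assms(1) by (simp add: is_vspace_def)
  show ?thesis using assms(2,3) is_vspace_add[OF assms(1)]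
    by (simp add: linear_map_def scale_right_distrib)
qed

lemma linear_map_scale_fun:
  assumes "is_vspace W" "linear_map V W f"
  shows "linear_map V W (\<lambda>v. scale W c (f v))"
proof -
  interpret vector_space "scale W" using assms(1) by (simp add: is_vspace_def)
  show ?thesis using assms(2) is_vspace_scale[OF assms(1)]
    by (simp add: linear_map_def scale_right_distrib mult.commute)
qed

lemma linear_map_scalar_mult:
  assumes "is_vspace W" "linear_map V ground f" "w \<in> carrier W"
  shows "linear_map V W (\<lambda>v. scale W (f v) w)"
proof -
  interpret vector_space "scale W" using assms(1) by (simp add: is_vspace_def)
  show ?thesis using assms(2) is_vspace_scale[OF assms(1,3)]
    by (simp add: linear_map_def ground_def scale_left_distrib)
qed

lemma linear_map_sum_fun:
  assumes "is_vspace W" "\<And>i. i \<in> I \<Longrightarrow> linear_map V W (f i)"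
  shows "linear_map V W (\<lambda>v. \<Sum>i\<in>I. f i v)"
  using assms(2)
proof (induction I rule: infinite_finite_induct)
  case (insert x F)
  then show ?case by (simp add: linear_map_add_fun[OF assms(1)])
qed (use assms(1) in \<open>auto simp: linear_map_def is_vspace_zero is_vspace_scale_zero\<close>)

lemma bilinear_mapI:
  assumes "\<And>v. v \<in> carrier V \<Longrightarrow> linear_map W U (f v)"
    and "\<And>w. w \<in> carrier W \<Longrightarrow> linear_map V U (\<lambda>v. f v w)"
  shows "bilinear_map V W U f"
  using assms by (simp add: bilinear_map_def)

lemma bilinear_mapD:
  assumes "bilinear_map V W U f"
  shows "v \<in> carrier V \<Longrightarrow> linear_map W U (f v)"
    and "w \<in> carrier W \<Longrightarrow> linear_map V U (\<lambda>v. f v w)"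
    and "v \<in> carrier V \<Longrightarrow> w \<in> carrier W \<Longrightarrow> f v w \<in> carrier U"
  using assms by (auto simp: bilinear_map_def linear_map_def)

lemma bilinear_map_comp:
  assumes "bilinear_map V W U f" "linear_map V' V a" "linear_map W' W b"
  shows "bilinear_map V' W' U (\<lambda>v w. f (a v) (b w))"
  using assms unfolding bilinear_map_def linear_map_def by simp

section \<open>Tensors and Sweedler sums\<close>

text \<open>Only the carrier and the scaling of a record enter the tensor product.\<close>

lemma tens_cong:
  assumes "carrier V = carrier V'" "scale V = scale V'" "carrier W = carrier W'" "scale W = scale W'"
  shows "tens V W = tens V' W'"
  using assms by (simp add: tens_def bilinear_map_def linear_map_def fun_eq_iff)

lemma tensor_space_cong:
  assumes "carrier V = carrier V'" "scale V = scale V'" "carrier W = carrier W'" "scale W = scale W'"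
  shows "tensor_space V W = tensor_space V' W'"
  using assms by (simp add: tensor_space_def tens_cong[OF assms])

lemma sweedler_space_cong:
  assumes "carrier V = carrier V'" "scale V = scale V'" "carrier W = carrier W'" "scale W = scale W'"
  shows "sweedler V W = sweedler V' W'"
  using assms by (simp add: sweedler_def fun_eq_iff tens_cong[OF assms])

lemma scale_tensor_space [simp]: "scale (tensor_space V W) = tscale"
  by (simp add: tensor_space_def)

text \<open>The list of pure tensors that \<^const>\<open>sweedler\<close> sums over depends on the tensor only and not
  on the function that is evaluated on it, so that a Sweedler sum is additive in that function
  and commutes with linear maps.\<close>

definition tensor_rep ::
    "('k::field, 'v::ab_group_add, 'y) vspace_scheme \<Rightarrow> ('k, 'w::ab_group_add, 'z) vspace_scheme
      \<Rightarrow> ('k, 'v, 'w) tensor \<Rightarrow> ('v \<times> 'w) list"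
  where "tensor_rep V W t =
    (SOME xs. set xs \<subseteq> carrier V \<times> carrier W \<and> t = (\<Sum>(v, w)\<leftarrow>xs. tens V W v w))"

lemma sweedler_tensor_rep: "sweedler V W t f = (\<Sum>(v, w)\<leftarrow>tensor_rep V W t. f v w)"
  by (simp add: sweedler_def tensor_rep_def Let_def)

lemma tensor_rep:
  assumes "is_vspace V" "t \<in> carrier (tensor_space V W)"
  shows "set (tensor_rep V W t) \<subseteq> carrier V \<times> carrier W"
    and "t = (\<Sum>(v, w)\<leftarrow>tensor_rep V W t. tens V W v w)"
  using someI_ex[OF tensor_space_sum_list[OF assms]] by (simp_all add: tensor_rep_def)

lemma tensor_repD:
  assumes "is_vspace V" "t \<in> carrier (tensor_space V W)" "(v, w) \<in> set (tensor_rep V W t)"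
  shows "v \<in> carrier V" "w \<in> carrier W"
  using tensor_rep(1)[OF assms(1,2)] assms(3) by auto

lemma sweedler_cong:
  assumes "is_vspace V" "t \<in> carrier (tensor_space V W)"
    and "\<And>v w. v \<in> carrier V \<Longrightarrow> w \<in> carrier W \<Longrightarrow> f v w = g v w"
  shows "sweedler V W t f = sweedler V W t g"
  unfolding sweedler_tensor_rep
  by (rule arg_cong[of _ _ sum_list], rule map_cong)
    (use tensor_repD[OF assms(1,2)] assms(3) in auto)

lemma sweedler_identity:
  assumes "is_vspace V" "t \<in> carrier (tensor_space V W)"
  shows "sweedler V W t (tens V W) = t"
  unfolding sweedler_tensor_rep by (rule tensor_rep(2)[OF assms, symmetric])

lemma sweedler_linear:
  assumes "linear_map U U' g" "is_vspace U" "is_vspace V" "t \<in> carrier (tensor_space V W)"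
    and "\<And>v w. v \<in> carrier V \<Longrightarrow> w \<in> carrier W \<Longrightarrow> f v w \<in> carrier U"
  shows "g (sweedler V W t f) = sweedler V W t (\<lambda>v w. g (f v w))"
  using linear_map_sum_list[OF assms(2,1), of "tensor_rep V W t" "\<lambda>(v, w). f v w"]
    tensor_repD[OF assms(3,4)] assms(5)
  unfolding sweedler_tensor_rep case_prod_unfold by auto

lemma sweedler_closed:
  assumes "is_vspace V" "is_vspace U" "t \<in> carrier (tensor_space V W)"
    and "\<And>v w. v \<in> carrier V \<Longrightarrow> w \<in> carrier W \<Longrightarrow> f v w \<in> carrier U"
  shows "sweedler V W t f \<in> carrier U"
  using linear_map_sum_list[OF assms(2) linear_map_id, of "tensor_rep V W t" "\<lambda>(v, w). f v w"]
    tensor_repD[OF assms(1,3)] assms(4)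
  unfolding sweedler_tensor_rep case_prod_unfold by auto

text \<open>Nested Sweedler sums are shown to be linear in each variable by two rules: for a variable in
  the tensor that is summed over, and for a variable in the summand.\<close>

lemma linear_map_sweedler_arg:
  assumes "linear_map X (tensor_space V W) c" "bilinear_map V W U f" "is_vspace V" "is_vspace U"
  shows "linear_map X U (\<lambda>x. sweedler V W (c x) f)"
  by (rule linear_map_comp[OF assms(1) linear_map_sweedler[OF assms(2-4)]])

lemma linear_map_sum_list_fun:
  assumes "is_vspace W" "\<And>i. i \<in> set xs \<Longrightarrow> linear_map V W (f i)"
  shows "linear_map V W (\<lambda>v. \<Sum>i\<leftarrow>xs. f i v)"
  using assms(2)
proof (induction xs)
  case Nil
  show ?case using linear_map_sum_fun[OF assms(1), of "{}"] by simp
qed (simp add: linear_map_add_fun[OF assms(1)])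

lemma linear_map_sweedler_param:
  assumes "\<And>v w. v \<in> carrier V \<Longrightarrow> w \<in> carrier W \<Longrightarrow> linear_map X U (\<lambda>x. f x v w)"
    and "is_vspace V" "is_vspace U" "t \<in> carrier (tensor_space V W)"
  shows "linear_map X U (\<lambda>x. sweedler V W t (f x))"
  unfolding sweedler_tensor_rep case_prod_unfold
  by (rule linear_map_sum_list_fun[OF assms(3)])
    (use tensor_repD[OF assms(2,4)] assms(1) in auto)

lemma linear_map_tens_left: "w \<in> carrier W \<Longrightarrow> linear_map V (tensor_space V W) (\<lambda>v. tens V W v w)"
  and linear_map_tens_right: "v \<in> carrier V \<Longrightarrow> linear_map W (tensor_space V W) (tens V W v)"
  using bilinear_map_tens[of V W] by (auto simp: bilinear_map_def)

lemma sweedler_add: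
  assumes "bilinear_map V W U f" "is_vspace V" "is_vspace U"
    "s \<in> carrier (tensor_space V W)" "t \<in> carrier (tensor_space V W)"
  shows "sweedler V W (s + t) f = sweedler V W s f + sweedler V W t f"
  using linear_mapD(2)[OF linear_map_sweedler[OF assms(1-3)]] assms(4,5) by blast

lemma sweedler_sum_tens:
  assumes f: "bilinear_map V W U f" and V: "is_vspace V" and U: "is_vspace U"
    and I: "\<And>i. i \<in> I \<Longrightarrow> v i \<in> carrier V" "\<And>i. i \<in> I \<Longrightarrow> w i \<in> carrier W"
  shows "sweedler V W (\<Sum>i\<in>I. tens V W (v i) (w i)) f = (\<Sum>i\<in>I. f (v i) (w i))"
proof -
  have "sweedler V W (\<Sum>i\<in>I. tens V W (v i) (w i)) f = (\<Sum>i\<in>I. sweedler V W (tens V W (v i) (w i)) f)"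
    by (rule linear_map_sum[OF is_vspace_tensor_space linear_map_sweedler[OF f V U]])
      (use I in \<open>auto intro: tens_in_tensor_space\<close>)
  also have "\<dots> = (\<Sum>i\<in>I. f (v i) (w i))"
    by (intro sum.cong refl sweedler_tens[OF f U]) (use I in auto)
  finally show ?thesis .
qed

lemma tens_apply: "bilinear_map V W ground \<beta> \<Longrightarrow> tens V W v w \<beta> = \<beta> v w"
  by (simp add: tens_def)

lemma sum_tensor_apply: "(\<Sum>i\<in>I. f i) \<beta> = (\<Sum>i\<in>I. f i \<beta>)"
  for f :: "'i \<Rightarrow> ('k::field, 'v, 'w) tensor"
  by (induction I rule: infinite_finite_induct) auto

text \<open>Linear forms on a carrier are obtained by extending from an independent set to the whole
  ambient type, which is a vector space under the same scaling.\<close>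

lemma coordinate_functional:
  fixes V :: "('k::field, 'v::ab_group_add, 'z) vspace_scheme"
  assumes "is_vspace V" "\<not> module.dependent (scale V) B"
  obtains \<phi> where "\<And>b. \<phi> b \<in> {f. linear_map V ground f}" "\<And>b b'. b' \<in> B \<Longrightarrow> \<phi> b b' = (if b = b' then 1 else (0::'k))"
proof -
  interpret V: vector_space "scale V" using assms(1) by (simp add: is_vspace_def)
  interpret P: vector_space_pair "scale V" "(*) :: 'k \<Rightarrow> 'k \<Rightarrow> 'k"
    by (intro vector_space_pair.intro V.vector_space_axioms vector_space_mult)
  have "\<exists>g. Vector_Spaces.linear (scale V) (*) g \<and> (\<forall>x\<in>B. g x = (if b = x then 1 else 0))" for b
    using P.linear_independent_extend[of B "\<lambda>x. if b = x then 1 else 0"] assms(2) by blast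
  then obtain \<phi> where \<phi>: "\<And>b. Vector_Spaces.linear (scale V) (*) (\<phi> b)"
    "\<And>b x. x \<in> B \<Longrightarrow> \<phi> b x = (if b = x then 1 else 0)" by metis
  have "linear_map V ground (\<phi> b)" for b
  proof -
    interpret L: Vector_Spaces.linear "scale V" "(*)" "\<phi> b" by (rule \<phi>)
    show ?thesis by (simp add: linear_map_def ground_def L.add L.scale)
  qed
  with \<phi>(2) show ?thesis using that by blast
qed

lemma bilinear_map_product:
  assumes "linear_map V ground f" "linear_map W ground g"
  shows "bilinear_map V W ground (\<lambda>v w. f v * g w)"
  using assms by (auto simp: bilinear_map_def linear_map_def ground_def algebra_simps)

section \<open>Algebras and presentations\<close>

text \<open>The coproduct of \<open>x\<^sup>n\<close> is computed by multiplication with \<open>x\<close> from the left, so powers are unfolded by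
  \<open>pow_Suc\<close> below and not at the right end.\<close>

declare Group.nat_pow_Suc [simp del]

locale algebra_on_carrier =
  fixes A :: "('k::field, 'a::ab_group_add, 'z) bialg_scheme" (structure)
  assumes is_algebra: "is_algebra A"
begin

abbreviation pow :: "'a \<Rightarrow> nat \<Rightarrow> 'a" (infixr \<open>\<up>\<close> 80)
  where "a \<up> n \<equiv> a [^]\<^bsub>mult_monoid A\<^esub> n"

lemma vs: "is_vspace A" and bilinear_mul: "bilinear_map A A A (mul A)"
  and monoid: "Group.monoid (mult_monoid A)"
  using is_algebra by (simp_all add: is_algebra_def)

sublocale M: monoid "mult_monoid A" by (rule monoid)

declare M.nat_pow_Suc [simp del]

lemma mult_monoid_simps [simp]:
  "carrier (mult_monoid A) = carrier A" "one (mult_monoid A) = unity A"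
  "monoid.mult (mult_monoid A) = mul A"
  by (simp_all add: mult_monoid_def)

sublocale VS: vector_space "scale A" using vs by (simp add: is_vspace_def)

lemma closed [simp, intro]:
  "0 \<in> carrier A" "unity A \<in> carrier A"
  "a \<in> carrier A \<Longrightarrow> b \<in> carrier A \<Longrightarrow> a + b \<in> carrier A"
  "a \<in> carrier A \<Longrightarrow> scale A c a \<in> carrier A"
  "a \<in> carrier A \<Longrightarrow> b \<in> carrier A \<Longrightarrow> a \<cdot> b \<in> carrier A"
  "a \<in> carrier A \<Longrightarrow> a \<up> n \<in> carrier A"
  using is_vspace_zero[OF vs] is_vspace_add[OF vs] is_vspace_scale[OF vs]
    M.one_closed M.m_closed M.nat_pow_closed
  by (auto simp: mult_monoid_def)

lemma minus_closed [simp, intro]: "a \<in> carrier A \<Longrightarrow> - a \<in> carrier A"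
  "a \<in> carrier A \<Longrightarrow> b \<in> carrier A \<Longrightarrow> a - b \<in> carrier A"
proof -
  show m: "- a \<in> carrier A" if "a \<in> carrier A" for a
    using closed(4)[of a "-1"] that by simp
  show "a - b \<in> carrier A" if "a \<in> carrier A" "b \<in> carrier A"
    using closed(3)[of a "- b"] that m by simp
qed

lemma unit [simp]: "a \<in> carrier A \<Longrightarrow> unity A \<cdot> a = a" "a \<in> carrier A \<Longrightarrow> a \<cdot> unity A = a"
  using M.l_one M.r_one by (auto simp: mult_monoid_def)

lemma assoc: "a \<in> carrier A \<Longrightarrow> b \<in> carrier A \<Longrightarrow> c \<in> carrier A \<Longrightarrow> a \<cdot> b \<cdot> c = a \<cdot> (b \<cdot> c)"
  using M.m_assoc by (auto simp: mult_monoid_def)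

lemma linear_mul_left: "b \<in> carrier A \<Longrightarrow> linear_map A A (\<lambda>a. a \<cdot> b)"
  and linear_mul_right: "a \<in> carrier A \<Longrightarrow> linear_map A A (\<lambda>b. a \<cdot> b)"
  using bilinear_mapD(1,2)[OF bilinear_mul] by auto

lemma distrib:
  assumes "a \<in> carrier A" "b \<in> carrier A" "c \<in> carrier A"
  shows "(a + b) \<cdot> c = a \<cdot> c + b \<cdot> c" "c \<cdot> (a + b) = c \<cdot> a + c \<cdot> b"
  using linear_mapD(2)[OF linear_mul_left] linear_mapD(2)[OF linear_mul_right] assms by auto

lemma mult_scale:
  assumes "a \<in> carrier A" "b \<in> carrier A"
  shows "scale A c a \<cdot> b = scale A c (a \<cdot> b)" "a \<cdot> scale A c b = scale A c (a \<cdot> b)"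
  using linear_mapD(3)[OF linear_mul_left] linear_mapD(3)[OF linear_mul_right] assms by auto

lemma mult_zero [simp]:
  assumes "a \<in> carrier A" shows "0 \<cdot> a = 0" "a \<cdot> 0 = 0"
  using linear_map_zero[OF vs linear_mul_left] linear_map_zero[OF vs linear_mul_right] assms by auto

lemma pow_Suc:
  assumes "a \<in> carrier A" shows "a \<up> Suc n = a \<cdot> a \<up> n"
  using M.nat_pow_Suc2[of a n] assms by (simp add: mult_monoid_def)

lemma pow_Suc_right: "a \<up> Suc n = a \<up> n \<cdot> a"
  using M.nat_pow_Suc[of a n] by (simp add: mult_monoid_def)

lemma pow_one [simp]: "a \<in> carrier A \<Longrightarrow> a \<up> Suc 0 = a"
  using pow_Suc[of a 0] by (simp add: M.nat_pow_0)

end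

lemma poly_mapping_single_induct [case_names zero single add]:
  assumes "P 0" "\<And>w c. P (Poly_Mapping.single w c)" "\<And>p q. P p \<Longrightarrow> P q \<Longrightarrow> P (p + q)"
  shows "P (p :: 'a \<Rightarrow>\<^sub>0 'b::comm_monoid_add)"
proof (induction p rule: update_induct)
  case const show ?case by (rule assms(1))
next
  case (update f a b)
  have "Poly_Mapping.update a b f = f + Poly_Mapping.single a b"
    using update(1)
    by (intro poly_mapping_eqI) (auto simp: lookup_update lookup_add lookup_single when_def in_keys_iff)
  then show ?case using assms update by simp
qed

lemma poly_mapping_sum_singles:
  "(p :: 'a \<Rightarrow>\<^sub>0 'b::comm_monoid_add) = (\<Sum>w\<in>Poly_Mapping.keys p. Poly_Mapping.single w (Poly_Mapping.lookup p w))"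
proof (rule poly_mapping_eqI)
  fix k
  show "Poly_Mapping.lookup p k =
    Poly_Mapping.lookup (\<Sum>w\<in>Poly_Mapping.keys p. Poly_Mapping.single w (Poly_Mapping.lookup p w)) k"
    by (simp add: lookup_sum lookup_single when_def in_keys_iff)
qed

context algebra_on_carrier
begin

definition monomial :: "('i \<Rightarrow> 'a) \<Rightarrow> 'i list \<Rightarrow> 'a"
  where "monomial \<gamma> w = foldr (\<lambda>i a. \<gamma> i \<cdot> a) w (unity A)"

context
  fixes \<gamma> :: "'i \<Rightarrow> 'a"
  assumes \<gamma>: "\<And>i. \<gamma> i \<in> carrier A"
begin

lemma monomial_closed [simp]: "monomial \<gamma> w \<in> carrier A"
  by (induction w) (auto simp: monomial_def \<gamma>)

lemma monomial_append: "monomial \<gamma> (v @ w) = monomial \<gamma> v \<cdot> monomial \<gamma> w"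
proof (induction v)
  case (Cons i v)
  have "monomial \<gamma> ((i # v) @ w) = \<gamma> i \<cdot> (monomial \<gamma> v \<cdot> monomial \<gamma> w)"
    using Cons by (simp add: monomial_def)
  also have "\<dots> = monomial \<gamma> (i # v) \<cdot> monomial \<gamma> w"
    using assoc[OF \<gamma>[of i] monomial_closed[of v] monomial_closed[of w]]
    by (simp add: monomial_def[of \<gamma> "i # v"] flip: monomial_def[of \<gamma> v])
  finally show ?case .
qed (use monomial_closed[of w] in \<open>simp add: monomial_def\<close>)

lemma eval_free_superset:
  assumes "finite S" "Poly_Mapping.keys p \<subseteq> S"
  shows "eval_free A \<gamma> p = (\<Sum>w\<in>S. scale A (Poly_Mapping.lookup p w) (monomial \<gamma> w))"
  unfolding eval_free_def monomial_def[symmetric]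
  by (rule sum.mono_neutral_left) (use assms in \<open>auto simp: in_keys_iff\<close>)

lemma eval_free_add: "eval_free A \<gamma> (p + q) = eval_free A \<gamma> p + eval_free A \<gamma> q"
proof -
  let ?S = "Poly_Mapping.keys p \<union> Poly_Mapping.keys q"
  have "finite ?S" "Poly_Mapping.keys (p + q) \<subseteq> ?S" using keys_add[of p q] by auto
  then show ?thesis
    by (simp add: eval_free_superset[of ?S] lookup_add VS.scale_left_distrib sum.distrib)
qed

lemma eval_free_single [simp]: "eval_free A \<gamma> (Poly_Mapping.single w c) = scale A c (monomial \<gamma> w)"
  using eval_free_superset[of "{w}" "Poly_Mapping.single w c"] by (simp split: if_splits)

lemma eval_free_zero [simp]: "eval_free A \<gamma> 0 = 0"
  by (simp add: eval_free_def)

lemma eval_free_closed [simp]: "eval_free A \<gamma> p \<in> carrier A"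
  by (induction p rule: poly_mapping_single_induct) (auto simp: eval_free_add)

lemma eval_free_uminus: "eval_free A \<gamma> (- p) = - eval_free A \<gamma> p"
  using eval_free_add[of p "- p"] by (simp add: eq_neg_iff_add_eq_0 add.commute)

lemma eval_free_diff: "eval_free A \<gamma> (p - q) = eval_free A \<gamma> p - eval_free A \<gamma> q"
  using eval_free_add[of p "- q"] by (simp add: eval_free_uminus)

lemma eval_free_sum: "eval_free A \<gamma> (\<Sum>i\<in>I. f i) = (\<Sum>i\<in>I. eval_free A \<gamma> (f i))"
  by (induction I rule: infinite_finite_induct) (auto simp: eval_free_add)

lemma eval_free_mult: "eval_free A \<gamma> (p * q) = eval_free A \<gamma> p \<cdot> eval_free A \<gamma> q"
proof (induction p rule: poly_mapping_single_induct)
  case (single v c)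
  show ?case
    by (induction q rule: poly_mapping_single_induct)
      (auto simp: mult_single plus_list_def monomial_append mult_scale distrib_left eval_free_add distrib)
qed (auto simp: distrib_right eval_free_add distrib)

lemma eval_free_gen [simp]: "eval_free A \<gamma> (gen i) = \<gamma> i"
  by (simp add: gen_def monomial_def \<gamma>)

lemma eval_free_const [simp]: "eval_free A \<gamma> (const c) = scale A c (unity A)"
  by (simp add: const_def monomial_def)

lemma eval_free_one [simp]: "eval_free A \<gamma> 1 = unity A"
  using eval_free_const[of 1] by (simp add: const_def zero_list_def[symmetric])

lemma eval_free_power: "eval_free A \<gamma> (p ^ n) = eval_free A \<gamma> p \<up> n"
proof (induction n)
  case (Suc n)
  then show ?case by (simp only: power_Suc eval_free_mult pow_Suc[OF eval_free_closed])
qed simp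

lemma subalgebra_eval_free: "subalgebra A (range (eval_free A \<gamma>))"
  unfolding subalgebra_def
proof (intro conjI ballI)
  show "VS.subspace (range (eval_free A \<gamma>))"
    unfolding VS.subspace_def
  proof (intro conjI ballI allI)
    show "0 \<in> range (eval_free A \<gamma>)" using eval_free_zero by (metis rangeI)
    show "a + b \<in> range (eval_free A \<gamma>)"
      if "a \<in> range (eval_free A \<gamma>)" "b \<in> range (eval_free A \<gamma>)" for a b
      using that eval_free_add by (auto simp del: eval_free_add) (metis rangeI)
    show "scale A c a \<in> range (eval_free A \<gamma>)" if a: "a \<in> range (eval_free A \<gamma>)" for c a
    proof -
      obtain p where "a = eval_free A \<gamma> p" using a by blast
      then have "scale A c a = eval_free A \<gamma> (const c * p)" by (simp add: eval_free_mult mult_scale)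
      then show ?thesis by blast
    qed
  qed
  show "a \<cdot> b \<in> range (eval_free A \<gamma>)"
    if "a \<in> range (eval_free A \<gamma>)" "b \<in> range (eval_free A \<gamma>)" for a b
    using that by (auto simp flip: eval_free_mult)
  show "unity A \<in> range (eval_free A \<gamma>)" using eval_free_one by (metis rangeI)
qed auto

end

end

definition ideal_cong :: "'a::ring_1 set \<Rightarrow> 'a \<Rightarrow> 'a \<Rightarrow> bool"
  where "ideal_cong X p q \<longleftrightarrow> p - q \<in> two_sided_ideal X"

lemma two_sided_ideal_mult:
  assumes "p \<in> two_sided_ideal X" shows "a * p * b \<in> two_sided_ideal X"
  using assms
proof induction
  case (base x c d)
  have "a * (c * x * d) * b = (a * c) * x * (d * b)" by (simp add: mult.assoc)
  then show ?case using base by (metis two_sided_ideal.base)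
qed (auto simp: algebra_simps intro: two_sided_ideal.intros)

lemma ideal_cong_refl [simp]: "ideal_cong X p p"
  by (simp add: ideal_cong_def two_sided_ideal.zero)

lemma ideal_cong_sym: "ideal_cong X p q \<Longrightarrow> ideal_cong X q p"
  using two_sided_ideal_mult[of "p - q" X "-1" 1] by (simp add: ideal_cong_def)

lemma ideal_cong_trans [trans]: "ideal_cong X p q \<Longrightarrow> ideal_cong X q r \<Longrightarrow> ideal_cong X p r"
  using two_sided_ideal.add[of "p - q" X "q - r"] by (simp add: ideal_cong_def)

lemma ideal_cong_add: "ideal_cong X p q \<Longrightarrow> ideal_cong X p' q' \<Longrightarrow> ideal_cong X (p + p') (q + q')"
  using two_sided_ideal.add[of "p - q" X "p' - q'"] by (simp add: ideal_cong_def algebra_simps)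

lemma ideal_cong_sandwich: "ideal_cong X p q \<Longrightarrow> ideal_cong X (a * p * b) (a * q * b)"
  using two_sided_ideal_mult[of "p - q" X a b] by (simp add: ideal_cong_def algebra_simps)

lemma ideal_cong_mult:
  assumes "ideal_cong X p q" "ideal_cong X p' q'" shows "ideal_cong X (p * p') (q * q')"
  using ideal_cong_trans[of X "p * p'" "q * p'" "q * q'"]
    ideal_cong_sandwich[OF assms(1), of 1 p'] ideal_cong_sandwich[OF assms(2), of q 1] by simp

lemma ideal_cong_power: "ideal_cong X p q \<Longrightarrow> ideal_cong X (p ^ n) (q ^ n)"
  by (induction n) (auto intro: ideal_cong_mult)

lemma ideal_cong_sum:
  "(\<And>i. i \<in> I \<Longrightarrow> ideal_cong X (f i) (g i)) \<Longrightarrow> ideal_cong X (\<Sum>i\<in>I. f i) (\<Sum>i\<in>I. g i)"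
  by (induction I rule: infinite_finite_induct) (auto intro: ideal_cong_add)

lemma const_mult: "const (a * b) = const a * (const b :: ('i, 'k::field) free_algebra)"
  using mult_single[of "[]" a "[]" b, symmetric] by (simp add: const_def plus_list_def)

lemma const_one [simp]: "const 1 = (1 :: ('i, 'k::field) free_algebra)"
  by (simp add: const_def zero_list_def[symmetric])

lemma const_zero [simp]: "const 0 = (0 :: ('i, 'k::field) free_algebra)"
  by (simp add: const_def)

lemma const_add: "const (a + b) = const a + (const b :: ('i, 'k::field) free_algebra)"
  by (simp add: const_def single_add)

lemma const_sum: "const (sum f I) = (\<Sum>i\<in>I. const (f i) :: ('i, 'k::field) free_algebra)"
  by (induction I rule: infinite_finite_induct) (auto simp: const_add)

lemma const_central: "p * const c = const c * (p :: ('i, 'k::field) free_algebra)"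
proof (induction p rule: poly_mapping_single_induct)
  case (single w d)
  then show ?case by (simp add: const_def mult_single mult.commute zero_list_def plus_list_def)
qed (auto simp: algebra_simps)

lemma ideal_cong_commute_power:
  fixes u v :: "('i, 'k::field) free_algebra"
  assumes "ideal_cong X (u * v) (const d * v * u)"
  shows "ideal_cong X (u * v ^ n) (const (d ^ n) * v ^ n * u)"
proof (induction n)
  case (Suc n)
  have "ideal_cong X (u * v * v ^ n) (const d * v * u * v ^ n)"
    by (intro ideal_cong_mult assms ideal_cong_refl)
  also have "const d * v * u * v ^ n = const d * v * (u * v ^ n)" by (simp add: mult.assoc)
  also have "ideal_cong X \<dots> (const d * v * (const (d ^ n) * v ^ n * u))"
    by (intro ideal_cong_mult Suc ideal_cong_refl)
  also have "\<dots> = const d * (v * const (d ^ n)) * v ^ n * u" by (simp only: mult.assoc)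
  also have "\<dots> = const (d ^ Suc n) * v ^ Suc n * u"
    unfolding const_central[of v] by (simp add: const_mult mult.assoc)
  finally show ?case by (simp add: mult.assoc)
qed simp

text \<open>A quantum plane truncated at \<open>x\<^bsup>Nx\<^esup>\<close> and \<open>y\<^bsup>Ny\<^esup>\<close>, on which a group-like element of order \<open>N\<close> acts
  diagonally.\<close>

definition taft_rels ::
    "nat \<Rightarrow> nat \<Rightarrow> nat \<Rightarrow> 'k::field \<Rightarrow> 'k \<Rightarrow> 'k
      \<Rightarrow> ((taft_generator, 'k) free_algebra \<times> (taft_generator, 'k) free_algebra) set"
  where "taft_rels Nx Ny N \<alpha> \<beta> \<gamma> =
    {(gen Gen_x ^ Nx, 0),
     (gen Gen_y ^ Ny, 0),
     (gen Gen_x * gen Gen_y, const \<alpha> * gen Gen_y * gen Gen_x),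
     (gen Gen_g ^ N, 1),
     (gen Gen_g * gen Gen_x, const \<beta> * gen Gen_x * gen Gen_g),
     (gen Gen_g * gen Gen_y, const \<gamma> * gen Gen_y * gen Gen_g)}"

definition normal_word :: "nat \<Rightarrow> nat \<Rightarrow> nat \<Rightarrow> (taft_generator, 'k::field) free_algebra"
  where "normal_word i j l = gen Gen_x ^ i * gen Gen_y ^ j * gen Gen_g ^ l"

context
  fixes Nx Ny N :: nat and \<alpha> \<beta> \<gamma> :: "'k::field" and X
  assumes pos: "Nx > 0" "Ny > 0" "N > 0" and nz: "\<alpha> \<noteq> 0"
  defines "X \<equiv> {l - r | l r. (l, r) \<in> taft_rels Nx Ny N \<alpha> \<beta> \<gamma>}"
begin

lemma taft_rels_cong: "(l, r) \<in> taft_rels Nx Ny N \<alpha> \<beta> \<gamma> \<Longrightarrow> ideal_cong X l r"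
  using two_sided_ideal.base[of "l - r" X 1 1] by (auto simp: ideal_cong_def X_def)

lemma normal_word_Suc_x: "gen Gen_x * normal_word i j l = normal_word (Suc i) j l"
  by (simp add: normal_word_def mult.assoc)

text \<open>The relation between \<open>x\<close> and \<open>y\<close> moves \<open>x\<close> to the right; here it is read backwards, which is
  possible because \<open>\<alpha>\<close> is invertible.\<close>

lemma normal_word_mult_y:
  "ideal_cong X (gen Gen_y * normal_word i j l) (const ((1 / \<alpha>) ^ i) * normal_word i (Suc j) l)"
proof -
  let ?x = "gen Gen_x :: (taft_generator, 'k) free_algebra"
    and ?y = "gen Gen_y :: (taft_generator, 'k) free_algebra"
  have "ideal_cong X (const (1 / \<alpha>) * (?x * ?y)) (const (1 / \<alpha>) * (const \<alpha> * ?y * ?x))"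
    by (intro ideal_cong_mult ideal_cong_refl taft_rels_cong) (simp add: taft_rels_def)
  also have "const (1 / \<alpha>) * (const \<alpha> * ?y * ?x) = ?y * ?x"
    using nz by (simp add: mult.assoc[symmetric] const_mult[symmetric])
  finally have "ideal_cong X (?y * ?x) (const (1 / \<alpha>) * ?x * ?y)"
    by (simp add: ideal_cong_sym mult.assoc)
  from ideal_cong_mult[OF ideal_cong_commute_power[OF this, of i] ideal_cong_refl]
  have "ideal_cong X (?y * ?x ^ i * (?y ^ j * gen Gen_g ^ l))
    (const ((1 / \<alpha>) ^ i) * ?x ^ i * ?y * (?y ^ j * gen Gen_g ^ l))" .
  then show ?thesis by (simp add: normal_word_def mult.assoc)
qed

lemma normal_word_mult_g:
  "ideal_cong X (gen Gen_g * normal_word i j l) (const (\<beta> ^ i * \<gamma> ^ j) * normal_word i j (Suc l))"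
proof -
  let ?x = "gen Gen_x :: (taft_generator, 'k) free_algebra"
    and ?y = "gen Gen_y :: (taft_generator, 'k) free_algebra"
    and ?g = "gen Gen_g :: (taft_generator, 'k) free_algebra"
  have gx: "ideal_cong X (?g * ?x ^ i) (const (\<beta> ^ i) * ?x ^ i * ?g)"
    by (intro ideal_cong_commute_power taft_rels_cong) (simp add: taft_rels_def)
  have gy: "ideal_cong X (?g * ?y ^ j) (const (\<gamma> ^ j) * ?y ^ j * ?g)"
    by (intro ideal_cong_commute_power taft_rels_cong) (simp add: taft_rels_def)
  have "ideal_cong X (?g * ?x ^ i * (?y ^ j * ?g ^ l)) (const (\<beta> ^ i) * ?x ^ i * ?g * (?y ^ j * ?g ^ l))"
    by (intro ideal_cong_mult ideal_cong_refl gx)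
  also have "\<dots> = const (\<beta> ^ i) * ?x ^ i * (?g * ?y ^ j) * ?g ^ l" by (simp only: mult.assoc)
  also have "ideal_cong X \<dots> (const (\<beta> ^ i) * ?x ^ i * (const (\<gamma> ^ j) * ?y ^ j * ?g) * ?g ^ l)"
    by (intro ideal_cong_mult ideal_cong_refl gy)
  also have "\<dots> = const (\<beta> ^ i) * (?x ^ i * const (\<gamma> ^ j)) * ?y ^ j * ?g * ?g ^ l" by (simp only: mult.assoc)
  also have "\<dots> = const (\<beta> ^ i * \<gamma> ^ j) * normal_word i j (Suc l)"
    unfolding const_central[of "?x ^ i"] by (simp add: normal_word_def const_mult mult.assoc)
  finally show ?thesis by (simp add: normal_word_def mult.assoc)
qed

text \<open>The normal words are closed, up to scalars, under multiplication by a generator from the left.\<close>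

lemma word_normal_form: "\<exists>c i j l. ideal_cong X (Poly_Mapping.single w 1) (const c * normal_word i j l)"
proof (induction w)
  case Nil
  show ?case
    by (rule exI[of _ 1], rule exI[of _ 0], rule exI[of _ 0], rule exI[of _ 0])
      (simp add: normal_word_def zero_list_def[symmetric])
next
  case (Cons s w)
  then obtain c i j l where IH: "ideal_cong X (Poly_Mapping.single w 1) (const c * normal_word i j l)"
    by blast
  have "Poly_Mapping.single (s # w) 1 = gen s * (Poly_Mapping.single w 1 :: (taft_generator, 'k) free_algebra)"
    by (simp add: gen_def mult_single plus_list_def)
  also have "ideal_cong X \<dots> (gen s * (const c * normal_word i j l))"
    by (intro ideal_cong_mult ideal_cong_refl IH)
  also have "gen s * (const c * normal_word i j l) = const c * (gen s * normal_word i j l)"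
    by (simp add: mult.assoc[symmetric] const_central)
  finally have 1: "ideal_cong X (Poly_Mapping.single (s # w) 1) (const c * (gen s * normal_word i j l))" .
  have "\<exists>d i' j' l'. ideal_cong X (gen s * normal_word i j l) (const d * normal_word i' j' l')"
  proof (cases s)
    case Gen_g then show ?thesis using normal_word_mult_g by blast
  next
    case Gen_x then show ?thesis
      by (intro exI[of _ 1] exI[of _ "Suc i"] exI[of _ j] exI[of _ l]) (simp add: normal_word_Suc_x)
  next
    case Gen_y then show ?thesis using normal_word_mult_y by blast
  qed
  then obtain d i' j' l' where
    "ideal_cong X (gen s * normal_word i j l) (const d * normal_word i' j' l')" by blast
  with 1 have "ideal_cong X (Poly_Mapping.single (s # w) 1) (const c * (const d * normal_word i' j' l'))"
    by (meson ideal_cong_trans ideal_cong_mult ideal_cong_refl)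
  then show ?case by (metis const_mult mult.assoc)
qed

lemma ideal_cong_power_zero:
  assumes "ideal_cong X (p ^ n) 0" "n \<le> m" shows "ideal_cong X (p ^ m) 0"
proof -
  have "ideal_cong X (p ^ n * p ^ (m - n)) (0 * p ^ (m - n))"
    by (intro ideal_cong_mult assms ideal_cong_refl)
  then show ?thesis using assms(2) by (simp add: power_add[symmetric])
qed

text \<open>An exponent that is too large makes the word vanish for \<open>x\<close> and \<open>y\<close> and can be reduced modulo \<open>N\<close> for \<open>g\<close>;
  a vanishing word is covered by the coefficient \<open>c = 0\<close>.\<close>

lemma reduced_normal_form:
  "\<exists>c i j l. i < Nx \<and> j < Ny \<and> l < N \<and>
     ideal_cong X (Poly_Mapping.single w 1) (const c * normal_word i j l)"
proof -
  obtain c i j l where 1: "ideal_cong X (Poly_Mapping.single w 1) (const c * normal_word i j l)"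
    using word_normal_form by blast
  let ?x = "gen Gen_x :: (taft_generator, 'k) free_algebra"
    and ?y = "gen Gen_y :: (taft_generator, 'k) free_algebra"
    and ?g = "gen Gen_g :: (taft_generator, 'k) free_algebra"
  show ?thesis
  proof (cases "i < Nx \<and> j < Ny")
    case True
    have "ideal_cong X (?g ^ N) 1" by (rule taft_rels_cong) (simp add: taft_rels_def)
    then have "ideal_cong X ((?g ^ N) ^ (l div N) * ?g ^ (l mod N)) (1 ^ (l div N) * ?g ^ (l mod N))"
      by (intro ideal_cong_mult ideal_cong_power ideal_cong_refl)
    then have "ideal_cong X (?g ^ l) (?g ^ (l mod N))"
      by (simp add: power_mult[symmetric] power_add[symmetric])
    then have "ideal_cong X (const c * (?x ^ i * ?y ^ j * ?g ^ l)) (const c * (?x ^ i * ?y ^ j * ?g ^ (l mod N)))"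
      by (intro ideal_cong_mult ideal_cong_refl)
    then have "ideal_cong X (Poly_Mapping.single w 1) (const c * normal_word i j (l mod N))"
      using 1 ideal_cong_trans unfolding normal_word_def by blast
    then show ?thesis using True pos by (meson mod_less_divisor)
  next
    case False
    have x0: "ideal_cong X (?x ^ Nx) 0" and y0: "ideal_cong X (?y ^ Ny) 0"
      by (rule taft_rels_cong, simp add: taft_rels_def)+
    have "ideal_cong X (?x ^ i * ?y ^ j) 0"
    proof (cases "i < Nx")
      case True
      then have "ideal_cong X (?x ^ i * ?y ^ j) (?x ^ i * 0)"
        using False by (intro ideal_cong_mult ideal_cong_refl ideal_cong_power_zero[OF y0]) auto
      then show ?thesis by simp
    next
      case False
      then have "ideal_cong X (?x ^ i * ?y ^ j) (0 * ?y ^ j)"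
        by (intro ideal_cong_mult ideal_cong_refl ideal_cong_power_zero[OF x0]) auto
      then show ?thesis by simp
    qed
    then have "ideal_cong X (const c * ((?x ^ i * ?y ^ j) * ?g ^ l)) (const c * (0 * ?g ^ l))"
      by (intro ideal_cong_mult ideal_cong_refl)
    then have "ideal_cong X (const c * normal_word i j l) (const 0 * normal_word 0 0 0)"
      by (simp add: normal_word_def)
    then have "ideal_cong X (Poly_Mapping.single w 1) (const 0 * normal_word 0 0 0)"
      using 1 ideal_cong_trans by blast
    then show ?thesis using pos by blast
  qed
qed

text \<open>The quotient of the free algebra by the relations has dimension at most \<open>Nx Ny N\<close>.\<close>

lemma free_algebra_normal_form:
  "\<exists>c. ideal_cong X p (\<Sum>(i, j, l)\<in>{..<Nx} \<times> {..<Ny} \<times> {..<N}. const (c i j l) * normal_word i j l)"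
proof -
  let ?K = "Poly_Mapping.keys p" and ?B = "{..<Nx} \<times> {..<Ny} \<times> {..<N}"
  obtain c n where n: "\<And>w. n w \<in> ?B"
    and c: "\<And>w. ideal_cong X (Poly_Mapping.single w 1)
      (const (c w) * (case n w of (i, j, l) \<Rightarrow> normal_word i j l))"
  proof -
    have "\<forall>w. \<exists>q. snd q \<in> ?B \<and> ideal_cong X (Poly_Mapping.single w 1)
      (const (fst q) * (case snd q of (i, j, l) \<Rightarrow> normal_word i j l))"
      using reduced_normal_form by fastforce
    then obtain f where "\<forall>w. snd (f w) \<in> ?B \<and> ideal_cong X (Poly_Mapping.single w 1)
      (const (fst (f w)) * (case snd (f w) of (i, j, l) \<Rightarrow> normal_word i j l))" by metis
    then show ?thesis using that[of "\<lambda>w. snd (f w)" "\<lambda>w. fst (f w)"] by blast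
  qed
  define d where "d = (\<lambda>b. \<Sum>w\<in>{w \<in> ?K. n w = b}. Poly_Mapping.lookup p w * c w)"
  define nw where "nw = (\<lambda>(i, j, l). normal_word i j l :: (taft_generator, 'k) free_algebra)"
  have "p = (\<Sum>w\<in>?K. const (Poly_Mapping.lookup p w) * Poly_Mapping.single w 1)"
    using poly_mapping_sum_singles[of p] by (simp add: const_def mult_single plus_list_def)
  also have "ideal_cong X \<dots> (\<Sum>w\<in>?K. const (Poly_Mapping.lookup p w) * (const (c w) * nw (n w)))"
    using c unfolding nw_def by (intro ideal_cong_sum ideal_cong_mult ideal_cong_refl)
  also have "\<dots> = (\<Sum>b\<in>?B. \<Sum>w\<in>{w \<in> ?K. n w = b}. const (Poly_Mapping.lookup p w) * (const (c w) * nw (n w)))"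
    by (rule sum.group[symmetric]) (simp_all, use n in blast)
  also have "\<dots> = (\<Sum>b\<in>?B. const (d b) * nw b)"
    by (intro sum.cong refl)
      (simp add: d_def const_sum const_mult sum_distrib_right mult.assoc)
  also have "\<dots> = (\<Sum>(i, j, l)\<in>?B. const (d (i, j, l)) * normal_word i j l)"
    by (intro sum.cong refl) (auto simp: nw_def)
  finally show ?thesis by (intro exI[of _ "\<lambda>i j l. d (i, j, l)"])
qed

end

text \<open>If evaluation kills \<open>p\<close>, it kills the normal form of \<open>p\<close>. By independence of the
  monomials in \<open>A\<close> this normal form is zero, and so \<open>p\<close> lies in the ideal.\<close>

lemma (in algebra_on_carrier) presented_by_taft_rels:
  assumes carrier: "g \<in> carrier A" "x \<in> carrier A" "y \<in> carrier A"
    and pos: "Nx > 0" "Ny > 0" "N > 0" and nz: "\<alpha> \<noteq> 0"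
    and rels: "x \<up> Nx = 0" "y \<up> Ny = 0" "x \<cdot> y = scale A \<alpha> (y \<cdot> x)" "g \<up> N = unity A"
      "g \<cdot> x = scale A \<beta> (x \<cdot> g)" "g \<cdot> y = scale A \<gamma> (y \<cdot> g)"
    and generated: "\<And>Y. subalgebra A Y \<Longrightarrow> g \<in> Y \<Longrightarrow> x \<in> Y \<Longrightarrow> y \<in> Y \<Longrightarrow> carrier A \<subseteq> Y"
    and independent: "\<And>c. (\<Sum>(i, j, l)\<in>{..<Nx} \<times> {..<Ny} \<times> {..<N}.
        scale A (c i j l) (x \<up> i \<cdot> y \<up> j \<cdot> g \<up> l)) = 0 \<Longrightarrow>
        (\<forall>i<Nx. \<forall>j<Ny. \<forall>l<N. c i j l = 0)"
  shows "presented_by A (case_taft_generator g x y) (taft_rels Nx Ny N \<alpha> \<beta> \<gamma>)"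
proof -
  let ?\<gamma> = "case_taft_generator g x y" and ?R = "taft_rels Nx Ny N \<alpha> \<beta> \<gamma>"
  let ?X = "{l - r | l r. (l, r) \<in> ?R}"
  have cl: "?\<gamma> i \<in> carrier A" for i using carrier by (cases i) auto
  note ev [simp] = eval_free_mult[OF cl] eval_free_power[OF cl] eval_free_diff[OF cl]
    eval_free_add[OF cl] eval_free_sum[OF cl] eval_free_gen[OF cl] eval_free_const[OF cl]
    eval_free_one[OF cl] eval_free_zero[OF cl] eval_free_closed[OF cl]
  have gens: "eval_free A ?\<gamma> (gen i) = ?\<gamma> i" for i by simp
  have vanish: "eval_free A ?\<gamma> p = 0" if "p \<in> two_sided_ideal ?X" for p
    using that
  proof induction
    case (base r a b)
    then have "eval_free A ?\<gamma> r = 0"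
      by (auto simp: taft_rels_def rels carrier mult_scale)
    then show ?case by simp
  qed auto
  have "p \<in> two_sided_ideal ?X" if "eval_free A ?\<gamma> p = 0" for p
  proof -
    let ?s = "\<lambda>c. \<Sum>(i, j, l)\<in>{..<Nx} \<times> {..<Ny} \<times> {..<N}. const (c i j l) * normal_word i j l
       :: (taft_generator, 'k) free_algebra"
    obtain c where c: "ideal_cong ?X p (?s c)"
      using free_algebra_normal_form[OF pos nz] by blast
    then have "eval_free A ?\<gamma> (p - ?s c) = 0"
      using vanish by (simp only: ideal_cong_def)
    then have "eval_free A ?\<gamma> (?s c) = 0"
      using that eval_free_diff[OF cl, where p = p and q = "?s c"] by (simp only: diff_0 neg_equal_0_iff_equal)
    moreover have "eval_free A ?\<gamma> (?s c) = (\<Sum>(i, j, l)\<in>{..<Nx} \<times> {..<Ny} \<times> {..<N}.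
        scale A (c i j l) (x \<up> i \<cdot> y \<up> j \<cdot> g \<up> l))"
      unfolding eval_free_sum[OF cl]
      by (intro sum.cong refl) (auto simp: normal_word_def mult_scale carrier)
    ultimately have "\<forall>i<Nx. \<forall>j<Ny. \<forall>l<N. c i j l = 0" using independent by simp
    then have "?s c = 0" by (intro sum.neutral) auto
    with c show ?thesis by (simp add: ideal_cong_def)
  qed
  with vanish have "{p. eval_free A ?\<gamma> p = 0} = two_sided_ideal ?X" by blast
  moreover have "eval_free A ?\<gamma> ` UNIV = carrier A"
  proof
    show "carrier A \<subseteq> eval_free A ?\<gamma> ` UNIV"
    proof (rule generated[OF subalgebra_eval_free[OF cl]])
      show "g \<in> range (eval_free A ?\<gamma>)" "x \<in> range (eval_free A ?\<gamma>)" "y \<in> range (eval_free A ?\<gamma>)"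
        using gens[of Gen_g] gens[of Gen_x] gens[of Gen_y] by (metis rangeI taft_generator.case)+
    qed
  qed auto
  ultimately show ?thesis using cl by (simp add: presented_by_def)
qed

section \<open>Gaussian binomial coefficients\<close>

definition qint :: "'k::field \<Rightarrow> nat \<Rightarrow> 'k"
  where "qint q n = (\<Sum>i<n. q ^ i)"

fun qbinomial :: "'k::field \<Rightarrow> nat \<Rightarrow> nat \<Rightarrow> 'k"
  where "qbinomial q n 0 = 1"
  | "qbinomial q 0 (Suc k) = 0"
  | "qbinomial q (Suc n) (Suc k) = qbinomial q n k + q ^ Suc k * qbinomial q n (Suc k)"

lemma qint_0 [simp]: "qint q 0 = 0" and qint_Suc: "qint q (Suc n) = qint q n + q ^ n"
  by (simp_all add: qint_def)

lemma qint_add: "qint q (m + n) = qint q m + q ^ m * qint q n"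
  by (induction n) (simp_all add: qint_Suc algebra_simps power_add)

lemma qint_geometric: "(q - 1) * qint q n = q ^ n - 1"
  by (induction n) (simp_all add: qint_Suc algebra_simps)

lemma qbinomial_eq_0: "n < k \<Longrightarrow> qbinomial q n k = 0"
  by (induction q n k rule: qbinomial.induct) auto

lemma qbinomial_self [simp]: "qbinomial q n n = 1"
  by (induction n) (auto simp: qbinomial_eq_0)

text \<open>The ratio of neighbouring coefficients, in a form without division since the factors vanish at
  roots of unity. The induction also yields the absorption rule \<open>*\<close>, which is the first half of the step.\<close>

lemma qbinomial_step:
  "k \<le> n \<Longrightarrow> qint q (Suc k) * qbinomial q n (Suc k) = qint q (n - k) * qbinomial q n k"
proof (induction n arbitrary: k)
  case 0
  then show ?case by simp
next
  case (Suc n)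
  have *: "qint q (Suc k) * qbinomial q (Suc n) (Suc k) = qint q (Suc n) * qbinomial q n k" if "k \<le> n" for k
  proof -
    have "qint q (Suc k) * qbinomial q (Suc n) (Suc k) =
        qint q (Suc k) * qbinomial q n k + q ^ Suc k * (qint q (Suc k) * qbinomial q n (Suc k))"
      by (simp add: algebra_simps)
    also have "\<dots> = (qint q (Suc k) + q ^ Suc k * qint q (n - k)) * qbinomial q n k"
      unfolding Suc.IH[OF that] by (simp only: algebra_simps)
    also have "qint q (Suc k) + q ^ Suc k * qint q (n - k) = qint q (Suc n)"
      using qint_add[of q "Suc k" "n - k"] that by simp
    finally show ?thesis .
  qed
  show ?case
  proof (cases "k = Suc n")
    case True
    then show ?thesis by (simp add: qbinomial_eq_0)
  next
    case False
    then have k: "k \<le> n" using Suc.prems by simp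
    show ?thesis
    proof (cases k)
      case 0
      then show ?thesis using *[OF k] by simp
    next
      case (Suc k')
      have "qint q (Suc n - k) * qbinomial q (Suc n) k =
          qint q (n - k') * qbinomial q n k' + q ^ Suc k' * qint q (n - k') * qbinomial q n (Suc k')"
        using Suc by (simp add: algebra_simps)
      also have "qint q (n - k') * qbinomial q n k' = qint q (Suc k') * qbinomial q n (Suc k')"
        using Suc.IH[of k'] k Suc by simp
      also have "qint q (Suc k') * qbinomial q n (Suc k') + q ^ Suc k' * qint q (n - k') * qbinomial q n (Suc k') =
          (qint q (Suc k') + q ^ Suc k' * qint q (n - k')) * qbinomial q n k"
        using Suc by (simp only: algebra_simps)
      also have "qint q (Suc k') + q ^ Suc k' * qint q (n - k') = qint q (Suc n)"
        using qint_add[of q "Suc k'" "n - k'"] k Suc by simp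
      finally show ?thesis using *[OF k] by simp
    qed
  qed
qed

definition has_order :: "'k::field \<Rightarrow> nat \<Rightarrow> bool"
  where "has_order q n \<longleftrightarrow> 0 < n \<and> q ^ n = 1 \<and> (\<forall>m. 0 < m \<and> m < n \<longrightarrow> q ^ m \<noteq> 1)"

lemma qint_nonzero: "has_order q n \<Longrightarrow> 0 < m \<Longrightarrow> m < n \<Longrightarrow> qint q m \<noteq> 0"
  using qint_geometric[of q m] by (auto simp: has_order_def)

lemma qint_order_eq_0: "has_order q n \<Longrightarrow> q \<noteq> 1 \<Longrightarrow> qint q n = 0"
  using qint_geometric[of q n] by (auto simp: has_order_def)

text \<open>At a primitive \<open>n\<close>-th root of unity the factor \<open>qint q n\<close> vanishes, which makes the coefficient for \<open>k = 1\<close> zero;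
  the factors \<open>qint q k\<close> that would have to be cancelled to reach larger \<open>k\<close> do not vanish.\<close>

lemma qbinomial_order_eq_0:
  assumes "has_order q n" "q \<noteq> 1" "0 < k" "k < n" shows "qbinomial q n k = 0"
  using assms(3,4)
proof (induction k)
  case (Suc k)
  have "qint q (Suc k) * qbinomial q n (Suc k) = qint q (n - k) * qbinomial q n k"
    using Suc.prems by (intro qbinomial_step) simp
  also have "\<dots> = 0"
    using Suc qint_order_eq_0[OF assms(1,2)] by (cases "k = 0") auto
  finally show ?case using qint_nonzero[OF assms(1), of "Suc k"] Suc.prems by simp
qed simp

section \<open>Graded components\<close>

lemma sum_support:
  "finite S \<Longrightarrow> {n. f n \<noteq> 0} \<subseteq> S \<Longrightarrow> (\<Sum>n | f n \<noteq> 0. f n) = (\<Sum>n\<in>S. f n)"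
  for f :: "'i \<Rightarrow> 'a::ab_group_add"
  by (rule sum.mono_neutral_left) auto

definition graded_component :: "(nat \<Rightarrow> 'v::ab_group_add set) \<Rightarrow> 'v \<Rightarrow> nat \<Rightarrow> 'v"
  where "graded_component gr v =
    (THE f. (\<forall>n. f n \<in> gr n) \<and> finite {n. f n \<noteq> 0} \<and> v = (\<Sum>n | f n \<noteq> 0. f n))"

context
  fixes V :: "('k::field, 'v::ab_group_add, 'z) vspace_scheme" and gr
  assumes V: "is_vspace V" and ds: "direct_sum_decomposition V gr"
begin

lemma gr_subspace: "module.subspace (scale V) (gr n)" and gr_carrier: "v \<in> gr n \<Longrightarrow> v \<in> carrier V"
  using ds by (auto simp: direct_sum_decomposition_def)

lemma gr_vs: "is_vspace \<lparr>carrier = gr n, scale = scale V\<rparr>"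
  using V gr_subspace by (simp add: is_vspace_def)

lemma gr_zero [simp]: "0 \<in> gr n"
  and gr_add: "u \<in> gr n \<Longrightarrow> v \<in> gr n \<Longrightarrow> u + v \<in> gr n"
  and gr_scale: "u \<in> gr n \<Longrightarrow> scale V c u \<in> gr n"
  using is_vspace_zero[OF gr_vs[of n]] is_vspace_add[OF gr_vs[of n]] is_vspace_scale[OF gr_vs[of n]]
  by simp_all

lemma graded_component:
  assumes "v \<in> carrier V"
  shows "graded_component gr v n \<in> gr n" "finite {n. graded_component gr v n \<noteq> 0}"
    "v = (\<Sum>n | graded_component gr v n \<noteq> 0. graded_component gr v n)"
proof -
  have "\<exists>!f. (\<forall>n. f n \<in> gr n) \<and> finite {n. f n \<noteq> 0} \<and> v = (\<Sum>n | f n \<noteq> 0. f n)"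
    using ds assms unfolding direct_sum_decomposition_def by blast
  from theI'[OF this, folded graded_component_def]
  show "graded_component gr v n \<in> gr n" "finite {n. graded_component gr v n \<noteq> 0}"
    "v = (\<Sum>n | graded_component gr v n \<noteq> 0. graded_component gr v n)" by blast+
qed

lemma graded_component_unique:
  assumes "v \<in> carrier V" "\<And>n. f n \<in> gr n" "finite S" "{n. f n \<noteq> 0} \<subseteq> S" "v = (\<Sum>n\<in>S. f n)"
  shows "graded_component gr v = f"
proof -
  have ex: "\<exists>!f. (\<forall>n. f n \<in> gr n) \<and> finite {n. f n \<noteq> 0} \<and> v = (\<Sum>n | f n \<noteq> 0. f n)"
    using ds assms(1) unfolding direct_sum_decomposition_def by blast
  have "(\<forall>n. f n \<in> gr n) \<and> finite {n. f n \<noteq> 0} \<and> v = (\<Sum>n | f n \<noteq> 0. f n)"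
    using assms(2,5) finite_subset[OF assms(4,3)] sum_support[OF assms(3,4)] by simp
  with ex show ?thesis unfolding graded_component_def by (intro the1_equality)
qed

lemma graded_component_homogeneous:
  assumes "v \<in> gr n" shows "graded_component gr v = (\<lambda>m. if m = n then v else 0)"
  by (rule graded_component_unique[of _ _ "{n}"]) (use assms gr_carrier in auto)

lemma linear_graded_component: "linear_map V V (\<lambda>v. graded_component gr v n)"
  unfolding linear_map_def
proof (intro conjI ballI allI)
  fix u v c assume u: "u \<in> carrier V" and v: "v \<in> carrier V"
  let ?c = "graded_component gr"
  interpret vector_space "scale V" using V by (simp add: is_vspace_def)
  let ?S = "{n. ?c u n \<noteq> 0} \<union> {n. ?c v n \<noteq> 0}"
  have S: "finite ?S" using graded_component(2)[OF u] graded_component(2)[OF v] by simp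
  have su: "u = (\<Sum>n\<in>?S. ?c u n)" and sv: "v = (\<Sum>n\<in>?S. ?c v n)"
    using graded_component(3)[OF u] graded_component(3)[OF v] sum_support[OF S, of "?c u"] sum_support[OF S, of "?c v"]
    by auto
  have "?c (u + v) = (\<lambda>n. ?c u n + ?c v n)"
    by (rule graded_component_unique[OF _ _ S])
      (use graded_component(1)[OF u] graded_component(1)[OF v] u v su sv
       in \<open>auto simp: sum.distrib intro: gr_add is_vspace_add[OF V]\<close>)
  then show "?c (u + v) n = ?c u n + ?c v n" by simp
  have "scale V c u = (\<Sum>n\<in>?S. scale V c (?c u n))"
    using arg_cong[OF su, of "scale V c"] by (simp only: scale_sum_right)
  then have "?c (scale V c u) = (\<lambda>n. scale V c (?c u n))"
    by (intro graded_component_unique[OF is_vspace_scale[OF V u] _ S])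
      (use graded_component(1)[OF u] gr_scale in auto)
  then show "?c (scale V c u) n = scale V c (?c u n)" by simp
next
  fix v assume "v \<in> carrier V"
  then show "graded_component gr v n \<in> carrier V" using graded_component(1) gr_carrier by blast
qed

end

section \<open>The Nichols algebra of a quantum plane\<close>

lemma sweedler_add_fun:
  "sweedler V W t (\<lambda>v w. f v w + g v w) = sweedler V W t f + sweedler V W t g"
  by (simp add: sweedler_tensor_rep case_prod_unfold sum_list_addf)

lemma two_cases: "(i :: 2) = 1 \<or> i = 2"
proof -
  have "card {1, 2 :: 2} = 2" by simp
  then have "{1, 2 :: 2} = UNIV" by (intro card_subset_eq) auto
  then show ?thesis by blast
qed

text \<open>The facts about a Nichols algebra that determine its relations. The \<open>w\<^sub>j\<close> are independent
  primitive elements, \<open>\<tau> j\<close> is the action of the degree of \<open>w\<^sub>j\<close>, and \<open>q\<close> is the matrix of the braiding. The last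
  assumption is the multiplicativity of the coproduct, specialised to left multiplication by the primitive
  element \<open>w\<^sub>j\<close>.\<close>

locale quantum_plane = algebra_on_carrier R
  for R :: "('k::field, 'r::ab_group_add, 'z) bialg_scheme" (structure) +
  fixes gr :: "nat \<Rightarrow> 'r set" and w :: "2 \<Rightarrow> 'r" and \<tau> :: "2 \<Rightarrow> 'r \<Rightarrow> 'r" and q :: "2 \<Rightarrow> 2 \<Rightarrow> 'k"
  assumes comul_linear: "linear_map R (tensor_space R R) (comul R)"
    and counity_linear: "linear_map R ground (counity R)"
    and counity_right: "\<And>r. r \<in> carrier R \<Longrightarrow>
      sweedler R R (comul R r) (\<lambda>a b. scale R (counity R b) a) = r"
    and counity_unity: "counity R (unity R) = 1"
    and comul_unity: "comul R (unity R) = tens R R (unity R) (unity R)"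
    and decomposition: "direct_sum_decomposition R gr"
    and gr_0: "gr 0 = module.span (scale R) {unity R}"
    and gr_1: "gr 1 = primitives R"
    and gr_mult: "\<And>m n r s. r \<in> gr m \<Longrightarrow> s \<in> gr n \<Longrightarrow> r \<cdot> s \<in> gr (m + n)"
    and counity_gr: "\<And>n r. n > 0 \<Longrightarrow> r \<in> gr n \<Longrightarrow> counity R r = 0"
    and w_gr: "\<And>j. w j \<in> gr 1"
    and w_independent: "inj w" "\<not> module.dependent (scale R) (range w)"
    and \<tau>_linear: "\<And>j. linear_map R R (\<tau> j)"
    and \<tau>_mult: "\<And>j r s. r \<in> carrier R \<Longrightarrow> s \<in> carrier R \<Longrightarrow> \<tau> j (r \<cdot> s) = \<tau> j r \<cdot> \<tau> j s"
    and \<tau>_unity: "\<And>j. \<tau> j (unity R) = unity R"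
    and \<tau>_w: "\<And>j k. \<tau> j (w k) = scale R (q j k) (w k)"
    and comul_mult: "\<And>j s. s \<in> carrier R \<Longrightarrow> comul R (w j \<cdot> s) =
      sweedler R R (comul R s) (\<lambda>s1 s2. tens R R (w j \<cdot> s1) s2 + tens R R (\<tau> j s1) (w j \<cdot> s2))"
begin

notation pow (infixr \<open>\<up>\<close> 80)

lemma gr_closed: "r \<in> gr n \<Longrightarrow> r \<in> carrier R"
  by (rule gr_carrier[OF vs decomposition])

lemma w_closed [simp]: "w j \<in> carrier R"
  by (rule gr_closed[OF w_gr])

lemma \<tau>_closed [simp]: "r \<in> carrier R \<Longrightarrow> \<tau> j r \<in> carrier R"
  by (rule linear_mapD(1)[OF \<tau>_linear])

lemma comul_closed [simp]: "r \<in> carrier R \<Longrightarrow> comul R r \<in> carrier (tensor_space R R)"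
  by (rule linear_mapD(1)[OF comul_linear])

lemma unity_gr: "unity R \<in> gr 0"
  by (simp add: gr_0 VS.span_base)

lemma pow_gr: "w j \<up> n \<in> gr n"
proof (induction n)
  case (Suc n)
  then show ?case using gr_mult[OF w_gr Suc, of j] by (simp add: pow_Suc)
qed (simp add: unity_gr)

lemma \<tau>_pow: "\<tau> j (w k \<up> n) = scale R (q j k ^ n) (w k \<up> n)"
proof (induction n)
  case (Suc n)
  have "\<tau> j (w k \<up> Suc n) = scale R (q j k) (w k) \<cdot> scale R (q j k ^ n) (w k \<up> n)"
    using \<tau>_mult[of "w k" "w k \<up> n" j] by (simp only: pow_Suc[OF w_closed] \<tau>_w Suc closed w_closed)
  also have "\<dots> = scale R (q j k ^ Suc n) (w k \<up> Suc n)"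
    by (simp only: pow_Suc[OF w_closed] mult_scale closed w_closed VS.scale_scale power_Suc2)
  finally show ?case .
qed (simp add: \<tau>_unity)

text \<open>The primitive elements of a Nichols algebra are those of degree one; this is what forces the
  relations.\<close>

lemma primitive_eq_0:
  assumes "r \<in> gr n" "n \<noteq> 1" "r \<in> primitives R" shows "r = 0"
proof -
  have "r \<in> gr 1" using assms(3) gr_1 by simp
  then have "(if n = 1 then r else 0) = graded_component gr r n"
    using graded_component_homogeneous[OF vs decomposition] by metis
  also have "\<dots> = r"
    using graded_component_homogeneous[OF vs decomposition assms(1)] by simp
  finally show ?thesis using assms(2) by simp
qed

lemma bilinear_comul_mult:
  "bilinear_map R R (tensor_space R R) (\<lambda>s1 s2. tens R R (w j \<cdot> s1) s2 + tens R R (\<tau> j s1) (w j \<cdot> s2))"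
proof -
  note T = is_vspace_tensor_space[of R R]
  have b: "bilinear_map R R (tensor_space R R) (\<lambda>s1 s2. tens R R (f s1) (g s2))"
    if "linear_map R R f" "linear_map R R g" for f g
    by (rule bilinear_map_comp[OF bilinear_map_tens that])
  have 1: "bilinear_map R R (tensor_space R R) (\<lambda>s1 s2. tens R R (w j \<cdot> s1) s2)"
    by (intro b linear_mul_right linear_map_id w_closed)
  have 2: "bilinear_map R R (tensor_space R R) (\<lambda>s1 s2. tens R R (\<tau> j s1) (w j \<cdot> s2))"
    by (intro b linear_mul_right \<tau>_linear w_closed)
  show ?thesis
    by (intro bilinear_mapI linear_map_add_fun[OF T] bilinear_mapD[OF 1] bilinear_mapD[OF 2])
qed

lemma comul_w: "comul R (w j) = tens R R (w j) (unity R) + tens R R (unity R) (w j)"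
  using w_gr[of j] unfolding gr_1 primitives_def by simp

lemma tens_scale:
  assumes "r \<in> carrier R" "s \<in> carrier R"
  shows "tens R R (scale R c r) s = tscale c (tens R R r s)"
    "tens R R r (scale R c s) = tscale c (tens R R r s)"
  using linear_mapD(3)[OF linear_map_tens_left[OF assms(2)] assms(1)]
    linear_mapD(3)[OF linear_map_tens_right[OF assms(1)] assms(2)] by simp_all

text \<open>Left multiplication by \<open>\<Delta> w\<^sub>j\<close> is the sum of the operators \<open>w\<^sub>j \<otimes> 1\<close> and \<open>\<tau>\<^sub>j \<otimes> w\<^sub>j\<close>, and the
  second commutes with the first up to \<open>q\<^sub>j\<^sub>j\<close>; hence the Gaussian binomial formula.\<close>

lemma comul_pow:
  "comul R (w j \<up> n) =
    (\<Sum>i\<le>n. tscale (qbinomial (q j j) n i) (tens R R (w j \<up> i) (w j \<up> (n - i))))"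
proof (induction n)
  case 0
  show ?case by (simp add: comul_unity)
next
  case (Suc n)
  let ?T = "\<lambda>i k. tens R R (w j \<up> i) (w j \<up> k)" and ?G = "qbinomial (q j j)"
  let ?F = "\<lambda>s1 s2. tens R R (w j \<cdot> s1) s2 + tens R R (\<tau> j s1) (w j \<cdot> s2)"
  have T: "?T i k \<in> carrier (tensor_space R R)" for i k by (intro tens_in_tensor_space) auto
  note lin = linear_map_sweedler[OF bilinear_comul_mult[of j] vs is_vspace_tensor_space]
  have F: "sweedler R R (tscale c (?T i k)) ?F =
    tscale c (?T (Suc i) k) + tscale (c * q j j ^ i) (?T i (Suc k))" for c i k
  proof -
    have "sweedler R R (tscale c (?T i k)) ?F = tscale c (sweedler R R (?T i k) ?F)"
      using linear_mapD(3)[OF lin T] by simp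
    also have "sweedler R R (?T i k) ?F = ?F (w j \<up> i) (w j \<up> k)"
      by (rule sweedler_tens[OF bilinear_comul_mult is_vspace_tensor_space]) auto
    also have "\<dots> = ?T (Suc i) k + tscale (q j j ^ i) (?T i (Suc k))"
      by (simp add: \<tau>_pow tens_scale pow_Suc)
    finally show ?thesis by (simp only: tsc.scale_right_distrib tsc.scale_scale)
  qed
  have "comul R (w j \<up> Suc n) = sweedler R R (comul R (w j \<up> n)) ?F"
    unfolding pow_Suc[OF w_closed] by (rule comul_mult) auto
  also have "\<dots> = (\<Sum>i\<le>n. sweedler R R (tscale (?G n i) (?T i (n - i))) ?F)"
    unfolding Suc
    by (rule linear_map_sum[OF is_vspace_tensor_space lin])
      (use T is_vspace_scale[OF is_vspace_tensor_space, of "?T _ _" R R] in auto)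
  also have "\<dots> = (\<Sum>i\<le>n. tscale (?G n i) (?T (Suc i) (n - i))) +
      (\<Sum>i\<le>n. tscale (?G n i * q j j ^ i) (?T i (Suc n - i)))"
    unfolding F sum.distrib by (simp add: Suc_diff_le)
  also have "(\<Sum>i\<le>n. tscale (?G n i * q j j ^ i) (?T i (Suc n - i))) =
      (\<Sum>i\<le>Suc n. tscale (?G n i * q j j ^ i) (?T i (Suc n - i)))"
    by (simp add: qbinomial_eq_0)
  also have "\<dots> = ?T 0 (Suc n) + (\<Sum>i\<le>n. tscale (?G n (Suc i) * q j j ^ Suc i) (?T (Suc i) (n - i)))"
    by (subst sum.atMost_Suc_shift) simp
  also have "(\<Sum>i\<le>n. tscale (?G n i) (?T (Suc i) (n - i))) +
      (?T 0 (Suc n) + (\<Sum>i\<le>n. tscale (?G n (Suc i) * q j j ^ Suc i) (?T (Suc i) (n - i)))) =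
      ?T 0 (Suc n) + (\<Sum>i\<le>n. tscale (?G (Suc n) (Suc i)) (?T (Suc i) (n - i)))"
    by (simp add: sum.distrib[symmetric] tsc.scale_left_distrib algebra_simps)
  also have "\<dots> = (\<Sum>i\<le>Suc n. tscale (?G (Suc n) i) (?T i (Suc n - i)))"
    by (subst sum.atMost_Suc_shift) simp
  finally show ?case .
qed

lemma pow_order_eq_0:
  assumes "has_order (q j j) n" "q j j \<noteq> 1" shows "w j \<up> n = 0"
proof (rule primitive_eq_0[OF pow_gr])
  show "n \<noteq> 1" using assms by (auto simp: has_order_def)
  let ?f = "\<lambda>i. tscale (qbinomial (q j j) n i) (tens R R (w j \<up> i) (w j \<up> (n - i)))"
  have "n > 0" using assms by (simp add: has_order_def)
  have "(\<Sum>i\<le>n. ?f i) = (\<Sum>i\<in>{0, n}. ?f i)"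
    by (rule sum.mono_neutral_right) (auto simp: qbinomial_order_eq_0[OF assms])
  also have "\<dots> = tens R R (w j \<up> n) (unity R) + tens R R (unity R) (w j \<up> n)"
    using \<open>n > 0\<close> by (simp add: add.commute)
  finally show "w j \<up> n \<in> primitives R" by (simp add: primitives_def comul_pow)
qed

text \<open>In the coproduct of the skew commutator, the terms \<open>w\<^sub>k \<otimes> w\<^sub>j\<close> cancel by the choice of the
  coefficient and the terms \<open>w\<^sub>j \<otimes> w\<^sub>k\<close> because \<open>q\<^sub>j\<^sub>k q\<^sub>k\<^sub>j = 1\<close>.\<close>

lemma skew_commute:
  assumes "j \<noteq> k" "q j k * q k j = 1" shows "w j \<cdot> w k = scale R (q j k) (w k \<cdot> w j)"
proof -
  let ?u = "unity R" and ?t = "tens R R"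
  have c: "comul R (w j \<cdot> w k) =
    ?t (w j \<cdot> w k) ?u + tscale (q j k) (?t (w k) (w j)) + ?t (w j) (w k) + ?t ?u (w j \<cdot> w k)" for j k
  proof -
    let ?F = "\<lambda>s1 s2. ?t (w j \<cdot> s1) s2 + ?t (\<tau> j s1) (w j \<cdot> s2)"
    note ev = sweedler_tens[OF bilinear_comul_mult is_vspace_tensor_space]
    have "comul R (w j \<cdot> w k) = sweedler R R (?t (w k) ?u + ?t ?u (w k)) ?F"
      using comul_mult[of "w k" j] by (simp add: comul_w)
    also have "\<dots> = ?F (w k) ?u + ?F ?u (w k)"
      by (subst sweedler_add[OF bilinear_comul_mult vs is_vspace_tensor_space])
        (auto simp: ev tens_in_tensor_space)
    finally show ?thesis by (simp add: \<tau>_w \<tau>_unity tens_scale add_ac)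
  qed
  define r where "r = w j \<cdot> w k - scale R (q j k) (w k \<cdot> w j)"
  have "r \<in> gr 2"
  proof -
    have "w j \<cdot> w k \<in> gr 2" "scale R (- q j k) (w k \<cdot> w j) \<in> gr 2"
      using gr_mult[OF w_gr w_gr, of j k]
        gr_scale[OF vs decomposition gr_mult[OF w_gr w_gr, of k j], of "- q j k"]
      by (simp_all add: numeral_2_eq_2)
    then have "w j \<cdot> w k + scale R (- q j k) (w k \<cdot> w j) \<in> gr 2"
      by (rule gr_add[OF vs decomposition])
    then show ?thesis by (simp add: r_def)
  qed
  moreover have "r \<in> primitives R"
  proof -
    have eq: "r = w j \<cdot> w k + scale R (- q j k) (w k \<cdot> w j)" by (simp add: r_def)
    have "comul R r = comul R (w j \<cdot> w k) + tscale (- q j k) (comul R (w k \<cdot> w j))"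
      unfolding eq using linear_mapD(2)[OF comul_linear, of "w j \<cdot> w k" "scale R (- q j k) (w k \<cdot> w j)"]
        linear_mapD(3)[OF comul_linear, of "w k \<cdot> w j" "- q j k"] by simp
    moreover have "?t r ?u = ?t (w j \<cdot> w k) ?u + tscale (- q j k) (?t (w k \<cdot> w j) ?u)"
      unfolding eq using linear_mapD(2)[OF linear_map_tens_left[of ?u R R], of "w j \<cdot> w k" "scale R (- q j k) (w k \<cdot> w j)"]
        tens_scale[of "w k \<cdot> w j" ?u "- q j k"] tens_scale[of ?u "w k \<cdot> w j" "- q j k"] by simp
    moreover have "?t ?u r = ?t ?u (w j \<cdot> w k) + tscale (- q j k) (?t ?u (w k \<cdot> w j))"
      unfolding eq using linear_mapD(2)[OF linear_map_tens_right[of ?u R R], of "w j \<cdot> w k" "scale R (- q j k) (w k \<cdot> w j)"]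
        tens_scale[of "w k \<cdot> w j" ?u "- q j k"] tens_scale[of ?u "w k \<cdot> w j" "- q j k"] by simp
    ultimately have "comul R r = ?t r ?u + ?t ?u r"
      using assms(2) by (simp add: c tsc.scale_right_distrib tsc.scale_minus_left)
    then show ?thesis by (simp add: primitives_def eq)
  qed
  ultimately have "r = 0" by (intro primitive_eq_0[of r 2]) auto
  then show ?thesis by (simp add: r_def)
qed

lemma degree_one_functional:
  obtains f where "linear_map R ground f" "\<And>j. f (w j) = (if j = k then 1 else 0)"
    "\<And>n r. n \<noteq> 1 \<Longrightarrow> r \<in> gr n \<Longrightarrow> f r = 0"
proof -
  obtain \<phi> where \<phi>: "\<And>b. \<phi> b \<in> {f. linear_map R ground f}"
    "\<And>b b'. b' \<in> range w \<Longrightarrow> \<phi> b b' = (if b = b' then 1 else 0)"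
    using coordinate_functional[OF vs w_independent(2)] by blast
  define f where "f = (\<lambda>r. \<phi> (w k) (graded_component gr r 1))"
  have lin: "linear_map R ground (\<phi> (w k))" using \<phi>(1) by blast
  show ?thesis
  proof
    show "linear_map R ground f" unfolding f_def
      by (rule linear_map_comp[OF linear_graded_component[OF vs decomposition] lin])
    show "f (w j) = (if j = k then 1 else 0)" for j
      using graded_component_homogeneous[OF vs decomposition w_gr, of j] \<phi>(2)[of "w j" "w k"] w_independent(1)
      by (auto simp: f_def inj_eq)
    show "f r = 0" if "n \<noteq> 1" "r \<in> gr n" for n r
      using graded_component_homogeneous[OF vs decomposition that(2)] that(1) linear_map_zero[OF vs lin]
      by (simp add: f_def)
  qed
qed

text \<open>The derivation is \<open>(id \<otimes> f) \<Delta>\<close>, where \<open>f\<close> is the coordinate of \<open>w\<^sub>k\<close> in degree one and vanishes in the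
  other degrees.\<close>

lemma skew_derivation:
  obtains D where "linear_map R R D" "D (unity R) = 0"
    "\<And>j s. s \<in> carrier R \<Longrightarrow> D (w j \<cdot> s) = w j \<cdot> D s + (if j = k then \<tau> j s else 0)"
proof -
  obtain f where f: "linear_map R ground f" "\<And>j. f (w j) = (if j = k then 1 else 0)"
    "\<And>n r. n \<noteq> 1 \<Longrightarrow> r \<in> gr n \<Longrightarrow> f r = 0"
    by (rule degree_one_functional) blast
  have f_scale: "f (scale R c r) = c * f r" if "r \<in> carrier R" for c r
    using linear_mapD(3)[OF f(1) that] by (simp add: ground_def)
  define \<delta> :: "2 \<Rightarrow> 'k" where "\<delta> = (\<lambda>j. if j = k then 1 else 0)"
  \<comment> \<open>only the component of \<open>s\<close> in degree zero, which is its counit, contributes\<close>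
  have f_mult: "f (w j \<cdot> s) = \<delta> j * counity R s" if s: "s \<in> carrier R" for j s
  proof -
    let ?c = "graded_component gr s" and ?S = "insert 0 {n. graded_component gr s n \<noteq> 0}"
    note gc = graded_component[OF vs decomposition s]
    have cl: "?c n \<in> carrier R" for n using gc(1) gr_closed by blast
    have S: "finite ?S" "{n. ?c n \<noteq> 0} \<subseteq> ?S" using gc(2) by auto
    have l: "linear_map R ground (\<lambda>s. f (w j \<cdot> s))"
      by (rule linear_map_comp[OF linear_mul_right f(1)]) simp
    have deg: "f (w j \<cdot> ?c n) = \<delta> j * counity R (?c n)" for n
    proof (cases "n = 0")
      case True
      then have "?c n \<in> VS.span {unity R}" using gc(1)[of 0] gr_0 by simp
      then obtain c where c: "?c n = scale R c (unity R)"
        by (auto simp: VS.span_singleton)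
      have "counity R (?c n) = c"
        using linear_mapD(3)[OF counity_linear, of "unity R" c] counity_unity by (simp add: c ground_def)
      then show ?thesis by (simp add: c mult_scale f_scale f(2) \<delta>_def)
    next
      case False
      then show ?thesis
        using f(3)[OF _ gr_mult[OF w_gr gc(1)], of n j] counity_gr[OF _ gc(1), of n] by simp
    qed
    have s_sum: "s = (\<Sum>n\<in>?S. ?c n)"
      using gc(3) sum_support[OF S] by simp
    have "f (w j \<cdot> s) = (\<Sum>n\<in>?S. f (w j \<cdot> ?c n))"
      by (subst s_sum, rule linear_map_sum[OF vs l cl])
    also have "\<dots> = \<delta> j * (\<Sum>n\<in>?S. counity R (?c n))" by (simp only: deg sum_distrib_left)
    also have "(\<Sum>n\<in>?S. counity R (?c n)) = counity R s"
      by (subst (2) s_sum, rule linear_map_sum[OF vs counity_linear cl, symmetric])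
    finally show ?thesis .
  qed
  let ?B = "\<lambda>a b. scale R (f b) a"
  have B: "bilinear_map R R R ?B"
    by (intro bilinear_mapI linear_map_scalar_mult[OF vs f(1)] linear_map_scale_fun[OF vs] linear_map_id)
  define D where "D = (\<lambda>s. sweedler R R (comul R s) ?B)"
  have D_lin: "linear_map R R D"
    unfolding D_def by (rule linear_map_sweedler_arg[OF comul_linear B vs vs])
  have "D (unity R) = 0"
    unfolding D_def comul_unity using f(3)[OF _ unity_gr] by (subst sweedler_tens[OF B vs]) auto
  moreover have "D (w j \<cdot> s) = w j \<cdot> D s + (if j = k then \<tau> j s else 0)" if s: "s \<in> carrier R" for j s
  proof -
    let ?t = "comul R s"
    let ?F = "\<lambda>s1 s2. tens R R (w j \<cdot> s1) s2 + tens R R (\<tau> j s1) (w j \<cdot> s2)"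
    have t: "?t \<in> carrier (tensor_space R R)" using s by simp
    note lin = linear_map_sweedler[OF B vs vs]
    have "D (w j \<cdot> s) = sweedler R R (sweedler R R ?t ?F) ?B"
      unfolding D_def using comul_mult[OF s] by simp
    also have "\<dots> = sweedler R R ?t (\<lambda>s1 s2. sweedler R R (?F s1 s2) ?B)"
      by (rule sweedler_linear[OF lin is_vspace_tensor_space vs t bilinear_mapD(3)[OF bilinear_comul_mult]])
    also have "\<dots> = sweedler R R ?t (\<lambda>s1 s2. w j \<cdot> ?B s1 s2 + scale R (\<delta> j) (\<tau> j (scale R (counity R s2) s1)))"
    proof (rule sweedler_cong[OF vs t])
      fix a b assume ab: "a \<in> carrier R" "b \<in> carrier R"
      have "sweedler R R (?F a b) ?B = ?B (w j \<cdot> a) b + ?B (\<tau> j a) (w j \<cdot> b)"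
        using ab by (subst sweedler_add[OF B vs vs])
          (auto intro!: tens_in_tensor_space simp: sweedler_tens[OF B vs])
      also have "\<dots> = w j \<cdot> ?B a b + scale R (\<delta> j) (\<tau> j (scale R (counity R b) a))"
        using ab linear_mapD(3)[OF \<tau>_linear] by (simp add: f_mult mult_scale)
      finally show "sweedler R R (?F a b) ?B = w j \<cdot> ?B a b + scale R (\<delta> j) (\<tau> j (scale R (counity R b) a))" .
    qed
    also have "\<dots> = w j \<cdot> D s + scale R (\<delta> j) (\<tau> j s)"
    proof -
      have "w j \<cdot> D s = sweedler R R ?t (\<lambda>s1 s2. w j \<cdot> ?B s1 s2)"
        unfolding D_def
        by (rule sweedler_linear[OF linear_mul_right vs vs t]) auto
      moreover have "scale R (\<delta> j) (\<tau> j s) =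
          sweedler R R ?t (\<lambda>s1 s2. scale R (\<delta> j) (\<tau> j (scale R (counity R s2) s1)))"
        using sweedler_linear[OF linear_map_scale_fun[OF vs \<tau>_linear[of j], of "\<delta> j"] vs vs t,
          where f = "\<lambda>a b. scale R (counity R b) a"]
        by (simp add: counity_right[OF s])
      ultimately show ?thesis by (simp only: sweedler_add_fun)
    qed
    finally show ?thesis by (simp add: \<delta>_def)
  qed
  ultimately show ?thesis using D_lin that by blast
qed

lemma skew_derivation_powers:
  obtains D where "linear_map R R D" "D (unity R) = 0"
    "\<And>j n s. j \<noteq> k \<Longrightarrow> s \<in> carrier R \<Longrightarrow> D (w j \<up> n \<cdot> s) = w j \<up> n \<cdot> D s"
    "\<And>n s. s \<in> carrier R \<Longrightarrow> D s = 0 \<Longrightarrow>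
      D (w k \<up> Suc n \<cdot> s) = scale R (qint (q k k) (Suc n)) (w k \<up> n \<cdot> \<tau> k s)"
proof -
  obtain D where D: "linear_map R R D" "D (unity R) = 0"
    "\<And>j s. s \<in> carrier R \<Longrightarrow> D (w j \<cdot> s) = w j \<cdot> D s + (if j = k then \<tau> j s else 0)"
    by (rule skew_derivation) blast
  have cl: "D s \<in> carrier R" if "s \<in> carrier R" for s by (rule linear_mapD(1)[OF D(1) that])
  have pow: "w j \<up> Suc n \<cdot> s = w j \<cdot> (w j \<up> n \<cdot> s)" if "s \<in> carrier R" for j n s
    using that by (simp add: pow_Suc assoc)
  have "D (w j \<up> n \<cdot> s) = w j \<up> n \<cdot> D s" if "j \<noteq> k" "s \<in> carrier R" for j n s
    using that by (induction n) (simp_all add: pow cl D(3))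
  moreover have "D (w k \<up> Suc n \<cdot> s) = scale R (qint (q k k) (Suc n)) (w k \<up> n \<cdot> \<tau> k s)"
    if s: "s \<in> carrier R" "D s = 0" for n s
  proof (induction n)
    case 0
    show ?case using s D(3)[of s k] by (simp add: qint_Suc)
  next
    case (Suc n)
    have "D (w k \<up> Suc (Suc n) \<cdot> s) = w k \<cdot> D (w k \<up> Suc n \<cdot> s) + \<tau> k (w k \<up> Suc n \<cdot> s)"
      using s(1) by (simp add: pow[OF s(1), of k "Suc n"] D(3))
    also have "w k \<cdot> D (w k \<up> Suc n \<cdot> s) = scale R (qint (q k k) (Suc n)) (w k \<up> Suc n \<cdot> \<tau> k s)"
      using s(1) unfolding Suc by (simp add: pow mult_scale)
    also have "\<tau> k (w k \<up> Suc n \<cdot> s) = scale R (q k k ^ Suc n) (w k \<up> Suc n \<cdot> \<tau> k s)"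
      using s(1) by (simp add: \<tau>_mult \<tau>_pow mult_scale del: power_Suc)
    finally show ?case by (simp only: VS.scale_left_distrib[symmetric] qint_Suc[of _ "Suc n"])
  qed
  ultimately show ?thesis using D(1,2) that by blast
qed

text \<open>The functional is the counit after \<open>a\<close> applications of the derivation for \<open>w\<^sub>1\<close> and \<open>b\<close> applications of the one for
  \<open>w\<^sub>2\<close>, normalised. The scalars divided by are quantum integers below the orders, hence non-zero.\<close>

lemma dual_functional:
  assumes o: "has_order (q 1 1) Nx" "has_order (q 2 2) Ny" and nz: "q 1 2 \<noteq> 0"
    and ab: "a < Nx" "b < Ny"
  shows "\<exists>\<Phi>. linear_map R ground \<Phi> \<and>
    (\<forall>i j. \<Phi> (w 1 \<up> i \<cdot> w 2 \<up> j) = (if i = a \<and> j = b then 1 else 0))"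
proof -
  have lower: "linear_map R ground (\<lambda>r. 1 / n * \<Phi> (D r))"
    if "linear_map R R D" "linear_map R ground \<Phi>" for n \<Phi> D
    using linear_map_scale_fun[OF is_vspace_ground linear_map_comp[OF that], of "1 / n"]
    by (simp add: ground_def)
  have ev: "\<Phi> (scale R c r) = c * \<Phi> r" if "linear_map R ground \<Phi>" "r \<in> carrier R" for \<Phi> c r
    using linear_mapD(3)[OF that] by (simp add: ground_def)
  show ?thesis using ab(1)
  proof (induction a)
    case 0
    show ?case using ab(2)
    proof (induction b)
      case 0
      have "counity R (w 1 \<up> i \<cdot> w 2 \<up> j) = (if i = 0 \<and> j = 0 then 1 else 0)" for i j
        using counity_gr[OF _ gr_mult[OF pow_gr[of 1 i] pow_gr[of 2 j]]] counity_unity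
        by (cases "i + j = 0") auto
      then show ?case using counity_linear by blast
    next
      case (Suc b)
      then obtain \<Phi> where \<Phi>: "linear_map R ground \<Phi>"
        "\<And>i j. \<Phi> (w 1 \<up> i \<cdot> w 2 \<up> j) = (if i = 0 \<and> j = b then 1 else 0)" by auto
      obtain D where D: "linear_map R R D" "D (unity R) = 0"
        "\<And>j n s. j \<noteq> 2 \<Longrightarrow> s \<in> carrier R \<Longrightarrow> D (w j \<up> n \<cdot> s) = w j \<up> n \<cdot> D s"
        "\<And>n s. s \<in> carrier R \<Longrightarrow> D s = 0 \<Longrightarrow>
          D (w 2 \<up> Suc n \<cdot> s) = scale R (qint (q 2 2) (Suc n)) (w 2 \<up> n \<cdot> \<tau> 2 s)"
        by (rule skew_derivation_powers) blast
      let ?n = "qint (q 2 2) (Suc b)"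
      have n: "?n \<noteq> 0" using qint_nonzero[OF o(2), of "Suc b"] Suc.prems by simp
      have "1 / ?n * \<Phi> (D (w 1 \<up> i \<cdot> w 2 \<up> j)) = (if i = 0 \<and> j = Suc b then 1 else 0)" for i j
      proof (cases j)
        case 0
        then show ?thesis using linear_map_zero[OF vs \<Phi>(1)] D(3)[of 1 "unity R" i] D(2) by simp
      next
        case (Suc m)
        then show ?thesis
          using D(3)[of 1 "w 2 \<up> j" i] D(4)[of "unity R" m] D(2) n
          by (auto simp: \<tau>_unity mult_scale ev[OF \<Phi>(1)] \<Phi>(2))
      qed
      then show ?case using lower[OF D(1) \<Phi>(1), of ?n] by blast
    qed
  next
    case (Suc a)
    then obtain \<Phi> where \<Phi>: "linear_map R ground \<Phi>"
      "\<And>i j. \<Phi> (w 1 \<up> i \<cdot> w 2 \<up> j) = (if i = a \<and> j = b then 1 else 0)" by auto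
    obtain D where D: "linear_map R R D" "D (unity R) = 0"
      "\<And>j n s. j \<noteq> 1 \<Longrightarrow> s \<in> carrier R \<Longrightarrow> D (w j \<up> n \<cdot> s) = w j \<up> n \<cdot> D s"
      "\<And>n s. s \<in> carrier R \<Longrightarrow> D s = 0 \<Longrightarrow>
        D (w 1 \<up> Suc n \<cdot> s) = scale R (qint (q 1 1) (Suc n)) (w 1 \<up> n \<cdot> \<tau> 1 s)"
      by (rule skew_derivation_powers) blast
    have Dy: "D (w 2 \<up> j) = 0" for j using D(3)[of 2 "unity R" j] D(2) by simp
    let ?n = "qint (q 1 1) (Suc a) * q 1 2 ^ b"
    have n: "?n \<noteq> 0" using qint_nonzero[OF o(1), of "Suc a"] Suc.prems nz by simp
    have "1 / ?n * \<Phi> (D (w 1 \<up> i \<cdot> w 2 \<up> j)) = (if i = Suc a \<and> j = b then 1 else 0)" for i j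
    proof (cases i)
      case 0
      then show ?thesis using linear_map_zero[OF vs \<Phi>(1)] Dy[of j] by simp
    next
      case (Suc m)
      then show ?thesis
        using D(4)[of "w 2 \<up> j" m] Dy[of j] n by (auto simp: \<tau>_pow mult_scale ev[OF \<Phi>(1)] \<Phi>(2))
    qed
    then show ?case using lower[OF D(1) \<Phi>(1), of ?n] by blast
  qed
qed

end

section \<open>Yetter--Drinfeld modules over a group algebra\<close>

lemma basis_coordinates:
  fixes V :: "('k::field, 'v::ab_group_add, 'z) vspace_scheme" and w :: "'i::finite \<Rightarrow> 'v"
  assumes V: "is_vspace V" and w: "inj w" "\<not> module.dependent (scale V) (range w)"
    and span: "module.span (scale V) (range w) = carrier V"
  obtains \<phi> where "\<And>k. linear_map V ground (\<phi> k)" "\<And>j k. \<phi> k (w j) = (if j = k then 1 else (0::'k))"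
    "\<And>m. m \<in> carrier V \<Longrightarrow> m = (\<Sum>k\<in>UNIV. scale V (\<phi> k m) (w k))"
proof -
  interpret vector_space "scale V" using V by (simp add: is_vspace_def)
  obtain \<psi> where \<psi>: "\<And>b. \<psi> b \<in> {f. linear_map V ground f}"
    "\<And>b b'. b' \<in> range w \<Longrightarrow> \<psi> b b' = (if b = b' then 1 else (0::'k))"
    using coordinate_functional[OF V w(2)] by blast
  define \<phi> where "\<phi> = (\<lambda>k. \<psi> (w k))"
  have lin: "linear_map V ground (\<phi> k)" for k using \<psi>(1) by (auto simp: \<phi>_def)
  have dual: "\<phi> k (w j) = (if j = k then 1 else 0)" for j k
    using \<psi>(2)[of "w j" "w k"] w(1) by (auto simp: \<phi>_def inj_eq)
  have "m \<in> carrier V \<and> (\<Sum>k\<in>UNIV. scale V (\<phi> k m) (w k)) = m" if "m \<in> span (range w)" for m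
    using that
  proof (induction rule: span_induct_alt)
    case base
    show ?case using linear_map_zero[OF V lin] is_vspace_zero[OF V] by simp
  next
    case (step c x y)
    from step(1) obtain j where j: "x = w j" by auto
    have y: "y \<in> carrier V" using step(2) by blast
    have x: "x \<in> carrier V" using span_base[of x "range w"] j span by blast
    have "(\<Sum>k\<in>UNIV. scale V (\<phi> k (scale V c x + y)) (w k)) =
        (\<Sum>k\<in>UNIV. (if k = j then scale V c x else 0) + scale V (\<phi> k y) (w k))"
      by (intro sum.cong refl)
        (simp add: linear_mapD(2)[OF lin is_vspace_scale[OF V x] y] linear_mapD(3)[OF lin x],
         simp add: j dual ground_def scale_left_distrib)
    also have "\<dots> = scale V c x + (\<Sum>k\<in>UNIV. scale V (\<phi> k y) (w k))" by (simp add: sum.distrib)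
    also have "\<dots> = scale V c x + y" using step(2) by simp
    finally show ?case using is_vspace_add[OF V is_vspace_scale[OF V x] y] by blast
  qed
  then have "m = (\<Sum>k\<in>UNIV. scale V (\<phi> k m) (w k))" if "m \<in> carrier V" for m
    using that span by metis
  then show ?thesis using lin dual by (intro that[of \<phi>])
qed

lemma sweedler_sum_fun:
  "sweedler V W t (\<lambda>v w. \<Sum>i\<in>I. f i v w) = (\<Sum>i\<in>I. sweedler V W t (f i))"
proof -
  have "(\<Sum>p\<leftarrow>ps. \<Sum>i\<in>I. f i (fst p) (snd p)) = (\<Sum>i\<in>I. \<Sum>p\<leftarrow>ps. f i (fst p) (snd p))" for ps
    by (induction ps) (simp_all only: list.map sum_list.Nil sum_list.Cons sum.distrib sum.neutral_const)
  then show ?thesis unfolding sweedler_tensor_rep case_prod_unfold .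
qed

text \<open>Being a Hopf algebra is an assumption because every Yetter--Drinfeld module supplies it through
  \<^const>\<open>yd_module\<close>; what remains to be computed are the values of the structure maps on group elements.\<close>

locale group_algebra_hopf = comm_group G
  for G :: "'g monoid" (structure) +
  fixes K :: "('k::field, 'g \<Rightarrow>\<^sub>0 'k) bialg"
  assumes finite_G: "finite (carrier G)" and K_def: "K = group_algebra G" and hopf: "is_hopf K"
begin

abbreviation e :: "'g \<Rightarrow> 'g \<Rightarrow>\<^sub>0 'k"
  where "e a \<equiv> Poly_Mapping.single a 1"

lemma carrier_K: "carrier K = {f. Poly_Mapping.keys f \<subseteq> carrier G}"
  and lookup_scale_K: "Poly_Mapping.lookup (scale K c f) a = c * Poly_Mapping.lookup f a"
  and unity_K: "unity K = e \<one>"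
  and mul_K: "mul K = (\<lambda>f f'. \<Sum>x\<in>Poly_Mapping.keys f. \<Sum>y\<in>Poly_Mapping.keys f'.
           Poly_Mapping.single (x \<otimes> y) (Poly_Mapping.lookup f x * Poly_Mapping.lookup f' y))"
  and counity_K: "counity K f = (\<Sum>x\<in>Poly_Mapping.keys f. Poly_Mapping.lookup f x)"
  by (simp_all add: K_def group_algebra_def Let_def map.rep_eq when_def)

lemma comul_K_e: "comul K (e a) = tens K K (e a) (e a)"
proof -
  let ?V = "\<lparr>carrier = {f. Poly_Mapping.keys f \<subseteq> carrier G}, scale = \<lambda>c::'k. Poly_Mapping.map ((*) c)\<rparr>"
  have V: "tens ?V ?V = tens K K"
    by (rule tens_cong) (simp_all add: K_def group_algebra_def Let_def)
  have "comul K = (\<lambda>f. \<Sum>x\<in>Poly_Mapping.keys f.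
      tscale (Poly_Mapping.lookup f x) (tens ?V ?V (e x) (e x)))"
    by (simp add: K_def group_algebra_def Let_def)
  then show ?thesis unfolding V by simp
qed

lemma sweedler_comul_e:
  assumes "bilinear_map K K U f" "is_vspace U" "a \<in> carrier G"
  shows "sweedler K K (comul K (e a)) f = f (e a) (e a)"
  unfolding comul_K_e by (rule sweedler_tens[OF assms(1,2)]) (use assms(3) in \<open>simp_all add: carrier_K\<close>)

lemma is_algebra_K: "is_algebra K" and is_coalgebra_K: "is_coalgebra K"
  using hopf by (simp_all add: is_hopf_def is_bialgebra_def)

sublocale K: algebra_on_carrier K
  by standard (rule is_algebra_K)

lemma e_closed [simp]: "a \<in> carrier G \<Longrightarrow> e a \<in> carrier K"
  by (simp add: carrier_K)

lemma counity_e [simp]: "counity K (e a) = 1"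
  by (simp add: counity_K)

lemma mult_e: "e a \<cdot>\<^bsub>K\<^esub> e b = e (a \<otimes> b)"
  by (simp add: mul_K)

lemma linear_lookup: "linear_map K ground (\<lambda>f. Poly_Mapping.lookup f a)"
  by (simp add: linear_map_def ground_def lookup_add lookup_scale_K)

lemma linear_counity_K: "linear_map K ground (counity K)"
  using is_coalgebra_K by (simp add: is_coalgebra_def)

lemma linear_comul_K: "linear_map K (tensor_space K K) (comul K)"
  using is_coalgebra_K by (simp add: is_coalgebra_def)

lemma expand_K:
  assumes "f \<in> carrier K" shows "f = (\<Sum>a\<in>carrier G. scale K (Poly_Mapping.lookup f a) (e a))"
proof (rule poly_mapping_eqI)
  fix k
  have "Poly_Mapping.lookup f k = 0" if "k \<notin> carrier G"
    using that assms by (auto simp: carrier_K in_keys_iff)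
  then show "Poly_Mapping.lookup f k =
      Poly_Mapping.lookup (\<Sum>a\<in>carrier G. scale K (Poly_Mapping.lookup f a) (e a)) k"
    using finite_G by (simp add: lookup_sum lookup_scale_K lookup_single when_def if_distrib[of "\<lambda>t. _ * t"] cong: if_cong)
qed

lemma mult_K_commute:
  assumes "f \<in> carrier K" "f' \<in> carrier K" shows "f \<cdot>\<^bsub>K\<^esub> f' = f' \<cdot>\<^bsub>K\<^esub> f"
proof -
  have "f \<cdot>\<^bsub>K\<^esub> f' = (\<Sum>y\<in>Poly_Mapping.keys f'. \<Sum>x\<in>Poly_Mapping.keys f.
      Poly_Mapping.single (x \<otimes> y) (Poly_Mapping.lookup f x * Poly_Mapping.lookup f' y))"
    unfolding mul_K by (rule sum.swap)
  also have "\<dots> = f' \<cdot>\<^bsub>K\<^esub> f"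
    unfolding mul_K
  proof (intro sum.cong refl)
    fix x y assume "y \<in> Poly_Mapping.keys f'" "x \<in> Poly_Mapping.keys f"
    then have "x \<otimes> y = y \<otimes> x" using assms by (intro m_comm) (auto simp: carrier_K)
    then show "Poly_Mapping.single (x \<otimes> y) (Poly_Mapping.lookup f x * Poly_Mapping.lookup f' y) =
        Poly_Mapping.single (y \<otimes> x) (Poly_Mapping.lookup f' y * Poly_Mapping.lookup f x)"
      by (simp only: mult.commute)
  qed
  finally show ?thesis .
qed

lemma antipode_K: "is_antipode K (antipode K)"
  using hopf someI_ex[of "is_antipode K"] by (auto simp: is_hopf_def antipode_def)

lemma antipode_closed [simp]: "f \<in> carrier K \<Longrightarrow> antipode K f \<in> carrier K"
  using antipode_K by (auto simp: is_antipode_def linear_map_def)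

lemma linear_antipode_K: "linear_map K K (antipode K)"
  using antipode_K by (simp add: is_antipode_def)

lemma e_antipode: assumes a: "a \<in> carrier G" shows "e a \<cdot>\<^bsub>K\<^esub> antipode K (e a) = unity K"
proof -
  have b: "bilinear_map K K K (\<lambda>a b. a \<cdot>\<^bsub>K\<^esub> antipode K b)"
    by (rule bilinear_map_comp[OF K.bilinear_mul linear_map_id linear_antipode_K])
  have "sweedler K K (comul K (e a)) (\<lambda>a b. a \<cdot>\<^bsub>K\<^esub> antipode K b) = scale K (counity K (e a)) (unity K)"
    using antipode_K[unfolded is_antipode_def, THEN conjunct2] e_closed[OF a] by blast
  then show ?thesis
    unfolding comul_K_e using a by (subst (asm) sweedler_tens[OF b K.vs]) auto
qed

text \<open>\<open>coefficient W a\<close> reads off \<open>w\<^sub>a\<close> from the expression of a tensor as the sum of the \<open>e a \<otimes> w\<^sub>a\<close>.\<close>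

definition coefficient ::
    "('k, 'w::ab_group_add, 'y) vspace_scheme \<Rightarrow> 'g \<Rightarrow> ('k, 'g \<Rightarrow>\<^sub>0 'k, 'w) tensor \<Rightarrow> 'w"
  where "coefficient W a t = sweedler K W t (\<lambda>f m. scale W (Poly_Mapping.lookup f a) m)"

lemma bilinear_coefficient:
  assumes "is_vspace W" shows "bilinear_map K W W (\<lambda>f m. scale W (Poly_Mapping.lookup f a) m)"
  by (intro bilinear_mapI linear_map_scalar_mult[OF assms linear_lookup] linear_map_scale_fun[OF assms] linear_map_id)

lemma coefficient_sum:
  assumes W: "is_vspace W" and m: "\<And>b. b \<in> carrier G \<Longrightarrow> m b \<in> carrier W" and a: "a \<in> carrier G"
  shows "coefficient W a (\<Sum>b\<in>carrier G. tens K W (e b) (m b)) = m a"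
proof -
  interpret W: vector_space "scale W" using W by (simp add: is_vspace_def)
  have "coefficient W a (\<Sum>b\<in>carrier G. tens K W (e b) (m b)) =
      (\<Sum>b\<in>carrier G. scale W (Poly_Mapping.lookup (e b) a) (m b))"
    unfolding coefficient_def by (rule sweedler_sum_tens[OF bilinear_coefficient[OF W] K.vs W]) (auto simp: m)
  also have "\<dots> = (\<Sum>b\<in>carrier G. if b = a then m b else 0)"
    by (intro sum.cong refl) (auto simp: lookup_single)
  finally show ?thesis using finite_G a by simp
qed

lemma coefficient_closed:
  "is_vspace W \<Longrightarrow> t \<in> carrier (tensor_space K W) \<Longrightarrow> coefficient W a t \<in> carrier W"
  unfolding coefficient_def by (rule sweedler_closed[OF K.vs]) (auto intro: is_vspace_scale)

lemma tensor_expand: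
  assumes W: "is_vspace W" and t: "t \<in> carrier (tensor_space K W)"
  shows "t = (\<Sum>a\<in>carrier G. tens K W (e a) (coefficient W a t))"
proof -
  let ?c = "\<lambda>f a. Poly_Mapping.lookup f a"
  have T: "is_vspace (tensor_space K W)" by (rule is_vspace_tensor_space)
  have "t = sweedler K W t (tens K W)" by (rule sweedler_identity[OF K.vs t, symmetric])
  also have "\<dots> = sweedler K W t (\<lambda>f m. \<Sum>a\<in>carrier G. tens K W (e a) (scale W (?c f a) m))"
  proof (rule sweedler_cong[OF K.vs t])
    fix f m assume f: "f \<in> carrier K" and m: "m \<in> carrier W"
    have "tens K W f m = tens K W (\<Sum>a\<in>carrier G. scale K (?c f a) (e a)) m"
      by (rule arg_cong[OF expand_K[OF f], of "\<lambda>f. tens K W f m"])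
    also have "\<dots> = (\<Sum>a\<in>carrier G. tens K W (scale K (?c f a) (e a)) m)"
      by (rule linear_map_sum[OF K.vs linear_map_tens_left[OF m]]) auto
    also have "\<dots> = (\<Sum>a\<in>carrier G. tens K W (e a) (scale W (?c f a) m))"
      using linear_mapD(3)[OF linear_map_tens_left[OF m, of K]] linear_mapD(3)[OF linear_map_tens_right[of _ K W] m]
      by (intro sum.cong refl) auto
    finally show "tens K W f m = (\<Sum>a\<in>carrier G. tens K W (e a) (scale W (?c f a) m))" .
  qed
  also have "\<dots> = (\<Sum>a\<in>carrier G. sweedler K W t (\<lambda>f m. tens K W (e a) (scale W (?c f a) m)))"
    by (rule sweedler_sum_fun)
  also have "\<dots> = (\<Sum>a\<in>carrier G. tens K W (e a) (coefficient W a t))"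
    unfolding coefficient_def
    by (intro sum.cong refl sweedler_linear[OF linear_map_tens_right W K.vs t, symmetric])
      (auto intro: is_vspace_scale[OF W])
  finally show ?thesis .
qed

context
  fixes M :: "('k, 'g \<Rightarrow>\<^sub>0 'k, 'v::ab_group_add) yd"
  assumes yd: "yd_module K M"
begin

lemma yd_vs: "is_vspace M"
  by (rule yd[unfolded yd_module_def, THEN conjunct2, THEN conjunct2, THEN conjunct1, rule_format])

lemma yd_bilinear_act: "bilinear_map K M M (act M)"
  by (rule yd[unfolded yd_module_def, THEN conjunct2, THEN conjunct2, THEN conjunct2, THEN conjunct1, rule_format])

lemma yd_act_unity: "m \<in> carrier M \<Longrightarrow> unity K \<triangleright>\<^bsub>M\<^esub> m = m"
  by (rule yd[unfolded yd_module_def, THEN conjunct2, THEN conjunct2, THEN conjunct2, THEN conjunct2, THEN conjunct1, rule_format])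

lemma yd_act_mult: "f \<in> carrier K \<Longrightarrow> f' \<in> carrier K \<Longrightarrow> m \<in> carrier M \<Longrightarrow>
    (f \<cdot>\<^bsub>K\<^esub> f') \<triangleright>\<^bsub>M\<^esub> m = f \<triangleright>\<^bsub>M\<^esub> f' \<triangleright>\<^bsub>M\<^esub> m"
  by (rule yd[unfolded yd_module_def, THEN conjunct2, THEN conjunct2, THEN conjunct2, THEN conjunct2, THEN conjunct2, THEN conjunct1, rule_format])

lemma yd_linear_coact: "linear_map M (tensor_space K M) (coact M)"
  by (rule yd[unfolded yd_module_def, THEN conjunct2, THEN conjunct2, THEN conjunct2, THEN conjunct2, THEN conjunct2, THEN conjunct2, THEN conjunct1, rule_format])

lemma yd_counit: "m \<in> carrier M \<Longrightarrow> sweedler K M (coact M m) (\<lambda>h m0. scale M (counity K h) m0) = m"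
  by (rule yd[unfolded yd_module_def, THEN conjunct2, THEN conjunct2, THEN conjunct2, THEN conjunct2, THEN conjunct2, THEN conjunct2, THEN conjunct2, THEN conjunct1, rule_format])

lemmas yd_coassoc = yd[unfolded yd_module_def, THEN conjunct2, THEN conjunct2, THEN conjunct2, THEN conjunct2, THEN conjunct2, THEN conjunct2, THEN conjunct2, THEN conjunct2, THEN conjunct1, rule_format]

lemmas yd_compatible = yd[unfolded yd_module_def, THEN conjunct2, THEN conjunct2, THEN conjunct2, THEN conjunct2, THEN conjunct2, THEN conjunct2, THEN conjunct2, THEN conjunct2, THEN conjunct2, rule_format]

lemma coact_closed: "m \<in> carrier M \<Longrightarrow> coact M m \<in> carrier (tensor_space K M)"
  by (rule linear_mapD(1)[OF yd_linear_coact])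

lemma act_closed [simp]: "f \<in> carrier K \<Longrightarrow> m \<in> carrier M \<Longrightarrow> f \<triangleright>\<^bsub>M\<^esub> m \<in> carrier M"
  by (rule bilinear_mapD(3)[OF yd_bilinear_act])

text \<open>A comodule over a group algebra is graded by the group: the components are the coefficients of
  the coaction, which sum up to \<open>m\<close> by the counit axiom and are homogeneous by comparing coefficients in
  the coassociativity axiom.\<close>

lemma homogeneous_components:
  assumes m: "m \<in> carrier M"
  defines "c \<equiv> (\<lambda>a. coefficient M a (coact M m))"
  shows "a \<in> carrier G \<Longrightarrow> c a \<in> carrier M"
    and "a \<in> carrier G \<Longrightarrow> coact M (c a) = tens K M (e a) (c a)"
    and "m = (\<Sum>a\<in>carrier G. c a)"
proof -
  note t = coact_closed[OF m]
  let ?T = "tensor_space K M"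
  have T: "is_vspace ?T" by (rule is_vspace_tensor_space)
  show cl: "c a \<in> carrier M" for a unfolding c_def by (rule coefficient_closed[OF yd_vs t])
  have t_eq: "coact M m = (\<Sum>a\<in>carrier G. tens K M (e a) (c a))"
    unfolding c_def by (rule tensor_expand[OF yd_vs t])
  have "m = sweedler K M (coact M m) (\<lambda>h m0. scale M (counity K h) m0)"
    by (rule yd_counit[OF m, symmetric])
  also have "\<dots> = (\<Sum>a\<in>carrier G. scale M (counity K (e a)) (c a))"
    unfolding t_eq
  proof (rule sweedler_sum_tens[OF _ K.vs yd_vs])
    show "bilinear_map K M M (\<lambda>h m0. scale M (counity K h) m0)"
      by (intro bilinear_mapI linear_map_scalar_mult[OF yd_vs linear_counity_K]
          linear_map_scale_fun[OF yd_vs] linear_map_id)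
  qed (use cl in auto)
  also have "\<dots> = (\<Sum>a\<in>carrier G. c a)"
  proof -
    interpret vector_space "scale M" using yd_vs by (simp add: is_vspace_def)
    show ?thesis by simp
  qed
  finally show "m = (\<Sum>a\<in>carrier G. c a)" .
  show "coact M (c a) = tens K M (e a) (c a)" if a: "a \<in> carrier G" for a
  proof -
    let ?L = "\<lambda>h m0. sweedler K K (comul K h) (\<lambda>h1 h2. tens K ?T h1 (tens K M h2 m0))"
    have b1: "bilinear_map K K (tensor_space K ?T) (\<lambda>h1 h2. tens K ?T h1 (tens K M h2 m0))"
      if "m0 \<in> carrier M" for m0
      by (rule bilinear_map_comp[OF bilinear_map_tens linear_map_id linear_map_tens_left[OF that]])
    have b2: "bilinear_map K M (tensor_space K ?T) ?L"
    proof (rule bilinear_mapI)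
      fix h assume h: "h \<in> carrier K"
      show "linear_map M (tensor_space K ?T) (?L h)"
        by (rule linear_map_sweedler_param[OF _ K.vs is_vspace_tensor_space linear_mapD(1)[OF linear_comul_K h]])
          (rule linear_map_comp[OF linear_map_tens_right linear_map_tens_right])
    next
      fix m0 assume "m0 \<in> carrier M"
      then show "linear_map K (tensor_space K ?T) (\<lambda>h. ?L h m0)"
        by (rule linear_map_sweedler_arg[OF linear_comul_K b1 K.vs is_vspace_tensor_space])
    qed
    have "(\<Sum>a\<in>carrier G. tens K ?T (e a) (tens K M (e a) (c a))) = (\<Sum>a\<in>carrier G. ?L (e a) (c a))"
      unfolding comul_K_e using cl
      by (intro sum.cong refl sweedler_tens[OF b1 is_vspace_tensor_space, symmetric]) auto
    also have "\<dots> = sweedler K M (coact M m) ?L"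
      unfolding t_eq
      by (rule sweedler_sum_tens[OF b2 K.vs is_vspace_tensor_space, symmetric]) (use cl in auto)
    also have "\<dots> = sweedler K M (coact M m) (\<lambda>h m0. sweedler K M (coact M m0)
        (\<lambda>h' m'. tens K ?T h (tens K M h' m')))" by (rule yd_coassoc[OF m])
    also have "\<dots> = sweedler K M (coact M m) (\<lambda>h m0. tens K ?T h (coact M m0))"
    proof (rule sweedler_cong[OF K.vs t])
      fix h m0 assume h: "h \<in> carrier K" and m0: "m0 \<in> carrier M"
      have "sweedler K M (coact M m0) (\<lambda>h' m'. tens K ?T h (tens K M h' m')) =
          tens K ?T h (sweedler K M (coact M m0) (tens K M))"
        by (rule sweedler_linear[OF linear_map_tens_right[OF h] T K.vs coact_closed[OF m0], symmetric])
          (rule tens_in_tensor_space)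
      then show "sweedler K M (coact M m0) (\<lambda>h' m'. tens K ?T h (tens K M h' m')) = tens K ?T h (coact M m0)"
        by (simp add: sweedler_identity[OF K.vs coact_closed[OF m0]])
    qed
    also have "\<dots> = (\<Sum>a\<in>carrier G. tens K ?T (e a) (coact M (c a)))"
      unfolding t_eq
      by (rule sweedler_sum_tens[OF bilinear_map_comp[OF bilinear_map_tens linear_map_id yd_linear_coact]
          K.vs is_vspace_tensor_space]) (use cl in auto)
    finally have eq: "(\<Sum>a\<in>carrier G. tens K ?T (e a) (tens K M (e a) (c a))) =
      (\<Sum>a\<in>carrier G. tens K ?T (e a) (coact M (c a)))" .
    show ?thesis
      using arg_cong[OF eq, of "coefficient ?T a"] a cl coact_closed
      by (simp add: coefficient_sum[OF T] tens_in_tensor_space)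
  qed
qed

text \<open>Acting by \<open>a\<close> conjugates the degree by \<open>a\<close>, which has no effect in a commutative group.\<close>

lemma act_homogeneous:
  assumes m: "m \<in> carrier M" and a: "a \<in> carrier G" and h: "h \<in> carrier G"
    and co: "coact M m = tens K M (e h) m"
  shows "coact M (e a \<triangleright>\<^bsub>M\<^esub> m) = tens K M (e h) (e a \<triangleright>\<^bsub>M\<^esub> m)"
proof -
  let ?T = "tensor_space K M"
  have T: "is_vspace ?T" by (rule is_vspace_tensor_space)
  let ?f = "\<lambda>h3 h1 h2 b m0. tens K M (h1 \<cdot>\<^bsub>K\<^esub> b \<cdot>\<^bsub>K\<^esub> antipode K h3) (h2 \<triangleright>\<^bsub>M\<^esub> m0)"
  let ?A = "\<lambda>h3 h1 h2. sweedler K M (coact M m) (?f h3 h1 h2)"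
  let ?B = "\<lambda>h12 h3. sweedler K K (comul K h12) (?A h3)"
  note t = coact_closed[OF m]
  have lin_b: "linear_map K K (\<lambda>b. h1 \<cdot>\<^bsub>K\<^esub> b \<cdot>\<^bsub>K\<^esub> h3)"
    if "h1 \<in> carrier K" "h3 \<in> carrier K" for h1 h3
    by (rule linear_map_comp[OF K.linear_mul_right[OF that(1)] K.linear_mul_left[OF that(2)]])
  have lin_h1: "linear_map K K (\<lambda>h1. h1 \<cdot>\<^bsub>K\<^esub> b \<cdot>\<^bsub>K\<^esub> h3)"
    if "b \<in> carrier K" "h3 \<in> carrier K" for b h3
    by (rule linear_map_comp[OF K.linear_mul_left[OF that(1)] K.linear_mul_left[OF that(2)]])
  have lin_act: "linear_map M M (\<lambda>m. h2 \<triangleright>\<^bsub>M\<^esub> m)" if "h2 \<in> carrier K" for h2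
    by (rule bilinear_mapD(1)[OF yd_bilinear_act that])
  have lin_act': "linear_map K M (\<lambda>h. h \<triangleright>\<^bsub>M\<^esub> m0)" if "m0 \<in> carrier M" for m0
    by (rule bilinear_mapD(2)[OF yd_bilinear_act that])
  have bf: "bilinear_map K M ?T (?f h3 h1 h2)" if "h1 \<in> carrier K" "h2 \<in> carrier K" "h3 \<in> carrier K" for h1 h2 h3
    by (rule bilinear_map_comp[OF bilinear_map_tens lin_b lin_act]) (use that in auto)
  have bA: "bilinear_map K K ?T (?A h3)" if h3: "h3 \<in> carrier K" for h3
  proof (rule bilinear_mapI)
    fix h1 assume "h1 \<in> carrier K"
    then show "linear_map K ?T (?A h3 h1)"
      by (intro linear_map_sweedler_param[OF linear_map_comp[OF lin_act' linear_map_tens_right] K.vs T t])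
        (use h3 in auto)
  next
    fix h2 assume "h2 \<in> carrier K"
    then show "linear_map K ?T (\<lambda>h1. ?A h3 h1 h2)"
      by (intro linear_map_sweedler_param[OF linear_map_comp[OF lin_h1 linear_map_tens_left] K.vs T t])
        (use h3 in auto)
  qed
  have lin_h3: "linear_map K ?T (\<lambda>h3. ?f h3 h1 h2 b m0)"
    if "h1 \<in> carrier K" "h2 \<in> carrier K" "b \<in> carrier K" "m0 \<in> carrier M" for h1 h2 b m0
    by (rule linear_map_comp[OF linear_map_comp[OF linear_antipode_K K.linear_mul_right] linear_map_tens_left])
      (use that in auto)
  have bB: "bilinear_map K K ?T ?B"
  proof (rule bilinear_mapI)
    fix h12 assume h12: "h12 \<in> carrier K"
    show "linear_map K ?T (?B h12)"
      by (rule linear_map_sweedler_param[OF linear_map_sweedler_param[OF lin_h3 K.vs T t] K.vs T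
            linear_mapD(1)[OF linear_comul_K h12]])
  next
    fix h3 assume "h3 \<in> carrier K"
    then show "linear_map K ?T (\<lambda>h12. ?B h12 h3)"
      by (rule linear_map_sweedler_arg[OF linear_comul_K bA K.vs T])
  qed
  have "coact M (e a \<triangleright>\<^bsub>M\<^esub> m) = sweedler K K (comul K (e a)) ?B"
    using yd_compatible[OF e_closed[OF a] m] .
  also have "\<dots> = ?B (e a) (e a)"
    by (rule sweedler_comul_e[OF bB T a])
  also have "\<dots> = ?A (e a) (e a) (e a)"
    by (rule sweedler_comul_e[OF bA T a]) (simp add: a)
  also have "\<dots> = ?f (e a) (e a) (e a) (e h) m"
    using sweedler_tens[OF bf[of "e a" "e a" "e a"] T e_closed[OF h] m] by (simp add: co a)
  also have "e a \<cdot>\<^bsub>K\<^esub> e h \<cdot>\<^bsub>K\<^esub> antipode K (e a) = e h"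
  proof -
    have "e a \<cdot>\<^bsub>K\<^esub> e h \<cdot>\<^bsub>K\<^esub> antipode K (e a) = e h \<cdot>\<^bsub>K\<^esub> e a \<cdot>\<^bsub>K\<^esub> antipode K (e a)"
      using mult_K_commute[of "e a" "e h"] a h by simp
    also have "\<dots> = e h"
      using K.assoc[of "e h" "e a" "antipode K (e a)"] e_antipode[OF a] a h by simp
    finally show ?thesis .
  qed
  finally show ?thesis .
qed

lemma act_pow:
  assumes m: "m \<in> carrier M" and g: "g \<in> carrier G" and eig: "e g \<triangleright>\<^bsub>M\<^esub> m = scale M z m"
  shows "e (g [^] (n::nat)) \<triangleright>\<^bsub>M\<^esub> m = scale M (z ^ n) m"
proof -
  interpret V: vector_space "scale M" using yd_vs by (simp add: is_vspace_def)
  show ?thesis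
  proof (induction n)
    case 0
    show ?case using yd_act_unity[OF m] by (simp add: unity_K)
  next
    case (Suc n)
    have "e (g [^] Suc n) = e (g [^] n) \<cdot>\<^bsub>K\<^esub> e g" by (simp add: mult_e Group.nat_pow_Suc)
    then have "e (g [^] Suc n) \<triangleright>\<^bsub>M\<^esub> m = e (g [^] n) \<triangleright>\<^bsub>M\<^esub> scale M z m"
      using yd_act_mult[of "e (g [^] n)" "e g" m] g m eig by simp
    also have "\<dots> = scale M z (e (g [^] n) \<triangleright>\<^bsub>M\<^esub> m)"
      by (rule linear_mapD(3)[OF bilinear_mapD(1)[OF yd_bilinear_act] m]) (simp add: g)
    finally show ?case by (simp add: Suc)
  qed
qed

text \<open>The discrete Fourier transform splits a module over a finite cyclic group into eigenvectors of
  a generator.\<close>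

lemma eigenvector_sum:
  assumes char: "of_nat N \<noteq> (0::'k)" and g: "g \<in> carrier G" "g [^] N = \<one>" and \<zeta>: "has_order \<zeta> N"
    and m: "m \<in> carrier M"
  defines "u \<equiv> (\<lambda>c. scale M (1 / of_nat N) (\<Sum>l<N. scale M (inverse \<zeta> ^ (l * c)) (e (g [^] l) \<triangleright>\<^bsub>M\<^esub> m)))"
  shows "u c \<in> carrier M" and "e g \<triangleright>\<^bsub>M\<^esub> u c = scale M (\<zeta> ^ c) (u c)"
    and "m = (\<Sum>c<N. u c)"
    and "h \<in> carrier G \<Longrightarrow> coact M m = tens K M (e h) m \<Longrightarrow> coact M (u c) = tens K M (e h) (u c)"
proof -
  interpret V: vector_space "scale M" using yd_vs by (simp add: is_vspace_def)
  have N: "N > 0" "\<zeta> ^ N = 1" using \<zeta> by (auto simp: has_order_def)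
  have \<zeta>0: "\<zeta> \<noteq> 0" using N by (cases "\<zeta> = 0") (auto simp: power_0_left)
  have cl: "e (g [^] l) \<triangleright>\<^bsub>M\<^esub> m \<in> carrier M" for l :: nat using g m by simp
  have cl': "(\<Sum>l<N. scale M (inverse \<zeta> ^ (l * c)) (e (g [^] l) \<triangleright>\<^bsub>M\<^esub> m)) \<in> carrier M" for c
    by (intro is_vspace_sum[OF yd_vs] is_vspace_scale[OF yd_vs] cl)
  show ucl: "u c \<in> carrier M" for c
    unfolding u_def by (intro is_vspace_scale[OF yd_vs] cl')
  have lin: "linear_map M M (\<lambda>m. e g \<triangleright>\<^bsub>M\<^esub> m)"
    by (rule bilinear_mapD(1)[OF yd_bilinear_act]) (simp add: g)
  have step: "e g \<triangleright>\<^bsub>M\<^esub> e (g [^] l) \<triangleright>\<^bsub>M\<^esub> m = e (g [^] Suc l) \<triangleright>\<^bsub>M\<^esub> m" for l :: nat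
  proof -
    have "e (g [^] Suc l) = e g \<cdot>\<^bsub>K\<^esub> e (g [^] l)" using nat_pow_Suc2[OF g(1), of l] by (simp only: mult_e)
    then show ?thesis using yd_act_mult[of "e g" "e (g [^] l)" m] g m by simp
  qed
  let ?F = "\<lambda>c l. scale M (inverse \<zeta> ^ (l * c)) (e (g [^] l) \<triangleright>\<^bsub>M\<^esub> m)"
  have "e g \<triangleright>\<^bsub>M\<^esub> (\<Sum>l<N. ?F c l) = scale M (\<zeta> ^ c) (\<Sum>l<N. ?F c l)" for c
  proof -
    have "e g \<triangleright>\<^bsub>M\<^esub> (\<Sum>l<N. ?F c l) = (\<Sum>l<N. e g \<triangleright>\<^bsub>M\<^esub> ?F c l)"
      by (rule linear_map_sum[OF yd_vs lin]) (intro is_vspace_scale[OF yd_vs] cl)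
    also have "\<dots> = (\<Sum>l<N. scale M (inverse \<zeta> ^ (l * c)) (e (g [^] Suc l) \<triangleright>\<^bsub>M\<^esub> m))"
      using linear_mapD(3)[OF lin cl] by (simp add: step)
    also have "\<dots> = (\<Sum>l<N. scale M (\<zeta> ^ c) (?F c (Suc l)))"
    proof (intro sum.cong refl)
      fix l
      have "\<zeta> ^ c * inverse \<zeta> ^ (Suc l * c) = (\<zeta> * inverse \<zeta>) ^ c * inverse \<zeta> ^ (l * c)"
        by (simp only: mult_Suc power_add power_mult_distrib mult.assoc)
      then have "\<zeta> ^ c * inverse \<zeta> ^ (Suc l * c) = inverse \<zeta> ^ (l * c)" using \<zeta>0 by simp
      then show "scale M (inverse \<zeta> ^ (l * c)) (e (g [^] Suc l) \<triangleright>\<^bsub>M\<^esub> m) = scale M (\<zeta> ^ c) (?F c (Suc l))"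
        by (simp only: V.scale_scale)
    qed
    also have "\<dots> = scale M (\<zeta> ^ c) (\<Sum>l<N. ?F c (Suc l))" by (simp only: V.scale_sum_right)
    also have "(\<Sum>l<N. ?F c (Suc l)) = (\<Sum>l<N. ?F c l)"
    proof -
      have "?F c N = ?F c 0"
      proof -
        have "inverse \<zeta> ^ (N * c) = 1" using N by (simp add: power_mult power_inverse)
        then show ?thesis using g by simp
      qed
      then show ?thesis using sum.lessThan_Suc_shift[of "?F c" N] by (simp add: add.commute)
    qed
    finally show ?thesis .
  qed
  then show "e g \<triangleright>\<^bsub>M\<^esub> u c = scale M (\<zeta> ^ c) (u c)"
    unfolding u_def linear_mapD(3)[OF lin cl'] by (simp only: V.scale_left_commute)
  have "(\<Sum>c<N. \<Sum>l<N. ?F c l) = (\<Sum>l<N. \<Sum>c<N. ?F c l)" by (rule sum.swap)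
  also have "\<dots> = (\<Sum>l<N. scale M (qint (inverse \<zeta> ^ l) N) (e (g [^] l) \<triangleright>\<^bsub>M\<^esub> m))"
    by (simp only: V.scale_sum_left[symmetric] qint_def power_mult)
  also have "\<dots> = (\<Sum>l<N. if l = 0 then scale M (of_nat N) m else 0)"
  proof (intro sum.cong refl)
    fix l assume l: "l \<in> {..<N}"
    show "scale M (qint (inverse \<zeta> ^ l) N) (e (g [^] l) \<triangleright>\<^bsub>M\<^esub> m) = (if l = 0 then scale M (of_nat N) m else 0)"
    proof (cases "l = 0")
      case True
      then show ?thesis using yd_act_unity[OF m] by (simp add: qint_def unity_K)
    next
      case False
      then have "inverse \<zeta> ^ l \<noteq> 1"
        using \<zeta> l by (auto simp: has_order_def power_inverse)
      moreover have "(inverse \<zeta> ^ l) ^ N = 1"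
        using N by (metis mult.commute power_inverse power_mult inverse_1 power_one)
      ultimately have "qint (inverse \<zeta> ^ l) N = 0" using qint_geometric[of "inverse \<zeta> ^ l" N] by simp
      then show ?thesis using False by simp
    qed
  qed
  also have "\<dots> = scale M (of_nat N) m" using N by simp
  finally have "(\<Sum>c<N. u c) = scale M (1 / of_nat N) (scale M (of_nat N) m)"
    unfolding u_def by (simp only: V.scale_sum_right[symmetric])
  then show "m = (\<Sum>c<N. u c)" using char by simp
  assume h: "h \<in> carrier G" and co: "coact M m = tens K M (e h) m"
  have 1: "coact M (e (g [^] l) \<triangleright>\<^bsub>M\<^esub> m) = tens K M (e h) (e (g [^] l) \<triangleright>\<^bsub>M\<^esub> m)" for l :: nat
    by (rule act_homogeneous[OF m _ h co]) (simp add: g)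
  let ?l1 = "coact M" and ?l2 = "\<lambda>m. tens K M (e h) m"
  have l2: "linear_map M (tensor_space K M) ?l2" by (rule linear_map_tens_right) (simp add: h)
  have F: "?F c l \<in> carrier M" for l by (intro is_vspace_scale[OF yd_vs] cl)
  have eq: "?l1 (?F c l) = ?l2 (?F c l)" for l
    unfolding linear_mapD(3)[OF yd_linear_coact cl] linear_mapD(3)[OF l2 cl] by (simp only: 1)
  have "?l1 (\<Sum>l<N. ?F c l) = (\<Sum>l<N. ?l1 (?F c l))"
    by (rule linear_map_sum[OF yd_vs yd_linear_coact F])
  also have "\<dots> = (\<Sum>l<N. ?l2 (?F c l))" by (simp only: eq)
  also have "\<dots> = ?l2 (\<Sum>l<N. ?F c l)"
    by (rule linear_map_sum[OF yd_vs l2 F, symmetric])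
  finally show "coact M (u c) = tens K M (e h) (u c)"
    unfolding u_def linear_mapD(3)[OF yd_linear_coact cl'] linear_mapD(3)[OF l2 cl'] by (rule arg_cong)
qed

end

lemma bilinear_braiding:
  assumes M: "yd_module K M" and N: "yd_module K N"
  shows "bilinear_map M N (tensor_space N M)
    (\<lambda>m n. sweedler K M (coact M m) (\<lambda>h m0. tens N M (h \<triangleright>\<^bsub>N\<^esub> n) m0))"
proof (rule bilinear_mapI)
  fix m assume m: "m \<in> carrier M"
  show "linear_map N (tensor_space N M) (\<lambda>n. sweedler K M (coact M m) (\<lambda>h m0. tens N M (h \<triangleright>\<^bsub>N\<^esub> n) m0))"
    by (rule linear_map_sweedler_param[OF linear_map_comp[OF bilinear_mapD(1)[OF yd_bilinear_act[OF N]] linear_map_tens_left]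
      K.vs is_vspace_tensor_space coact_closed[OF M m]])
next
  fix n assume n: "n \<in> carrier N"
  show "linear_map M (tensor_space N M) (\<lambda>m. sweedler K M (coact M m) (\<lambda>h m0. tens N M (h \<triangleright>\<^bsub>N\<^esub> n) m0))"
    by (rule linear_map_sweedler_arg[OF yd_linear_coact[OF M]
      bilinear_map_comp[OF bilinear_map_tens bilinear_mapD(2)[OF yd_bilinear_act[OF N] n] linear_map_id]
      K.vs is_vspace_tensor_space])
qed

lemma braiding_homogeneous:
  assumes M: "yd_module K M" and N: "yd_module K N" and m: "m \<in> carrier M" and n: "n \<in> carrier N"
    and h: "h \<in> carrier G" and co: "coact M m = tens K M (e h) m"
  shows "braiding K M N (tens M N m n) = tens N M (e h \<triangleright>\<^bsub>N\<^esub> n) m"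
proof -
  have "braiding K M N (tens M N m n) = sweedler K M (coact M m) (\<lambda>h m0. tens N M (h \<triangleright>\<^bsub>N\<^esub> n) m0)"
    unfolding braiding_def
    by (rule sweedler_tens[OF bilinear_braiding[OF M N] is_vspace_tensor_space m n])
  also have "\<dots> = tens N M (e h \<triangleright>\<^bsub>N\<^esub> n) m"
    unfolding co
    by (rule sweedler_tens[OF bilinear_map_comp[OF bilinear_map_tens bilinear_mapD(2)[OF yd_bilinear_act[OF N] n] linear_map_id]
      is_vspace_tensor_space e_closed[OF h] m])
  finally show ?thesis .
qed

end

section \<open>Roots of unity and additive orders\<close>

lemma has_order_dvd:
  assumes "has_order z n" shows "z ^ m = 1 \<longleftrightarrow> n dvd m"
proof -
  have n: "n > 0" "z ^ n = 1" using assms by (auto simp: has_order_def)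
  have "z ^ m = z ^ (n * (m div n) + m mod n)" by simp
  also have "\<dots> = z ^ (m mod n)" unfolding power_add power_mult n by simp
  finally have "z ^ m = z ^ (m mod n)" .
  moreover have "z ^ (m mod n) = 1 \<longleftrightarrow> m mod n = 0"
    using assms n mod_less_divisor[of n m] by (auto simp: has_order_def)
  ultimately show ?thesis by (simp add: dvd_eq_mod_eq_0)
qed

lemma has_orderI:
  assumes "n > 0" "\<And>m. z ^ m = 1 \<longleftrightarrow> n dvd m" shows "has_order z n"
  using assms by (auto simp: has_order_def dest: dvd_imp_le)

lemma has_order_if_power_eq_1:
  assumes "z ^ n = 1" "n > 0" obtains m where "has_order z m" "m dvd n"
proof -
  define m where "m = (LEAST m. 0 < m \<and> z ^ m = 1)"
  have "0 < m \<and> z ^ m = 1" unfolding m_def by (rule LeastI[of _ n]) (use assms in simp)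
  moreover have "z ^ k \<noteq> 1" if "0 < k" "k < m" for k
    using not_less_Least[of k "\<lambda>m. 0 < m \<and> z ^ m = 1"] that by (auto simp: m_def)
  ultimately have "has_order z m" by (auto simp: has_order_def)
  then show ?thesis using that has_order_dvd assms(1) by blast
qed

text \<open>A root of \<open>1 + u + \<dots> + u\<^bsup>p-1\<^esup>\<close> is a \<open>p\<close>-th root of unity, and it differs from \<open>1\<close>, where the sum is \<open>p \<noteq> 0\<close>.\<close>

lemma ex_prime_order:
  assumes p: "prime p"
  shows "\<exists>u::'k::{alg_closed_field, field_char_0}. has_order u p"
proof -
  have p1: "p > 1" using p by (rule prime_gt_1_nat)
  have "\<exists>u::'k. (\<Sum>k\<le>p - 1. 1 * u ^ k) = 0"
    by (rule alg_closed) (use p1 in auto)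
  then obtain u :: 'k where "(\<Sum>k\<le>p - 1. u ^ k) = 0" by auto
  moreover have "{..p - 1} = {..<p}" using p1 by auto
  ultimately have u: "qint u p = 0" by (simp add: qint_def)
  then have "u ^ p = 1" "u \<noteq> 1" using qint_geometric[of u p] p1 by (auto simp: qint_def)
  then obtain m where m: "has_order u m" "m dvd p" using has_order_if_power_eq_1[of u p] p1 by auto
  then have "m = 1 \<or> m = p" using p by (simp add: prime_nat_iff)
  then show ?thesis using m(1) \<open>u \<noteq> 1\<close> by (auto simp: has_order_def)
qed

text \<open>A primitive \<open>p n\<close>-th root of unity is a \<open>p\<close>-th root of a primitive \<open>n\<close>-th one; if \<open>p\<close> does not divide \<open>n\<close>, the
  \<open>p\<close>-th root has to be chosen outside the \<open>n\<close>-th roots of unity.\<close>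

lemma ex_has_order:
  assumes "n > 0" shows "\<exists>z::'k::{alg_closed_field, field_char_0}. has_order z n"
  using assms
proof (induction n rule: less_induct)
  case (less n)
  show ?case
  proof (cases "n = 1")
    case True
    then show ?thesis by (auto simp: has_order_def intro!: exI[of _ 1])
  next
    case False
    then obtain p where p: "prime p" "p dvd n" using prime_factor_nat by blast
    then obtain m where m: "n = m * p" by (metis dvdE mult.commute)
    have p1: "p > 1" using p(1) by (rule prime_gt_1_nat)
    have "m < n" "m > 0" using m less.prems p1 by auto
    then obtain z :: 'k where z: "has_order z m" using less.IH by blast
    obtain y0 :: 'k where y0: "y0 ^ p = z" using nth_root_exists[of p z] p1 by auto
    obtain u :: 'k where u: "has_order u p" using ex_prime_order[OF p(1)] by blast
    have "\<exists>y. y ^ p = z \<and> y ^ m \<noteq> 1"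
    proof (cases "y0 ^ m = 1")
      case True
      have "\<not> p dvd m"
      proof
        assume "p dvd m"
        then obtain k where k: "m = p * k" by blast
        then have "\<not> m dvd k" using \<open>m > 0\<close> p1 by (auto dest: dvd_imp_le)
        then show False using True has_order_dvd[OF z, of k] y0 by (simp add: k power_mult)
      qed
      then have "u ^ m \<noteq> 1" "u ^ p = 1" using has_order_dvd[OF u] by simp_all
      then have "(u * y0) ^ p = z \<and> (u * y0) ^ m \<noteq> 1"
        using y0 True by (simp add: power_mult_distrib)
      then show ?thesis by blast
    qed (use y0 in blast)
    then obtain y where y: "y ^ p = z" "y ^ m \<noteq> 1" by blast
    have "y ^ n = 1"
      using z unfolding m mult.commute[of m] power_mult y(1) by (simp add: has_order_def)
    then obtain k where k: "has_order y k" "k dvd n"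
      using has_order_if_power_eq_1 less.prems by blast
    have "z ^ k = (y ^ k) ^ p" unfolding y(1)[symmetric] by (simp add: power_mult[symmetric] mult.commute)
    then have "m dvd k" using k(1) has_order_dvd[OF z, of k] by (simp add: has_order_def)
    then obtain j where j: "k = m * j" by blast
    then have "j dvd p" using k(2) \<open>m > 0\<close> by (simp add: m)
    moreover have "j \<noteq> 1" using y(2) k(1) by (auto simp: j has_order_def)
    ultimately have "k = n" using p(1) by (auto simp: prime_nat_iff j m)
    then show ?thesis using k(1) by blast
  qed
qed

lemma additive_order:
  assumes N: "N \<ge> 2" and c: "c \<in> carrier (residue_ring (int N))"
  shows "additive_order N c > 0" and "additive_order N c dvd m \<longleftrightarrow> int N dvd int m * c"
proof -
  let ?R = "residue_ring (int N)"
  interpret residues "int N" ?R by unfold_locales (use N in simp_all)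
  have A: "Group.group (add_monoid ?R)" by (rule add.group_axioms)
  have cA: "c \<in> carrier (add_monoid ?R)" using c by simp
  have fin: "Finite_Set.finite (carrier (add_monoid ?R))" by simp
  show "additive_order N c > 0"
    using group.ord_ge_1[OF A fin cA] by (simp add: additive_order_def)
  have "c [^]\<^bsub>add_monoid ?R\<^esub> m = (int m * c) mod int N" for m :: nat
  proof (induction m)
    case 0
    show ?case by (simp add: residue_ring_def)
  next
    case (Suc m)
    then show ?case
      by (simp add: Group.nat_pow_Suc res_add_eq residue_ring_def mod_simps algebra_simps)
  qed
  then have "c [^]\<^bsub>add_monoid ?R\<^esub> m = \<one>\<^bsub>add_monoid ?R\<^esub> \<longleftrightarrow> int N dvd int m * c"
    by (simp add: residue_ring_def dvd_eq_mod_eq_0)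
  then show "additive_order N c dvd m \<longleftrightarrow> int N dvd int m * c"
    using group.pow_eq_id[OF A cA, of m] by (simp add: additive_order_def)
qed

section \<open>Finite cyclic groups\<close>

lemma cyclic_generator:
  assumes G: "Group.group G" "finite (carrier G)" "cyclic_group G"
  obtains g where "g \<in> carrier G" "g [^]\<^bsub>G\<^esub> card (carrier G) = \<one>\<^bsub>G\<^esub>"
    "bij_betw (\<lambda>l::nat. g [^]\<^bsub>G\<^esub> l) {..<card (carrier G)} (carrier G)"
proof -
  interpret Group.group G by (rule G)
  let ?N = "card (carrier G)"
  obtain g where g: "g \<in> carrier G" "subgroup_generated G {g} = G"
    using G(3) by (auto simp: cyclic_group_def)
  have "carrier G = carrier (subgroup_generated G {g})" using g(2) by simp
  also have "\<dots> = generate G {g}" using g(1) by (simp add: carrier_subgroup_generated)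
  also have "\<dots> = {g [^]\<^bsub>G\<^esub> k | k. k \<in> (UNIV::nat set)}"
    by (rule generate_pow_on_finite_carrier[OF G(2) g(1)])
  finally have gen: "carrier G = range (\<lambda>k::nat. g [^]\<^bsub>G\<^esub> k)" by auto
  have N: "?N > 0" using G(2) one_closed by (metis card_gt_0_iff empty_iff)
  have gN: "g [^]\<^bsub>G\<^esub> ?N = \<one>\<^bsub>G\<^esub>"
    using pow_order_eq_1[OF g(1)] by (simp add: order_def)
  have md: "g [^]\<^bsub>G\<^esub> k = g [^]\<^bsub>G\<^esub> (k mod ?N)" for k :: nat
  proof -
    have "g [^]\<^bsub>G\<^esub> k = g [^]\<^bsub>G\<^esub> (?N * (k div ?N) + k mod ?N)" by simp
    also have "\<dots> = (g [^]\<^bsub>G\<^esub> ?N) [^]\<^bsub>G\<^esub> (k div ?N) \<otimes>\<^bsub>G\<^esub> g [^]\<^bsub>G\<^esub> (k mod ?N)"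
      by (simp only: nat_pow_mult[OF g(1)] nat_pow_pow[OF g(1)])
    also have "\<dots> = g [^]\<^bsub>G\<^esub> (k mod ?N)" using g(1) by (simp add: gN)
    finally show ?thesis .
  qed
  have surj: "(\<lambda>l::nat. g [^]\<^bsub>G\<^esub> l) ` {..<?N} = carrier G"
  proof
    show "carrier G \<subseteq> (\<lambda>l::nat. g [^]\<^bsub>G\<^esub> l) ` {..<?N}"
      unfolding gen using md N gen by (metis (no_types, lifting) image_eqI image_subsetI lessThan_iff mod_less_divisor)
  qed (use g in auto)
  then have "inj_on (\<lambda>l::nat. g [^]\<^bsub>G\<^esub> l) {..<?N}" by (intro eq_card_imp_inj_on) auto
  then show ?thesis using that[OF g(1) gN] surj by (simp add: bij_betw_def)
qed

section \<open>Homogeneous eigenbases\<close>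

context group_algebra_hopf
begin

text \<open>The homogeneous components of an element are decomposed further into eigenvectors, which stay
  homogeneous.\<close>

lemma homogeneous_eigenvectors_span:
  fixes V :: "('k, 'g \<Rightarrow>\<^sub>0 'k, 'v::ab_group_add) yd"
  assumes V: "yd_module K V" and char: "of_nat N \<noteq> (0::'k)"
    and g: "g \<in> carrier G" "g [^] N = \<one>" and \<zeta>: "has_order \<zeta> N"
  shows "carrier V \<subseteq> module.span (scale V)
    {u \<in> carrier V. (\<exists>h\<in>carrier G. coact V u = tens K V (e h) u) \<and> (\<exists>c<N. e g \<triangleright>\<^bsub>V\<^esub> u = scale V (\<zeta> ^ c) u)}"
    (is "_ \<subseteq> module.span _ ?S")
proof
  note vs = yd_vs[OF V]
  interpret VS: vector_space "scale V" using vs by (simp add: is_vspace_def)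
  fix m assume m: "m \<in> carrier V"
  define p where "p = (\<lambda>a. coefficient V a (coact V m))"
  have p_closed: "p a \<in> carrier V" if "a \<in> carrier G" for a
    unfolding p_def by (rule homogeneous_components(1)[OF V m that])
  have p_coact: "coact V (p a) = tens K V (e a) (p a)" if "a \<in> carrier G" for a
    unfolding p_def by (rule homogeneous_components(2)[OF V m that])
  have p_sum: "m = (\<Sum>a\<in>carrier G. p a)"
    unfolding p_def by (rule homogeneous_components(3)[OF V m])
  define u where "u = (\<lambda>a c. scale V (1 / of_nat N) (\<Sum>l<N. scale V (inverse \<zeta> ^ (l * c)) (e (g [^] l) \<triangleright>\<^bsub>V\<^esub> p a)))"
  note ev = eigenvector_sum[OF V char g \<zeta>]
  have "u a c \<in> ?S" if a: "a \<in> carrier G" and "c < N" for a c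
    using ev(1,2)[OF p_closed[OF a], of c] ev(4)[OF p_closed[OF a] a p_coact[OF a], of c] that
    unfolding u_def by blast
  then have "(\<Sum>a\<in>carrier G. \<Sum>c<N. u a c) \<in> VS.span ?S"
    by (intro VS.span_sum VS.span_base) simp
  moreover have "(\<Sum>a\<in>carrier G. \<Sum>c<N. u a c) = (\<Sum>a\<in>carrier G. p a)"
    unfolding u_def by (intro sum.cong refl) (rule ev(3)[OF p_closed, symmetric])
  ultimately show "m \<in> VS.span ?S" by (simp only: p_sum[symmetric])
qed

text \<open>The basis in the definition of \<^const>\<open>D2_type\<close> need be neither homogeneous nor made of
  eigenvectors. But if \<open>w\<^sub>k\<close> occurs in \<open>v\<^sub>i\<close> and \<open>w\<^sub>l\<close> in \<open>v\<^sub>j\<close>, comparing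
  the coefficients of \<open>w\<^sub>l \<otimes> w\<^sub>k\<close> in \<open>\<sigma>(v\<^sub>i \<otimes> v\<^sub>j)\<close> shows that the braiding of \<open>w\<^sub>k\<close> with \<open>w\<^sub>l\<close> is
  the one of \<open>v\<^sub>i\<close> with \<open>v\<^sub>j\<close>. As the change of basis is invertible, the \<open>w\<^sub>k\<close> can be numbered such that
  \<open>w\<^sub>i\<close> occurs in \<open>v\<^sub>i\<close>.\<close>

lemma D2_type_eigenbasis:
  fixes V :: "('k, 'g \<Rightarrow>\<^sub>0 'k, 'v::ab_group_add) yd"
  assumes D2: "D2_type K V" and char: "of_nat N \<noteq> (0::'k)"
    and g: "g \<in> carrier G" "g [^] N = \<one>" and \<zeta>: "has_order \<zeta> N"
    and gen: "carrier G \<subseteq> (\<lambda>l::nat. g [^] l) ` {..<N}"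
  obtains w :: "2 \<Rightarrow> 'v" and d c :: "2 \<Rightarrow> nat" where
    "\<And>i. d i < N" "\<And>i. c i < N" "inj w" "\<not> module.dependent (scale V) (range w)"
    "module.span (scale V) (range w) = carrier V"
    "\<And>i. coact V (w i) = tens K V (e (g [^] d i)) (w i)"
    "\<And>i. e g \<triangleright>\<^bsub>V\<^esub> w i = scale V (\<zeta> ^ c i) (w i)"
    "\<zeta> ^ (d 1 * c 1) \<noteq> 1" "\<zeta> ^ (d 2 * c 2) \<noteq> 1" "\<zeta> ^ (d 1 * c 2) * \<zeta> ^ (d 2 * c 1) = 1"
proof -
  have V: "yd_module K V" using D2 by (simp add: D2_type_def)
  note vs = yd_vs[OF V]
  interpret VS: vector_space "scale V" using vs by (simp add: is_vspace_def)
  have subV: "VS.subspace (carrier V)" using vs by (simp add: is_vspace_def)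
  obtain v :: "2 \<Rightarrow> 'v" and q where v: "inj v" "VS.independent (range v)" "VS.span (range v) = carrier V"
    and br: "\<And>i j. braiding K V V (tens V V (v i) (v j)) = tscale (q i j) (tens V V (v j) (v i))"
    and q: "q 1 1 \<noteq> 1" "q 2 2 \<noteq> 1" "q 1 2 * q 2 1 = 1"
    using D2 unfolding D2_type_def scale_tensor_space by blast
  let ?S = "{u \<in> carrier V. (\<exists>h\<in>carrier G. coact V u = tens K V (e h) u) \<and> (\<exists>c<N. e g \<triangleright>\<^bsub>V\<^esub> u = scale V (\<zeta> ^ c) u)}"
  obtain B where B: "B \<subseteq> ?S" "VS.independent B" "?S \<subseteq> VS.span B"
    using VS.maximal_independent_subset by blast
  have spanB: "VS.span B = carrier V"
  proof
    show "VS.span B \<subseteq> carrier V" by (rule VS.span_minimal[OF _ subV]) (use B(1) in blast)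
    have "VS.span ?S \<subseteq> VS.span B" by (rule VS.span_minimal[OF B(3) VS.subspace_span])
    then show "carrier V \<subseteq> VS.span B"
      using homogeneous_eigenvectors_span[OF V char g \<zeta>] by (rule subset_trans[rotated])
  qed
  have "card B = VS.dim (carrier V)"
    using VS.dim_span_eq_card_independent[OF B(2)] spanB by simp
  also have "\<dots> = card (range v)"
    using VS.dim_span_eq_card_independent[OF v(2)] v(3) by simp
  also have "\<dots> = 2" using v(1) by (simp add: card_image)
  finally obtain b1 b2 where b: "B = {b1, b2}" "b1 \<noteq> b2" by (auto simp: card_2_iff)
  define w0 :: "2 \<Rightarrow> 'v" where "w0 = (\<lambda>i. if i = 1 then b1 else b2)"
  have rw0: "range w0 = B"
  proof
    show "B \<subseteq> range w0"
      unfolding b using rangeI[of w0 1] rangeI[of w0 2] by (simp add: w0_def)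
  qed (auto simp: w0_def b)
  have inj0: "inj w0"
    unfolding inj_def w0_def using b(2) two_cases by metis
  have w0S: "w0 i \<in> ?S" for i using rw0 B(1) by blast
  have "\<exists>d c. d < N \<and> c < N \<and> coact V (w0 i) = tens K V (e (g [^] (d::nat))) (w0 i) \<and> e g \<triangleright>\<^bsub>V\<^esub> w0 i = scale V (\<zeta> ^ c) (w0 i)" for i
    using w0S[of i] gen by blast
  then obtain d0 c0 where lt: "\<And>i. d0 i < N" "\<And>i. c0 i < N" and d0: "\<And>i. coact V (w0 i) = tens K V (e (g [^] (d0 i::nat))) (w0 i)"
    and c0: "\<And>i. e g \<triangleright>\<^bsub>V\<^esub> w0 i = scale V (\<zeta> ^ c0 i) (w0 i)" by metis
  have w0V: "w0 i \<in> carrier V" for i using w0S[of i] by blast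
  have vV: "v i \<in> carrier V" for i using v(3) VS.span_base[of "v i" "range v"] by auto
  obtain \<phi> where \<phi>: "\<And>k. linear_map V ground (\<phi> k)" "\<And>j k. \<phi> k (w0 j) = (if j = k then 1 else (0::'k))"
    "\<And>m. m \<in> carrier V \<Longrightarrow> m = (\<Sum>k\<in>UNIV. scale V (\<phi> k m) (w0 k))"
    by (rule basis_coordinates[OF vs inj0]) (use B(2) rw0 spanB in auto)
  obtain \<psi> where \<psi>: "\<And>k. linear_map V ground (\<psi> k)" "\<And>j k. \<psi> k (v j) = (if j = k then 1 else (0::'k))"
    "\<And>m. m \<in> carrier V \<Longrightarrow> m = (\<Sum>k\<in>UNIV. scale V (\<psi> k m) (v k))"
    by (rule basis_coordinates[OF vs v]) blast
  have lin_expand: "f m = (\<Sum>k\<in>UNIV. \<phi> k m * f (w0 k))" if f: "linear_map V ground f" and m: "m \<in> carrier V" for f m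
  proof -
    have "f m = f (\<Sum>k\<in>UNIV. scale V (\<phi> k m) (w0 k))" by (rule arg_cong[OF \<phi>(3)[OF m]])
    also have "\<dots> = (\<Sum>k\<in>UNIV. f (scale V (\<phi> k m) (w0 k)))"
      by (rule linear_map_sum[OF vs f]) (rule is_vspace_scale[OF vs w0V])
    also have "\<dots> = (\<Sum>k\<in>UNIV. \<phi> k m * f (w0 k))"
      by (simp only: linear_mapD(3)[OF f w0V]) (simp add: ground_def)
    finally show ?thesis .
  qed
  have hG: "g [^] d0 k \<in> carrier G" for k using g(1) by simp
  have coord_act: "\<phi> l (e (g [^] d0 k) \<triangleright>\<^bsub>V\<^esub> m) = \<zeta> ^ (d0 k * c0 l) * \<phi> l m" if m: "m \<in> carrier V" for k l m
  proof -
    have lin: "linear_map V ground (\<lambda>m. \<phi> l (e (g [^] d0 k) \<triangleright>\<^bsub>V\<^esub> m))"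
      by (rule linear_map_comp[OF bilinear_mapD(1)[OF yd_bilinear_act[OF V] e_closed[OF hG]] \<phi>(1)])
    have "\<phi> l (e (g [^] d0 k) \<triangleright>\<^bsub>V\<^esub> w0 j) = (if j = l then \<zeta> ^ (d0 k * c0 l) else 0)" for j
      using act_pow[OF V w0V g(1) c0, of "d0 k"] linear_mapD(3)[OF \<phi>(1) w0V]
      by (simp add: \<phi>(2) ground_def power_mult[symmetric] mult.commute)
    then have "\<phi> l (e (g [^] d0 k) \<triangleright>\<^bsub>V\<^esub> m) = (\<Sum>j\<in>UNIV. if j = l then \<phi> j m * \<zeta> ^ (d0 k * c0 l) else 0)"
      unfolding lin_expand[OF lin m] by (intro sum.cong refl) simp
    then show ?thesis by simp
  qed
  \<comment> \<open>the bilinear form \<open>\<beta>\<close> picks the coefficient of \<open>w\<^sub>l \<otimes> w\<^sub>k\<close>\<close>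
  have key: "\<zeta> ^ (d0 k * c0 l) = q i j" if k: "\<phi> k (v i) \<noteq> 0" and l: "\<phi> l (v j) \<noteq> 0" for i j k l
  proof -
    let ?\<beta> = "\<lambda>u m. \<phi> l u * \<phi> k m"
    have \<beta>: "bilinear_map V V ground ?\<beta>" by (rule bilinear_map_product[OF \<phi>(1) \<phi>(1)])
    let ?F = "\<lambda>m n. sweedler K V (coact V m) (\<lambda>h m0. tens V V (h \<triangleright>\<^bsub>V\<^esub> n) m0)"
    have br': "braiding K V V (tens V V m n) = ?F m n" if "m \<in> carrier V" "n \<in> carrier V" for m n
      unfolding braiding_def by (rule sweedler_tens[OF bilinear_braiding[OF V V] is_vspace_tensor_space that])
    have ev: "linear_map (tensor_space V V) ground (\<lambda>t. t ?\<beta>)"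
      by (simp add: linear_map_def ground_def tscale_def)
    have lin: "linear_map V ground (\<lambda>m. ?F m (v j) ?\<beta>)"
      by (rule linear_map_comp[OF bilinear_mapD(2)[OF bilinear_braiding[OF V V] vV] ev])
    have F_w0: "?F (w0 k') (v j) ?\<beta> = (if k' = k then \<zeta> ^ (d0 k * c0 l) * \<phi> l (v j) else 0)" for k'
      unfolding br'[OF w0V vV, symmetric] braiding_homogeneous[OF V V w0V vV hG d0] tens_apply[OF \<beta>]
      by (simp add: coord_act[OF vV] \<phi>(2))
    have "q i j * (\<phi> l (v j) * \<phi> k (v i)) = ?F (v i) (v j) ?\<beta>"
      using br[of i j] unfolding br'[OF vV vV] by (simp add: tscale_def tens_apply[OF \<beta>])
    also have "\<dots> = (\<Sum>k'\<in>UNIV. \<phi> k' (v i) * ?F (w0 k') (v j) ?\<beta>)" by (rule lin_expand[OF lin vV])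
    also have "\<dots> = (\<Sum>k'\<in>UNIV. if k' = k then \<phi> k (v i) * (\<zeta> ^ (d0 k * c0 l) * \<phi> l (v j)) else 0)"
      unfolding F_w0 by (intro sum.cong refl) simp
    also have "\<dots> = \<phi> k (v i) * (\<zeta> ^ (d0 k * c0 l) * \<phi> l (v j))" by simp
    finally show ?thesis using k l by (simp add: mult_ac)
  qed
  \<comment> \<open>if neither numbering worked, the products \<open>\<phi> 1 (v 1) \<phi> 2 (v 2)\<close> and \<open>\<phi> 2 (v 1) \<phi> 1 (v 2)\<close> would both vanish
       and the matrix of the \<open>\<phi> k (v i)\<close> would be singular, although the \<open>\<psi> j (w0 k)\<close> form its inverse\<close>
  have "\<exists>k l. k \<noteq> l \<and> \<phi> k (v 1) \<noteq> 0 \<and> \<phi> l (v 2) \<noteq> 0"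
  proof (rule ccontr)
    assume "\<not> ?thesis"
    then have z: "\<phi> 1 (v 1) = 0 \<or> \<phi> 2 (v 2) = 0" "\<phi> 2 (v 1) = 0 \<or> \<phi> 1 (v 2) = 0"
      by (metis two_cases zero_neq_one one_neq_zero)+
    have U: "(\<Sum>k\<in>UNIV. f k) = f 1 + f 2" for f :: "2 \<Rightarrow> 'k"
    proof -
      have "sum f UNIV = sum f {1, 2}" using two_cases by (intro sum.cong) auto
      then show ?thesis by simp
    qed
    have "\<phi> 1 (v i) * \<psi> j (w0 1) + \<phi> 2 (v i) * \<psi> j (w0 2) = (if i = j then 1 else 0)" for i j
      using lin_expand[OF \<psi>(1) vV, of j i] unfolding U \<psi>(2) by simp
    from this[of 1 1] this[of 1 2] this[of 2 1] this[of 2 2] z show False by auto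
  qed
  then obtain k l where kl: "k \<noteq> l" "\<phi> k (v 1) \<noteq> 0" "\<phi> l (v 2) \<noteq> 0" by blast
  define s :: "2 \<Rightarrow> 2" where "s = (\<lambda>i. if i = 1 then k else l)"
  have s: "inj s" unfolding inj_def s_def using kl(1) two_cases by metis
  then have "surj s" by (rule finite_UNIV_inj_surj[OF finite_class.finite_UNIV])
  then have range_s: "range (\<lambda>i. w0 (s i)) = B" using rw0 by (metis image_image)
  have s_nz: "\<phi> (s 1) (v 1) \<noteq> 0" "\<phi> (s 2) (v 2) \<noteq> 0" using kl by (simp_all add: s_def)
  show ?thesis
  proof (rule that[of "\<lambda>i. d0 (s i)" "\<lambda>i. c0 (s i)" "\<lambda>i. w0 (s i)"])
    show "inj (\<lambda>i. w0 (s i))" using inj0 s by (auto simp: inj_def)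
  qed (use lt range_s B(2) spanB d0 c0 key[OF s_nz(1) s_nz(1)] key[OF s_nz(2) s_nz(2)]
      key[OF s_nz(1) s_nz(2)] key[OF s_nz(2) s_nz(1)] q in auto)
qed

end

section \<open>Nichols algebras over a group algebra\<close>

lemma yd_of_simps [simp]:
  "carrier (yd_of R) = carrier R" "scale (yd_of R) = scale R" "act (yd_of R) = bact R" "coact (yd_of R) = bcoact R"
  by (simp_all add: yd_of_def)

lemma yd_of_tensors [simp]:
  "tens (yd_of R) W1 = tens R W1" "tens W2 (yd_of R) = tens W2 R"
  "tensor_space (yd_of R) W3 = tensor_space R W3" "tensor_space W4 (yd_of R) = tensor_space W4 R"
  "sweedler (yd_of R) W5 = sweedler R W5" "sweedler W6 (yd_of R) = sweedler W6 R"
  by (rule tens_cong tensor_space_cong sweedler_space_cong; simp)+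

lemma linear_map_yd_of [simp]:
  "linear_map (yd_of R) W f = linear_map R W f" "linear_map W' (yd_of R) f' = linear_map W' R f'"
  by (simp_all add: linear_map_def)

lemma bilinear_map_yd_of [simp]:
  "bilinear_map U W (yd_of R) f = bilinear_map U W R f"
  by (simp_all add: bilinear_map_def)

context group_algebra_hopf
begin

context
  fixes R :: "('k, 'g \<Rightarrow>\<^sub>0 'k, 'r::ab_group_add) braided_bialg"
  assumes R: "braided_hopf K R"
begin

lemma yd_R: "yd_module K (yd_of R)" and algebra_R: "is_algebra R" and coalgebra_R: "is_coalgebra R"
  and mul_morphism: "yd_morphism K (yd_tensor K (yd_of R) (yd_of R)) (yd_of R) (\<lambda>t. sweedler R R t (mul R))"
  and unity_morphism: "yd_morphism K (yd_unit K) (yd_of R) (\<lambda>c. scale R c (unity R))"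
  using R by (simp_all only: braided_hopf_def)

lemma comul_R_mult:
  assumes "r \<in> carrier R" "s \<in> carrier R"
  shows "comul R (r \<cdot>\<^bsub>R\<^esub> s) =
      sweedler R R (comul R r) (\<lambda>r1 r2. sweedler R R (comul R s) (\<lambda>s1 s2.
        sweedler R R (braiding K (yd_of R) (yd_of R) (tens R R r2 s1))
          (\<lambda>s1' r2'. tens R R (r1 \<cdot>\<^bsub>R\<^esub> s1') (r2' \<cdot>\<^bsub>R\<^esub> s2))))"
  by (rule R[unfolded braided_hopf_def, THEN conjunct2, THEN conjunct2, THEN conjunct2, THEN conjunct2,
        THEN conjunct2, THEN conjunct2, THEN conjunct2, THEN conjunct1, rule_format, OF assms])

lemma comul_R_unity: "comul R (unity R) = tens R R (unity R) (unity R)"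
  and counity_R_unity: "counity R (unity R) = 1"
  using R by (simp_all only: braided_hopf_def)

interpretation Ra: algebra_on_carrier R
  by standard (rule algebra_R)

lemma act_R_linear: "f \<in> carrier K \<Longrightarrow> linear_map R R (bact R f)"
  using bilinear_mapD(1)[OF yd_bilinear_act[OF yd_R]] by simp

lemma act_R_linear': "r \<in> carrier R \<Longrightarrow> linear_map K R (\<lambda>f. bact R f r)"
  using bilinear_mapD(2)[OF yd_bilinear_act[OF yd_R]] by simp

lemma act_R_closed: "f \<in> carrier K \<Longrightarrow> r \<in> carrier R \<Longrightarrow> bact R f r \<in> carrier R"
  using act_closed[OF yd_R] by simp

lemma linear_bcoact: "linear_map R (tensor_space K R) (bcoact R)"
  using yd_linear_coact[OF yd_R] by simp

lemma linear_comul_R: "linear_map R (tensor_space R R) (comul R)"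
  and linear_counity_R: "linear_map R ground (counity R)"
  using coalgebra_R by (simp_all add: is_coalgebra_def)

lemma act_one_R: "r \<in> carrier R \<Longrightarrow> bact R (e \<one>) r = r"
  using yd_act_unity[OF yd_R, of r] by (simp add: unity_K)

lemma act_R_unity: assumes a: "a \<in> carrier G" shows "bact R (e a) (unity R) = unity R"
proof -
  have "scale R (e a \<triangleright>\<^bsub>yd_unit K\<^esub> 1) (unity R) = e a \<triangleright>\<^bsub>yd_of R\<^esub> scale R 1 (unity R)"
    using unity_morphism[unfolded yd_morphism_def, THEN conjunct2, THEN conjunct1, THEN bspec, OF e_closed[OF a], THEN bspec, of 1]
    by (simp add: yd_unit_def)
  then show ?thesis by (simp add: yd_unit_def)
qed

lemma coact_R_unity: "bcoact R (unity R) = tens K R (e \<one>) (unity R)"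
proof -
  have lin: "linear_map ground R (\<lambda>c. scale R c (unity R))"
    by (rule linear_map_scalar_mult[OF Ra.vs linear_map_id]) simp
  have "coact (yd_of R) (scale R 1 (unity R)) =
    sweedler K (yd_unit K) (coact (yd_unit K) 1) (\<lambda>h m0. tens K (yd_of R) h (scale R m0 (unity R)))"
    using unity_morphism[unfolded yd_morphism_def, THEN conjunct2, THEN conjunct2, THEN bspec, of 1]
    by (simp add: yd_unit_def)
  moreover have "sweedler K (yd_unit K) t F = sweedler K ground t F"
    for t and F :: "('g \<Rightarrow>\<^sub>0 'k) \<Rightarrow> 'k \<Rightarrow> ('k, 'g \<Rightarrow>\<^sub>0 'k, 'r) tensor"
    by (rule fun_cong[OF fun_cong[OF sweedler_space_cong]]) (simp_all add: yd_unit_def ground_def)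
  moreover have "coact (yd_unit K) 1 = tens K ground (unity K) 1" by (simp add: yd_unit_def)
  moreover have "sweedler K ground (tens K ground (unity K) 1) (\<lambda>h m0. tens K R h (scale R m0 (unity R))) =
      tens K R (unity K) (scale R 1 (unity R))"
    by (rule sweedler_tens[OF bilinear_map_comp[OF bilinear_map_tens linear_map_id lin] is_vspace_tensor_space])
      (simp_all add: ground_def)
  ultimately show ?thesis by (simp add: unity_K)
qed

lemma act_R_mult:
  assumes a: "a \<in> carrier G" and r: "r \<in> carrier R" and s: "s \<in> carrier R"
  shows "bact R (e a) (r \<cdot>\<^bsub>R\<^esub> s) = bact R (e a) r \<cdot>\<^bsub>R\<^esub> bact R (e a) s"
proof -
  let ?t = "tens R R r s" and ?m = "\<lambda>t. sweedler R R t (mul R)"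
  have t: "?t \<in> carrier (tensor_space R R)" by (rule tens_in_tensor_space[OF r s])
  let ?F = "\<lambda>h1 h2. sweedler R R ?t (\<lambda>m n. tens R R (bact R h1 m) (bact R h2 n))"
  have b: "bilinear_map K K (tensor_space R R) ?F"
  proof (rule bilinear_mapI)
    fix h assume h: "h \<in> carrier K"
    show "linear_map K (tensor_space R R) (?F h)"
      by (rule linear_map_sweedler_param[OF linear_map_comp[OF act_R_linear' linear_map_tens_right] Ra.vs is_vspace_tensor_space t])
        (use h act_R_closed in auto)
    show "linear_map K (tensor_space R R) (\<lambda>h1. ?F h1 h)"
      by (rule linear_map_sweedler_param[OF linear_map_comp[OF act_R_linear' linear_map_tens_left] Ra.vs is_vspace_tensor_space t])
        (use h act_R_closed in auto)
  qed
  have b2: "bilinear_map R R (tensor_space R R) (\<lambda>m n. tens R R (bact R h m) (bact R h n))" if "h \<in> carrier K" for h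
    by (rule bilinear_map_comp[OF bilinear_map_tens act_R_linear[OF that] act_R_linear[OF that]])
  have act_t: "e a \<triangleright>\<^bsub>yd_tensor K (yd_of R) (yd_of R)\<^esub> ?t = tens R R (bact R (e a) r) (bact R (e a) s)"
  proof -
    have "e a \<triangleright>\<^bsub>yd_tensor K (yd_of R) (yd_of R)\<^esub> ?t = sweedler K K (comul K (e a)) ?F"
      by (simp add: yd_tensor_def)
    also have "\<dots> = ?F (e a) (e a)" by (rule sweedler_comul_e[OF b is_vspace_tensor_space a])
    also have "\<dots> = tens R R (bact R (e a) r) (bact R (e a) s)"
      by (rule sweedler_tens[OF b2 is_vspace_tensor_space r s]) (simp add: a)
    finally show ?thesis .
  qed
  have "?m (e a \<triangleright>\<^bsub>yd_tensor K (yd_of R) (yd_of R)\<^esub> ?t) = e a \<triangleright>\<^bsub>yd_of R\<^esub> ?m ?t"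
    using mul_morphism[unfolded yd_morphism_def, THEN conjunct2, THEN conjunct1, THEN bspec, THEN bspec, OF e_closed[OF a], of ?t] t
    by (simp add: yd_tensor_def)
  then show ?thesis
    unfolding act_t using a r s act_R_closed
    by (simp add: sweedler_tens[OF Ra.bilinear_mul Ra.vs])
qed

lemma braiding_R_linear: "linear_map (tensor_space R R) (tensor_space R R) (braiding K (yd_of R) (yd_of R))"
  using linear_map_sweedler[OF bilinear_braiding[OF yd_R yd_R] yd_vs[OF yd_R] is_vspace_tensor_space]
  unfolding braiding_def[abs_def] by simp

text \<open>In a braided Hopf algebra, multiplication by a primitive element \<open>w\<close> of degree \<open>h\<close> acts on
  coproducts as \<open>w \<otimes> 1 + h \<otimes> w\<close>, where \<open>h\<close> acts on the first factor.\<close>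

lemma comul_R_primitive_mult:
  assumes w: "w \<in> primitives R" and h: "h \<in> carrier G" and co: "bcoact R w = tens K R (e h) w"
    and s: "s \<in> carrier R"
  shows "comul R (w \<cdot>\<^bsub>R\<^esub> s) =
    sweedler R R (comul R s) (\<lambda>s1 s2. tens R R (w \<cdot>\<^bsub>R\<^esub> s1) s2 + tens R R (bact R (e h) s1) (w \<cdot>\<^bsub>R\<^esub> s2))"
proof -
  let ?br = "braiding K (yd_of R) (yd_of R)" and ?u = "unity R"
  let ?T = "tensor_space R R"
  have T: "is_vspace ?T" by (rule is_vspace_tensor_space)
  have wR: "w \<in> carrier R" and comul_w: "comul R w = tens R R w ?u + tens R R ?u w"
    using w by (auto simp: primitives_def)
  have t: "comul R s \<in> carrier ?T" by (rule linear_mapD(1)[OF linear_comul_R s])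
  have brc: "?br (tens R R r2 s1) \<in> carrier ?T" if "r2 \<in> carrier R" "s1 \<in> carrier R" for r2 s1
    by (rule linear_mapD(1)[OF braiding_R_linear tens_in_tensor_space[OF that]])
  let ?g = "\<lambda>r1 s2 s1' r2'. tens R R (r1 \<cdot>\<^bsub>R\<^esub> s1') (r2' \<cdot>\<^bsub>R\<^esub> s2)"
  have bg: "bilinear_map R R ?T (?g r1 s2)" if "r1 \<in> carrier R" "s2 \<in> carrier R" for r1 s2
    by (rule bilinear_map_comp[OF bilinear_map_tens Ra.linear_mul_right[OF that(1)] Ra.linear_mul_left[OF that(2)]])
  let ?G = "\<lambda>r1 r2. sweedler R R (comul R s) (\<lambda>s1 s2. sweedler R R (?br (tens R R r2 s1)) (?g r1 s2))"
  have bG: "bilinear_map R R ?T ?G"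
  proof (rule bilinear_mapI)
    fix r1 assume r1: "r1 \<in> carrier R"
    show "linear_map R ?T (?G r1)"
    proof (rule linear_map_sweedler_param[OF _ Ra.vs T t])
      fix s1 s2 assume "s1 \<in> carrier R" "s2 \<in> carrier R"
      then show "linear_map R ?T (\<lambda>r2. sweedler R R (?br (tens R R r2 s1)) (?g r1 s2))"
        by (intro linear_map_sweedler_arg[OF linear_map_comp[OF linear_map_tens_left braiding_R_linear] bg Ra.vs T] r1)
    qed
  next
    fix r2 assume r2: "r2 \<in> carrier R"
    show "linear_map R ?T (\<lambda>r1. ?G r1 r2)"
    proof (rule linear_map_sweedler_param[OF linear_map_sweedler_param[OF _ Ra.vs T brc] Ra.vs T t])
      fix s1 s2 s1' r2' assume cl: "s1 \<in> carrier R" "s2 \<in> carrier R" "s1' \<in> carrier R" "r2' \<in> carrier R"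
      show "linear_map R ?T (\<lambda>r1. ?g r1 s2 s1' r2')"
        by (rule linear_map_comp[OF Ra.linear_mul_left[OF cl(3)] linear_map_tens_left]) (use cl in simp)
    qed (use r2 in auto)
  qed
  have "comul R (w \<cdot>\<^bsub>R\<^esub> s) = sweedler R R (tens R R w ?u + tens R R ?u w) ?G"
    unfolding comul_R_mult[OF wR s] comul_w ..
  also have "\<dots> = ?G w ?u + ?G ?u w"
    by (subst sweedler_add[OF bG Ra.vs T]) (use wR in \<open>simp_all add: tens_in_tensor_space sweedler_tens[OF bG T]\<close>)
  also have "?G w ?u = sweedler R R (comul R s) (\<lambda>s1 s2. tens R R (w \<cdot>\<^bsub>R\<^esub> s1) s2)"
  proof (rule sweedler_cong[OF Ra.vs t])
    fix s1 s2 assume cl: "s1 \<in> carrier R" "s2 \<in> carrier R"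
    have "?br (tens R R ?u s1) = tens R R s1 ?u"
      using braiding_homogeneous[OF yd_R yd_R, of ?u s1 \<one>] cl coact_R_unity act_one_R by simp
    then show "sweedler R R (?br (tens R R ?u s1)) (?g w s2) = tens R R (w \<cdot>\<^bsub>R\<^esub> s1) s2"
      using sweedler_tens[OF bg[OF wR cl(2)] T cl(1), of ?u] cl by simp
  qed
  also have "?G ?u w = sweedler R R (comul R s) (\<lambda>s1 s2. tens R R (bact R (e h) s1) (w \<cdot>\<^bsub>R\<^esub> s2))"
  proof (rule sweedler_cong[OF Ra.vs t])
    fix s1 s2 assume cl: "s1 \<in> carrier R" "s2 \<in> carrier R"
    have hs: "bact R (e h) s1 \<in> carrier R" using act_R_closed h cl by simp
    have "?br (tens R R w s1) = tens R R (bact R (e h) s1) w"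
      using braiding_homogeneous[OF yd_R yd_R, of w s1 h] cl wR co h by simp
    then show "sweedler R R (?br (tens R R w s1)) (?g ?u s2) = tens R R (bact R (e h) s1) (w \<cdot>\<^bsub>R\<^esub> s2)"
      using sweedler_tens[OF bg[of ?u s2] T hs wR] cl hs by simp
  qed
  finally show ?thesis by (simp only: sweedler_add_fun)
qed

end

text \<open>The isomorphism of \<open>V\<close> with the component of degree one carries the eigenbasis of \<open>V\<close> into the Nichols
  algebra. A subalgebra that contains the images contains that component, hence everything.\<close>

lemma nichols_quantum_plane:
  fixes V :: "('k, 'g \<Rightarrow>\<^sub>0 'k, 'v::ab_group_add) yd"
    and R :: "('k, 'g \<Rightarrow>\<^sub>0 'k, 'r::ab_group_add) braided_bialg" and w :: "2 \<Rightarrow> 'v"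
  assumes nichols: "nichols_algebra K V R" and V: "yd_module K V"
    and w: "inj w" "\<not> module.dependent (scale V) (range w)" "module.span (scale V) (range w) = carrier V"
    and g: "g \<in> carrier G" and co: "\<And>i. coact V (w i) = tens K V (e (g [^] (d i::nat))) (w i)"
    and act: "\<And>i. e g \<triangleright>\<^bsub>V\<^esub> w i = scale V (z i) (w i)"
  obtains gr x where "braided_hopf K R"
    "quantum_plane R gr x (\<lambda>j. bact R (e (g [^] d j))) (\<lambda>i j. z j ^ d i)"
    "\<And>i. bcoact R (x i) = tens K R (e (g [^] d i)) (x i)"
    "\<And>i. bact R (e g) (x i) = scale R (z i) (x i)"
    "\<And>Y. subalgebra R Y \<Longrightarrow> range x \<subseteq> Y \<Longrightarrow> carrier R \<subseteq> Y"
proof -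
  let ?h = "\<lambda>i. g [^] d i"
  have h: "?h i \<in> carrier G" for i using g by simp
  obtain gr \<iota> where gr: "graded_braided_hopf K R gr" "gr 0 = module.span (scale R) {unity R}" "gr 1 = primitives R"
    and \<iota>: "yd_morphism K V (yd_of R) \<iota>" "bij_betw \<iota> (carrier V) (gr 1)"
    and gen: "generated_as_algebra R (gr 1)"
    using nichols unfolding nichols_algebra_def by blast
  note gbh = gr(1)[unfolded graded_braided_hopf_def]
  have R: "braided_hopf K R" and ds: "direct_sum_decomposition R gr"
    using gbh by (simp_all only:)
  have gr_mult: "\<forall>m n. \<forall>r\<in>gr m. \<forall>s\<in>gr n. r \<cdot>\<^bsub>R\<^esub> s \<in> gr (m + n)"
    using gbh by (elim conjE) assumption
  have counity_gr: "\<forall>n>0. \<forall>r\<in>gr n. counity R r = 0"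
    using gbh by (elim conjE) assumption
  interpret Ra: algebra_on_carrier R by standard (rule algebra_R[OF R])
  note vs = yd_vs[OF V]
  interpret VV: vector_space "scale V" using vs by (simp add: is_vspace_def)
  obtain \<phi> where \<phi>: "\<And>k. linear_map V ground (\<phi> k)" "\<And>j k. \<phi> k (w j) = (if j = k then 1 else (0::'k))"
    "\<And>m. m \<in> carrier V \<Longrightarrow> m = (\<Sum>k\<in>UNIV. scale V (\<phi> k m) (w k))"
    by (rule basis_coordinates[OF vs w]) blast
  have wV: "w i \<in> carrier V" for i using w(3) VV.span_base[of "w i" "range w"] by auto
  have lin: "linear_map V R \<iota>" using \<iota>(1) by (simp add: yd_morphism_def)
  define x where "x = (\<lambda>i. \<iota> (w i))"
  have x_gr: "x i \<in> gr 1" for i using \<iota>(2) wV by (auto simp: x_def bij_betw_def)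
  have \<iota>_inj: "inj_on \<iota> (carrier V)" using \<iota>(2) by (simp add: bij_betw_def)
  have x_inj: "inj x" using w(1) \<iota>_inj wV by (auto simp: inj_def x_def inj_on_def)
  have x_comb: "(\<Sum>k\<in>UNIV. scale R (f k) (x k)) = \<iota> (\<Sum>k\<in>UNIV. scale V (f k) (w k))" for f
    unfolding x_def linear_mapD(3)[OF lin wV, symmetric]
    by (rule linear_map_sum[OF vs lin, symmetric]) (rule is_vspace_scale[OF vs wV])
  have x_indep: "Ra.VS.independent (range x)"
  proof (rule Ra.VS.independent_if_scalars_zero)
    fix f y assume s: "(\<Sum>x\<in>range x. scale R (f x) x) = 0" and y: "y \<in> range x"
    let ?m = "\<Sum>k\<in>UNIV. scale V (f (x k)) (w k)"
    have mV: "?m \<in> carrier V" by (intro is_vspace_sum[OF vs] is_vspace_scale[OF vs] wV)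
    have "\<iota> ?m = 0" using s x_inj by (simp add: sum.reindex x_comb[symmetric])
    then have m0: "?m = 0"
      using inj_onD[OF \<iota>_inj _ mV is_vspace_zero[OF vs]] linear_map_zero[OF vs lin] by simp
    obtain j where j: "y = x j" using y by blast
    have "0 = \<phi> j ?m" using m0 linear_map_zero[OF vs \<phi>(1)] by simp
    also have "\<dots> = (\<Sum>k\<in>UNIV. \<phi> j (scale V (f (x k)) (w k)))"
      by (rule linear_map_sum[OF vs \<phi>(1)]) (rule is_vspace_scale[OF vs wV])
    also have "\<dots> = (\<Sum>k\<in>UNIV. if k = j then f (x j) else 0)"
      using linear_mapD(3)[OF \<phi>(1) wV] by (intro sum.cong refl) (auto simp: \<phi>(2) ground_def)
    finally show "f y = 0" by (simp add: j)
  qed simp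
  have coR: "bcoact R (x i) = tens K R (e (?h i)) (x i)" for i
  proof -
    have "coact (yd_of R) (\<iota> (w i)) = sweedler K V (coact V (w i)) (\<lambda>h m0. tens K (yd_of R) h (\<iota> m0))"
      using \<iota>(1) wV unfolding yd_morphism_def by blast
    also have "\<dots> = tens K R (e (?h i)) (\<iota> (w i))"
      unfolding co yd_of_tensors
      by (rule sweedler_tens[OF bilinear_map_comp[OF bilinear_map_tens linear_map_id lin] is_vspace_tensor_space e_closed[OF h] wV])
    finally show ?thesis by (simp add: x_def)
  qed
  have actR: "bact R (e g) (x i) = scale R (z i) (x i)" for i
  proof -
    have "\<iota> (e g \<triangleright>\<^bsub>V\<^esub> w i) = e g \<triangleright>\<^bsub>yd_of R\<^esub> \<iota> (w i)"
      using \<iota>(1) wV e_closed[OF g] unfolding yd_morphism_def by blast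
    then show ?thesis using act linear_mapD(3)[OF lin wV] by (simp add: x_def)
  qed
  have gens: "carrier R \<subseteq> Y" if Y: "subalgebra R Y" and xY: "range x \<subseteq> Y" for Y
  proof -
    have subY: "is_vspace \<lparr>carrier = Y, scale = scale R\<rparr>"
      using Y Ra.vs by (simp add: subalgebra_def is_vspace_def)
    have "gr 1 \<subseteq> Y"
    proof
      fix r assume "r \<in> gr 1"
      then obtain v where v: "v \<in> carrier V" "r = \<iota> v" using \<iota>(2) by (auto simp: bij_betw_def)
      have "\<iota> v = (\<Sum>k\<in>UNIV. scale R (\<phi> k v) (x k))"
        unfolding x_comb by (rule arg_cong[OF \<phi>(3)[OF v(1)]])
      moreover have "(\<Sum>k\<in>UNIV. scale R (\<phi> k v) (x k)) \<in> Y"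
        using is_vspace_sum[OF subY, of UNIV "\<lambda>k. scale R (\<phi> k v) (x k)"] is_vspace_scale[OF subY]
          subsetD[OF xY rangeI] by simp
      ultimately show "r \<in> Y" by (simp add: v(2))
    qed
    then show ?thesis using gen Y unfolding generated_as_algebra_def by blast
  qed
  have "quantum_plane R gr x (\<lambda>j. bact R (e (?h j))) (\<lambda>i j. z j ^ d i)"
  proof unfold_locales
    show "linear_map R (tensor_space R R) (comul R)" by (rule linear_comul_R[OF R])
    show "linear_map R ground (counity R)" by (rule linear_counity_R[OF R])
    show "sweedler R R (comul R r) (\<lambda>a b. scale R (counity R b) a) = r" if "r \<in> carrier R" for r
      using coalgebra_R[OF R] that unfolding is_coalgebra_def by (elim conjE) (rule bspec)
    show "counity R (unity R) = 1" by (rule counity_R_unity[OF R])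
    show "comul R (unity R) = tens R R (unity R) (unity R)" by (rule comul_R_unity[OF R])
    show "direct_sum_decomposition R gr" by (rule ds)
    show "gr 0 = module.span (scale R) {unity R}" by (rule gr(2))
    show "gr 1 = primitives R" by (rule gr(3))
    show "r \<cdot>\<^bsub>R\<^esub> s \<in> gr (m + n)" if "r \<in> gr m" "s \<in> gr n" for m n r s
      using gr_mult that by blast
    show "counity R r = 0" if "n > 0" "r \<in> gr n" for n r using counity_gr that by blast
    show "x j \<in> gr 1" for j by (rule x_gr)
    show "inj x" by (rule x_inj)
    show "Ra.VS.independent (range x)" by (rule x_indep)
    show "linear_map R R (bact R (e (?h j)))" for j by (rule act_R_linear[OF R e_closed[OF h]])
    show "bact R (e (?h j)) (r \<cdot>\<^bsub>R\<^esub> s) = bact R (e (?h j)) r \<cdot>\<^bsub>R\<^esub> bact R (e (?h j)) s"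
      if "r \<in> carrier R" "s \<in> carrier R" for j r s by (rule act_R_mult[OF R h that])
    show "bact R (e (?h j)) (unity R) = unity R" for j by (rule act_R_unity[OF R h])
    show "bact R (e (?h j)) (x k) = scale R (z k ^ d j) (x k)" for j k
      using act_pow[OF yd_R[OF R], of "x k" g "z k" "d j"] actR g gr_carrier[OF Ra.vs ds x_gr] by simp
    show "comul R (x j \<cdot>\<^bsub>R\<^esub> s) = sweedler R R (comul R s)
        (\<lambda>s1 s2. tens R R (x j \<cdot>\<^bsub>R\<^esub> s1) s2 + tens R R (bact R (e (?h j)) s1) (x j \<cdot>\<^bsub>R\<^esub> s2))"
      if "s \<in> carrier R" for j s
      by (rule comul_R_primitive_mult[OF R _ h coR that]) (use x_gr gr(3) in blast)
  qed
  from that[OF R this coR actR gens] show ?thesis .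
qed

end

section \<open>Antipodes of group-like and skew-primitive elements\<close>

context
  fixes H :: "('k::field, 'a::ab_group_add) bialg"
  assumes H: "is_hopf H"
begin

interpretation Ha: algebra_on_carrier H
  by standard (use H in \<open>simp add: is_hopf_def is_bialgebra_def\<close>)

lemma antipode_H: "is_antipode H (antipode H)"
  using H someI_ex[of "is_antipode H"] by (auto simp: is_hopf_def antipode_def)

lemma antipode_linear: "linear_map H H (antipode H)"
  using antipode_H by (simp add: is_antipode_def)

lemma antipode_H_closed: "h \<in> carrier H \<Longrightarrow> antipode H h \<in> carrier H"
  by (rule linear_mapD(1)[OF antipode_linear])

lemma antipode_axioms:
  assumes "h \<in> carrier H"
  shows "sweedler H H (comul H h) (\<lambda>a b. antipode H a \<cdot>\<^bsub>H\<^esub> b) = scale H (counity H h) (unity H)"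
    "sweedler H H (comul H h) (\<lambda>a b. a \<cdot>\<^bsub>H\<^esub> antipode H b) = scale H (counity H h) (unity H)"
  using antipode_H[unfolded is_antipode_def, THEN conjunct2, THEN bspec, OF assms] by (simp_all only:)

lemma bilinear_antipode:
  "bilinear_map H H H (\<lambda>a b. antipode H a \<cdot>\<^bsub>H\<^esub> b)" "bilinear_map H H H (\<lambda>a b. a \<cdot>\<^bsub>H\<^esub> antipode H b)"
  by (rule bilinear_map_comp[OF Ha.bilinear_mul antipode_linear linear_map_id],
      rule bilinear_map_comp[OF Ha.bilinear_mul linear_map_id antipode_linear])

lemma antipode_grouplike:
  assumes g: "g \<in> carrier H" "comul H g = tens H H g g" "counity H g = 1"
  shows "antipode H g \<cdot>\<^bsub>H\<^esub> g = unity H" "g \<cdot>\<^bsub>H\<^esub> antipode H g = unity H"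
    "antipode H g = inv\<^bsub>mult_monoid H\<^esub> g"
proof -
  show 1: "antipode H g \<cdot>\<^bsub>H\<^esub> g = unity H" and 2: "g \<cdot>\<^bsub>H\<^esub> antipode H g = unity H"
    using antipode_axioms[OF g(1)] unfolding g(2,3)
    by (simp_all add: sweedler_tens[OF bilinear_antipode(1) Ha.vs g(1) g(1)]
        sweedler_tens[OF bilinear_antipode(2) Ha.vs g(1) g(1)])
  show "antipode H g = inv\<^bsub>mult_monoid H\<^esub> g"
    by (rule Ha.M.inv_unique') (simp_all add: 1 2 g(1) antipode_H_closed)
qed

text \<open>The antipode axiom reads \<open>x + S(x) h = 0\<close>; multiply by \<open>S(h) = h\<^sup>-\<^sup>1\<close> from the right.\<close>

lemma antipode_skew_primitive:
  assumes x: "x \<in> carrier H" "comul H x = tens H H (unity H) x + tens H H x h" "counity H x = 0"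
    and h: "h \<in> carrier H" "comul H h = tens H H h h" "counity H h = 1"
  shows "antipode H x = - (x \<cdot>\<^bsub>H\<^esub> inv\<^bsub>mult_monoid H\<^esub> h)"
proof -
  let ?S = "antipode H" and ?u = "unity H"
  have Sc: "?S x \<in> carrier H" "?S h \<in> carrier H" by (simp_all add: antipode_H_closed x(1) h(1))
  have "counity H ?u = 1" "comul H ?u = tens H H ?u ?u"
    using H by (simp_all add: is_hopf_def is_bialgebra_def)
  then have Su: "?S ?u = ?u"
    using antipode_grouplike(2)[of ?u] antipode_H_closed[of ?u] by simp
  have "0 = sweedler H H (tens H H ?u x + tens H H x h) (\<lambda>a b. ?S a \<cdot>\<^bsub>H\<^esub> b)"
    using antipode_axioms(1)[OF x(1)] unfolding x(2,3) by simp
  also have "\<dots> = x + ?S x \<cdot>\<^bsub>H\<^esub> h"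
    by (subst sweedler_add[OF bilinear_antipode(1) Ha.vs Ha.vs])
      (use x(1) h(1) in \<open>simp_all add: tens_in_tensor_space sweedler_tens[OF bilinear_antipode(1) Ha.vs] Su\<close>)
  finally have "?S x \<cdot>\<^bsub>H\<^esub> h = - x" by (simp add: eq_neg_iff_add_eq_0 add.commute)
  then have "?S x \<cdot>\<^bsub>H\<^esub> h \<cdot>\<^bsub>H\<^esub> ?S h = (- x) \<cdot>\<^bsub>H\<^esub> ?S h" by simp
  moreover have "?S x \<cdot>\<^bsub>H\<^esub> h \<cdot>\<^bsub>H\<^esub> ?S h = ?S x"
    using Ha.assoc[OF Sc(1) h(1) Sc(2)] antipode_grouplike(2)[OF h] Sc by simp
  moreover have "(- x) \<cdot>\<^bsub>H\<^esub> ?S h = - (x \<cdot>\<^bsub>H\<^esub> ?S h)"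
    using Ha.mult_scale(1)[OF x(1) Sc(2), of "- 1"] by simp
  ultimately show ?thesis using antipode_grouplike(3)[OF h] by simp
qed

end

section \<open>The bosonisation\<close>

context group_algebra_hopf
begin

context
  fixes R :: "('k, 'g \<Rightarrow>\<^sub>0 'k, 'r::ab_group_add) braided_bialg"
  assumes R: "braided_hopf K R"
begin

interpretation Ra: algebra_on_carrier R
  by standard (rule algebra_R[OF R])

abbreviation T :: "('k, ('k, 'r, 'g \<Rightarrow>\<^sub>0 'k) tensor) vspace"
  where "T \<equiv> tensor_space R K"

abbreviation smash :: "'r \<Rightarrow> 'g \<Rightarrow> ('k, 'r, 'g \<Rightarrow>\<^sub>0 'k) tensor" (infix \<open>\<sharp>\<close> 75)
  where "r \<sharp> a \<equiv> tens R K r (e a)"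

lemma T_vs: "is_vspace T"
  by (rule is_vspace_tensor_space)

lemma bosonisation_simps:
  "carrier (bosonisation K R) = carrier T" "scale (bosonisation K R) = tscale"
  "unity (bosonisation K R) = unity R \<sharp> \<one>"
  by (simp_all add: bosonisation_def Let_def unity_K)

lemma smash_closed: "r \<in> carrier R \<Longrightarrow> a \<in> carrier G \<Longrightarrow> r \<sharp> a \<in> carrier T"
  by (intro tens_in_tensor_space) auto

text \<open>As \<open>\<Delta> a = a \<otimes> a\<close>, the factor \<open>a\<close> both acts on \<open>s\<close> and multiplies \<open>b\<close>. The bulk of the proof is the bilinearity of the nested
  sums in the definition, which is what permits evaluating them at pure tensors.\<close>

lemma bosonisation_mul:
  assumes r: "r \<in> carrier R" and a: "a \<in> carrier G" and s: "s \<in> carrier R" and b: "b \<in> carrier G"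
  shows "mul (bosonisation K R) (r \<sharp> a) (s \<sharp> b) = (r \<cdot>\<^bsub>R\<^esub> bact R (e a) s) \<sharp> (a \<otimes> b)"
proof -
  let ?f = "\<lambda>r s h g1 g2. tens R K (r \<cdot>\<^bsub>R\<^esub> bact R g1 s) (g2 \<cdot>\<^bsub>K\<^esub> h)"
  let ?C = "\<lambda>r g s h. sweedler K K (comul K g) (?f r s h)"
  let ?D = "\<lambda>r g. sweedler R K (s \<sharp> b) (?C r g)"
  have cg: "comul K g \<in> carrier (tensor_space K K)" if "g \<in> carrier K" for g
    by (rule linear_mapD(1)[OF linear_comul_K that])
  have act_cl: "bact R g m \<in> carrier R" if "g \<in> carrier K" "m \<in> carrier R" for g m
    by (rule act_R_closed[OF R that])
  have bf: "bilinear_map K K T (?f r s h)" if "r \<in> carrier R" "s \<in> carrier R" "h \<in> carrier K" for r s h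
    by (rule bilinear_map_comp[OF bilinear_map_tens
        linear_map_comp[OF act_R_linear'[OF R that(2)] Ra.linear_mul_right[OF that(1)]] K.linear_mul_left[OF that(3)]])
  have bC: "bilinear_map R K T (?C r g)" if r: "r \<in> carrier R" and g: "g \<in> carrier K" for r g
  proof (rule bilinear_mapI)
    fix m assume m: "m \<in> carrier R"
    show "linear_map K T (?C r g m)"
    proof (rule linear_map_sweedler_param[OF _ K.vs T_vs cg[OF g]])
      fix g1 g2 assume cl: "g1 \<in> carrier K" "g2 \<in> carrier K"
      show "linear_map K T (\<lambda>h. ?f r m h g1 g2)"
        by (rule linear_map_comp[OF K.linear_mul_right[OF cl(2)] linear_map_tens_right])
          (use r m cl act_cl in simp)
    qed
  next
    fix h assume h: "h \<in> carrier K"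
    show "linear_map R T (\<lambda>s. ?C r g s h)"
    proof (rule linear_map_sweedler_param[OF _ K.vs T_vs cg[OF g]])
      fix g1 g2 assume cl: "g1 \<in> carrier K" "g2 \<in> carrier K"
      show "linear_map R T (\<lambda>s. ?f r s h g1 g2)"
        by (rule linear_map_comp[OF linear_map_comp[OF act_R_linear[OF R cl(1)] Ra.linear_mul_right[OF r]] linear_map_tens_left])
          (use h cl in simp)
    qed
  qed
  have sb: "s \<sharp> b \<in> carrier T" by (rule smash_closed[OF s b])
  have bD: "bilinear_map R K T ?D"
  proof (rule bilinear_mapI)
    fix r assume r: "r \<in> carrier R"
    show "linear_map K T (?D r)"
      by (rule linear_map_sweedler_param[OF linear_map_sweedler_arg[OF linear_comul_K bf K.vs T_vs] Ra.vs T_vs sb])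
        (use r in auto)
  next
    fix g assume g: "g \<in> carrier K"
    show "linear_map R T (\<lambda>r. ?D r g)"
    proof (rule linear_map_sweedler_param[OF linear_map_sweedler_param[OF _ K.vs T_vs cg[OF g]] Ra.vs T_vs sb])
      fix m h g1 g2 assume cl: "m \<in> carrier R" "h \<in> carrier K" "g1 \<in> carrier K" "g2 \<in> carrier K"
      show "linear_map R T (\<lambda>r. ?f r m h g1 g2)"
        by (rule linear_map_comp[OF Ra.linear_mul_left[OF act_cl[OF cl(3,1)]] linear_map_tens_left])
          (use cl in simp)
    qed
  qed
  have "mul (bosonisation K R) (r \<sharp> a) (s \<sharp> b) = sweedler R K (r \<sharp> a) ?D"
    by (simp add: bosonisation_def Let_def)
  also have "\<dots> = ?D r (e a)" by (rule sweedler_tens[OF bD T_vs r e_closed[OF a]])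
  also have "\<dots> = ?C r (e a) s (e b)" by (rule sweedler_tens[OF bC[OF r e_closed[OF a]] T_vs s e_closed[OF b]])
  also have "\<dots> = ?f r s (e b) (e a) (e a)" by (rule sweedler_comul_e[OF bf[OF r s e_closed[OF b]] T_vs a])
  finally show ?thesis by (simp add: mult_e)
qed

text \<open>The two bilinearity statements allow the remaining sums to be evaluated once \<open>\<Delta> r\<close> and the
  coaction are known.\<close>

lemma bosonisation_comul:
  assumes r: "r \<in> carrier R" and a: "a \<in> carrier G"
  shows "comul (bosonisation K R) (r \<sharp> a) =
    sweedler R R (comul R r) (\<lambda>r1 r2. sweedler K R (bcoact R r2) (\<lambda>b r20.
      tens T T (tens R K r1 (b \<cdot>\<^bsub>K\<^esub> e a)) (r20 \<sharp> a)))"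
    and "bilinear_map R R (tensor_space T T) (\<lambda>r1 r2. sweedler K R (bcoact R r2) (\<lambda>b r20.
      tens T T (tens R K r1 (b \<cdot>\<^bsub>K\<^esub> e a)) (r20 \<sharp> a)))"
    and "\<And>r1. r1 \<in> carrier R \<Longrightarrow> bilinear_map K R (tensor_space T T)
      (\<lambda>b r20. tens T T (tens R K r1 (b \<cdot>\<^bsub>K\<^esub> e a)) (r20 \<sharp> a))"
proof -
  let ?TT = "tensor_space T T"
  have TT: "is_vspace ?TT" by (rule is_vspace_tensor_space)
  let ?f = "\<lambda>r1 b r20 g1 g2. tens T T (tens R K r1 (b \<cdot>\<^bsub>K\<^esub> g1)) (tens R K r20 g2)"
  let ?C = "\<lambda>r1 g b r20. sweedler K K (comul K g) (?f r1 b r20)"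
  let ?D = "\<lambda>g r1 r2. sweedler K R (bcoact R r2) (?C r1 g)"
  let ?E = "\<lambda>r g. sweedler R R (comul R r) (?D g)"
  have cg: "comul K g \<in> carrier (tensor_space K K)" if "g \<in> carrier K" for g
    by (rule linear_mapD(1)[OF linear_comul_K that])
  have cr: "comul R r \<in> carrier (tensor_space R R)" if "r \<in> carrier R" for r
    by (rule linear_mapD(1)[OF linear_comul_R[OF R] that])
  have br: "bcoact R r \<in> carrier (tensor_space K R)" if "r \<in> carrier R" for r
    by (rule linear_mapD(1)[OF linear_bcoact[OF R] that])
  have bf: "bilinear_map K K ?TT (?f r1 b r20)" if "r1 \<in> carrier R" "b \<in> carrier K" "r20 \<in> carrier R" for r1 b r20
    by (rule bilinear_map_comp[OF bilinear_map_tens linear_map_comp[OF K.linear_mul_right[OF that(2)]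
        linear_map_tens_right[OF that(1)]] linear_map_tens_right[OF that(3)]])
  have bf2: "bilinear_map K R ?TT (\<lambda>b r20. ?f r1 b r20 g1 g2)"
    if "r1 \<in> carrier R" "g1 \<in> carrier K" "g2 \<in> carrier K" for r1 g1 g2
    by (rule bilinear_map_comp[OF bilinear_map_tens linear_map_comp[OF K.linear_mul_left[OF that(2)]
        linear_map_tens_right[OF that(1)]] linear_map_tens_left[OF that(3)]])
  have lf: "linear_map R ?TT (\<lambda>r1. ?f r1 b r20 g1 g2)"
    if "b \<in> carrier K" "r20 \<in> carrier R" "g1 \<in> carrier K" "g2 \<in> carrier K" for b r20 g1 g2
    by (rule linear_map_comp[OF linear_map_tens_left linear_map_tens_left])
      (use that in \<open>simp_all add: tens_in_tensor_space\<close>)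
  have bC: "bilinear_map K R ?TT (?C r1 g)" if "r1 \<in> carrier R" "g \<in> carrier K" for r1 g
    by (intro bilinear_mapI linear_map_sweedler_param[OF _ K.vs TT cg[OF that(2)]]
        bilinear_mapD(1)[OF bf2[OF that(1)]] bilinear_mapD(2)[OF bf2[OF that(1)]])
  have bD: "bilinear_map R R ?TT (?D g)" if g: "g \<in> carrier K" for g
  proof (rule bilinear_mapI)
    fix r1 assume r1: "r1 \<in> carrier R"
    show "linear_map R ?TT (?D g r1)"
      by (rule linear_map_sweedler_arg[OF linear_bcoact[OF R] bC[OF r1 g] K.vs TT])
  next
    fix r2 assume r2: "r2 \<in> carrier R"
    show "linear_map R ?TT (\<lambda>r1. ?D g r1 r2)"
      by (rule linear_map_sweedler_param[OF linear_map_sweedler_param[OF lf K.vs TT cg[OF g]] K.vs TT br[OF r2]])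
  qed
  have bE: "bilinear_map R K ?TT ?E"
  proof (rule bilinear_mapI)
    fix r assume r: "r \<in> carrier R"
    show "linear_map K ?TT (?E r)"
      by (rule linear_map_sweedler_param[OF linear_map_sweedler_param[OF
            linear_map_sweedler_arg[OF linear_comul_K bf K.vs TT] K.vs TT br] Ra.vs TT cr[OF r]])
  next
    fix g assume g: "g \<in> carrier K"
    show "linear_map R ?TT (\<lambda>r. ?E r g)"
      by (rule linear_map_sweedler_arg[OF linear_comul_R[OF R] bD[OF g] Ra.vs TT])
  qed
  have C: "?C r1 (e a) b r20 = ?f r1 b r20 (e a) (e a)" if "r1 \<in> carrier R" "b \<in> carrier K" "r20 \<in> carrier R" for r1 b r20
    by (rule sweedler_comul_e[OF bf[OF that] TT a])
  have D: "?D (e a) r1 r2 = sweedler K R (bcoact R r2) (\<lambda>b r20. ?f r1 b r20 (e a) (e a))"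
    if "r1 \<in> carrier R" "r2 \<in> carrier R" for r1 r2
    by (rule sweedler_cong[OF K.vs br[OF that(2)] C[OF that(1)]])
  have "comul (bosonisation K R) (r \<sharp> a) = sweedler R K (r \<sharp> a) ?E"
    by (simp add: bosonisation_def Let_def)
  also have "\<dots> = ?E r (e a)" by (rule sweedler_tens[OF bE TT r e_closed[OF a]])
  also have "\<dots> = sweedler R R (comul R r) (\<lambda>r1 r2. sweedler K R (bcoact R r2) (\<lambda>b r20. ?f r1 b r20 (e a) (e a)))"
    by (rule sweedler_cong[OF Ra.vs cr[OF r] D])
  finally show "comul (bosonisation K R) (r \<sharp> a) =
    sweedler R R (comul R r) (\<lambda>r1 r2. sweedler K R (bcoact R r2) (\<lambda>b r20. ?f r1 b r20 (e a) (e a)))" .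
  show b3: "bilinear_map K R ?TT (\<lambda>b r20. ?f r1 b r20 (e a) (e a))" if "r1 \<in> carrier R" for r1
    by (rule bf2[OF that e_closed[OF a] e_closed[OF a]])
  show "bilinear_map R R ?TT (\<lambda>r1 r2. sweedler K R (bcoact R r2) (\<lambda>b r20. ?f r1 b r20 (e a) (e a)))"
  proof (rule bilinear_mapI)
    fix r1 assume r1: "r1 \<in> carrier R"
    show "linear_map R ?TT (\<lambda>r2. sweedler K R (bcoact R r2) (\<lambda>b r20. ?f r1 b r20 (e a) (e a)))"
      by (rule linear_map_sweedler_arg[OF linear_bcoact[OF R] b3[OF r1] K.vs TT])
  next
    fix r2 assume r2: "r2 \<in> carrier R"
    show "linear_map R ?TT (\<lambda>r1. sweedler K R (bcoact R r2) (\<lambda>b r20. ?f r1 b r20 (e a) (e a)))"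
      by (rule linear_map_sweedler_param[OF lf K.vs TT br[OF r2]]) (use a in auto)
  qed
qed

lemma bosonisation_comul_term:
  assumes r1: "r1 \<in> carrier R" and r2: "r2 \<in> carrier R" and a: "a \<in> carrier G" and h: "h \<in> carrier G"
    and co: "bcoact R r2 = tens K R (e h) r2"
  shows "sweedler K R (bcoact R r2) (\<lambda>b r20. tens T T (tens R K r1 (b \<cdot>\<^bsub>K\<^esub> e a)) (r20 \<sharp> a)) =
    tens T T (r1 \<sharp> (h \<otimes> a)) (r2 \<sharp> a)"
  unfolding co
  by (subst sweedler_tens[OF bosonisation_comul(3)[OF r1 a r1] is_vspace_tensor_space e_closed[OF h] r2])
    (simp add: mult_e)

lemma bosonisation_comul_grouplike:
  assumes a: "a \<in> carrier G"
  shows "comul (bosonisation K R) (unity R \<sharp> a) = tens T T (unity R \<sharp> a) (unity R \<sharp> a)"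
  unfolding bosonisation_comul(1)[OF Ra.closed(2) a] comul_R_unity[OF R]
  by (subst sweedler_tens[OF bosonisation_comul(2)[OF Ra.closed(2) a] is_vspace_tensor_space])
    (use a bosonisation_comul_term[OF _ _ a one_closed coact_R_unity[OF R]] in auto)

lemma bosonisation_comul_primitive:
  assumes w: "w \<in> primitives R" and h: "h \<in> carrier G" and co: "bcoact R w = tens K R (e h) w"
  shows "comul (bosonisation K R) (w \<sharp> \<one>) =
    tens T T (w \<sharp> \<one>) (unity R \<sharp> \<one>) + tens T T (unity R \<sharp> h) (w \<sharp> \<one>)"
proof -
  have wR: "w \<in> carrier R" and comul_w: "comul R w = tens R R w (unity R) + tens R R (unity R) w"
    using w by (auto simp: primitives_def)
  note b = bosonisation_comul(2)[OF wR one_closed]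
  show ?thesis
    unfolding bosonisation_comul(1)[OF wR one_closed] comul_w
    by (subst sweedler_add[OF b Ra.vs is_vspace_tensor_space])
      (use wR h bosonisation_comul_term[OF _ _ one_closed one_closed coact_R_unity[OF R]]
        bosonisation_comul_term[OF _ _ one_closed h co]
       in \<open>auto simp: tens_in_tensor_space sweedler_tens[OF b is_vspace_tensor_space]\<close>)
qed

lemma bosonisation_counity:
  assumes r: "r \<in> carrier R" and a: "a \<in> carrier G"
  shows "counity (bosonisation K R) (r \<sharp> a) = counity R r"
proof -
  have "counity (bosonisation K R) (r \<sharp> a) = sweedler R K (r \<sharp> a) (\<lambda>r g. counity R r * counity K g)"
    by (simp add: bosonisation_def Let_def)
  also have "\<dots> = counity R r * counity K (e a)"
    by (rule sweedler_tens[OF bilinear_map_product[OF linear_counity_R[OF R] linear_counity_K] is_vspace_ground r e_closed[OF a]])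
  finally show ?thesis by simp
qed

text \<open>A generalised Taft algebra \<open>H\<close> is studied through the images \<open>elem r a\<close> of the elements \<open>r \<otimes> a\<close>
  under an isomorphism \<open>\<phi>\<close>.\<close>

context
  fixes H :: "('k, 'a::ab_group_add) bialg" and \<phi>
  assumes hopf_H: "is_hopf H" and iso: "hopf_iso (coopposite (bosonisation K R)) H \<phi>"
begin

interpretation Ha: algebra_on_carrier H
  by standard (use hopf_H in \<open>simp add: is_hopf_def is_bialgebra_def\<close>)

lemma coopposite_simps:
  "carrier (coopposite A) = carrier A" "scale (coopposite A) = scale A" "mul (coopposite A) = mul A"
  "unity (coopposite A) = unity A" "counity (coopposite A) = counity A"
  "comul (coopposite A) h = sweedler A A (comul A h) (\<lambda>a b. tens A A b a)"
  by (simp_all add: coopposite_def)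

lemma \<phi>_linear: "linear_map T H \<phi>"
  using iso by (simp add: hopf_iso_def linear_map_def coopposite_simps bosonisation_simps)

lemma \<phi>_bij: "bij_betw \<phi> (carrier T) (carrier H)"
  using iso by (simp add: hopf_iso_def coopposite_simps bosonisation_simps)

lemma \<phi>_mul:
  assumes "s \<in> carrier T" "t \<in> carrier T"
  shows "\<phi> (mul (bosonisation K R) s t) = \<phi> s \<cdot>\<^bsub>H\<^esub> \<phi> t"
  using iso assms by (simp add: hopf_iso_def coopposite_simps bosonisation_simps)

lemma \<phi>_counity: "t \<in> carrier T \<Longrightarrow> counity H (\<phi> t) = counity (bosonisation K R) t"
  using iso by (simp add: hopf_iso_def coopposite_simps bosonisation_simps)

definition elem :: "'r \<Rightarrow> 'g \<Rightarrow> 'a"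
  where "elem r a = \<phi> (r \<sharp> a)"

lemma elem_closed [simp]: "r \<in> carrier R \<Longrightarrow> a \<in> carrier G \<Longrightarrow> elem r a \<in> carrier H"
  unfolding elem_def by (rule linear_mapD(1)[OF \<phi>_linear smash_closed])

lemma elem_unity: "elem (unity R) \<one> = unity H"
  using iso by (simp add: hopf_iso_def coopposite_simps bosonisation_simps elem_def)

lemma elem_linear: "a \<in> carrier G \<Longrightarrow> linear_map R H (\<lambda>r. elem r a)"
  unfolding elem_def by (rule linear_map_comp[OF linear_map_tens_left[OF e_closed] \<phi>_linear])

lemma elem_mult:
  assumes "r \<in> carrier R" "a \<in> carrier G" "s \<in> carrier R" "b \<in> carrier G"
  shows "elem r a \<cdot>\<^bsub>H\<^esub> elem s b = elem (r \<cdot>\<^bsub>R\<^esub> bact R (e a) s) (a \<otimes> b)"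
  unfolding elem_def \<phi>_mul[OF smash_closed[OF assms(1,2)] smash_closed[OF assms(3,4)], symmetric]
  by (simp only: bosonisation_mul[OF assms])

lemma elem_counity: "r \<in> carrier R \<Longrightarrow> a \<in> carrier G \<Longrightarrow> counity H (elem r a) = counity R r"
  unfolding elem_def using \<phi>_counity[OF smash_closed] bosonisation_counity by simp

text \<open>The map \<open>D\<close> is \<open>\<phi> \<otimes> \<phi>\<close> after the flip, so that coproducts in \<open>H\<close> are obtained from those in the
  bosonisation by exchanging the factors.\<close>

lemma \<phi>_comul:
  obtains D where "linear_map (tensor_space T T) (tensor_space H H) D"
    "\<And>s t. s \<in> carrier T \<Longrightarrow> t \<in> carrier T \<Longrightarrow> D (tens T T s t) = tens H H (\<phi> t) (\<phi> s)"
    "\<And>t. t \<in> carrier T \<Longrightarrow> comul H (\<phi> t) = D (comul (bosonisation K R) t)"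
proof -
  let ?A = "bosonisation K R"
  have eq: "tens ?A ?A = tens T T" "tensor_space ?A ?A = tensor_space T T"
    by (rule tens_cong tensor_space_cong; simp add: bosonisation_simps)+
  have sw: "sweedler ?A ?A t f = sweedler T T t f" "sweedler (coopposite ?A) (coopposite ?A) t f = sweedler T T t f" for t and f :: "_ \<Rightarrow> _ \<Rightarrow> 'c::ab_group_add"
    by (rule fun_cong[OF fun_cong[OF sweedler_space_cong]]; simp add: bosonisation_simps coopposite_simps)+
  have TT: "is_vspace (tensor_space T T)" by (rule is_vspace_tensor_space)
  have flip: "bilinear_map T T (tensor_space T T) (\<lambda>a b. tens T T b a)"
    by (intro bilinear_mapI linear_map_tens_left linear_map_tens_right)
  have b2: "bilinear_map T T (tensor_space H H) (\<lambda>a b. tens H H (\<phi> a) (\<phi> b))"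
    by (rule bilinear_map_comp[OF bilinear_map_tens \<phi>_linear \<phi>_linear])
  define D where "D = (\<lambda>u. sweedler T T (sweedler T T u (\<lambda>a b. tens T T b a)) (\<lambda>a b. tens H H (\<phi> a) (\<phi> b)))"
  show ?thesis
  proof
    show "linear_map (tensor_space T T) (tensor_space H H) D"
      unfolding D_def
      by (rule linear_map_comp[OF linear_map_sweedler[OF flip T_vs TT] linear_map_sweedler[OF b2 T_vs is_vspace_tensor_space]])
    show "D (tens T T s t) = tens H H (\<phi> t) (\<phi> s)" if "s \<in> carrier T" "t \<in> carrier T" for s t
      unfolding D_def sweedler_tens[OF flip TT that] sweedler_tens[OF b2 is_vspace_tensor_space that(2,1)] ..
    show "comul H (\<phi> t) = D (comul ?A t)" if "t \<in> carrier T" for t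
    proof -
      have "comul H (\<phi> t) = sweedler (coopposite ?A) (coopposite ?A) (comul (coopposite ?A) t) (\<lambda>a b. tens H H (\<phi> a) (\<phi> b))"
        using iso that unfolding hopf_iso_def by (simp add: coopposite_simps bosonisation_simps)
      then show ?thesis by (simp only: coopposite_simps sw eq D_def)
    qed
  qed
qed

lemma elem_comul_grouplike:
  assumes a: "a \<in> carrier G"
  shows "comul H (elem (unity R) a) = tens H H (elem (unity R) a) (elem (unity R) a)"
proof -
  obtain D where D: "\<And>s t. s \<in> carrier T \<Longrightarrow> t \<in> carrier T \<Longrightarrow> D (tens T T s t) = tens H H (\<phi> t) (\<phi> s)"
    "\<And>t. t \<in> carrier T \<Longrightarrow> comul H (\<phi> t) = D (comul (bosonisation K R) t)"
    by (rule \<phi>_comul) blast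
  have cl: "unity R \<sharp> a \<in> carrier T" by (rule smash_closed[OF Ra.closed(2) a])
  show ?thesis
    unfolding elem_def D(2)[OF cl] bosonisation_comul_grouplike[OF a] D(1)[OF cl cl] ..
qed

lemma elem_comul_primitive:
  assumes w: "w \<in> primitives R" and h: "h \<in> carrier G" and co: "bcoact R w = tens K R (e h) w"
  shows "comul H (elem w \<one>) = tens H H (unity H) (elem w \<one>) + tens H H (elem w \<one>) (elem (unity R) h)"
proof -
  obtain D where D: "linear_map (tensor_space T T) (tensor_space H H) D"
    "\<And>s t. s \<in> carrier T \<Longrightarrow> t \<in> carrier T \<Longrightarrow> D (tens T T s t) = tens H H (\<phi> t) (\<phi> s)"
    "\<And>t. t \<in> carrier T \<Longrightarrow> comul H (\<phi> t) = D (comul (bosonisation K R) t)"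
    by (rule \<phi>_comul) blast
  have wR: "w \<in> carrier R" using w by (simp add: primitives_def)
  have cl: "w \<sharp> \<one> \<in> carrier T" "unity R \<sharp> \<one> \<in> carrier T" "unity R \<sharp> h \<in> carrier T"
    using wR h by (auto intro: smash_closed)
  have "comul H (elem w \<one>) = D (tens T T (w \<sharp> \<one>) (unity R \<sharp> \<one>) + tens T T (unity R \<sharp> h) (w \<sharp> \<one>))"
    unfolding elem_def D(3)[OF cl(1)] bosonisation_comul_primitive[OF w h co] ..
  also have "\<dots> = D (tens T T (w \<sharp> \<one>) (unity R \<sharp> \<one>)) + D (tens T T (unity R \<sharp> h) (w \<sharp> \<one>))"
    by (rule linear_mapD(2)[OF D(1)]) (intro tens_in_tensor_space cl)+
  finally show ?thesis
    unfolding D(2)[OF cl(1,2)] D(2)[OF cl(3,1)] elem_def[symmetric] elem_unity .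
qed

lemma elem_span:
  assumes Y: "module.subspace (scale H) Y" and elem: "\<And>r a. r \<in> carrier R \<Longrightarrow> a \<in> carrier G \<Longrightarrow> elem r a \<in> Y"
  shows "carrier H \<subseteq> Y"
proof
  fix y assume "y \<in> carrier H"
  then obtain t where t: "t \<in> carrier T" "y = \<phi> t" using \<phi>_bij by (auto simp: bij_betw_def)
  have Yvs: "is_vspace \<lparr>carrier = Y, scale = scale H\<rparr>" using Y Ha.vs by (simp add: is_vspace_def)
  have pure: "\<phi> (tens R K r f) \<in> Y" if r: "r \<in> carrier R" and f: "f \<in> carrier K" for r f
  proof -
    have lin: "linear_map K H (\<lambda>f. \<phi> (tens R K r f))"
      by (rule linear_map_comp[OF linear_map_tens_right[OF r] \<phi>_linear])
    have "\<phi> (tens R K r f) = \<phi> (tens R K r (\<Sum>a\<in>carrier G. scale K (Poly_Mapping.lookup f a) (e a)))"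
      by (rule arg_cong[OF expand_K[OF f]])
    also have "\<dots> = (\<Sum>a\<in>carrier G. \<phi> (tens R K r (scale K (Poly_Mapping.lookup f a) (e a))))"
      by (rule linear_map_sum[OF K.vs lin]) auto
    also have "\<dots> = (\<Sum>a\<in>carrier G. scale H (Poly_Mapping.lookup f a) (elem r a))"
      by (intro sum.cong refl) (simp add: linear_mapD(3)[OF lin] elem_def)
    also have "\<dots> \<in> Y"
      using is_vspace_sum[OF Yvs, of "carrier G" "\<lambda>a. scale H (Poly_Mapping.lookup f a) (elem r a)"]
        is_vspace_scale[OF Yvs] elem[OF r] by simp
    finally show ?thesis .
  qed
  have "\<phi> t = \<phi> (sweedler R K t (tens R K))" by (simp only: sweedler_identity[OF Ra.vs t(1)])
  also have "\<dots> = sweedler R K t (\<lambda>r f. \<phi> (tens R K r f))"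
    by (rule sweedler_linear[OF \<phi>_linear T_vs Ra.vs t(1)]) (rule tens_in_tensor_space)
  also have "\<dots> \<in> Y"
    using sweedler_closed[OF Ra.vs Yvs t(1), of "\<lambda>r f. \<phi> (tens R K r f)"] pure by simp
  finally show "y \<in> Y" by (simp add: t(2))
qed

text \<open>The combination comes from a tensor that is zero by injectivity of \<open>\<phi>\<close>. Evaluate this tensor at the bilinear form
  given by \<open>\<Phi>\<close> and the coefficient of \<open>b\<close>, which keeps the terms with \<open>a i = b\<close>.\<close>

lemma elem_independent:
  assumes I: "finite I" and r: "\<And>i. i \<in> I \<Longrightarrow> r i \<in> carrier R" and a: "\<And>i. i \<in> I \<Longrightarrow> a i \<in> carrier G"
    and \<Phi>: "linear_map R ground \<Phi>"
    and zero: "(\<Sum>i\<in>I. scale H (c i) (elem (r i) (a i))) = 0"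
  shows "(\<Sum>i\<in>I. c i * (\<Phi> (r i) * (if a i = b then 1 else 0))) = 0"
proof -
  let ?t = "\<Sum>i\<in>I. tscale (c i) (r i \<sharp> a i)"
  have cl: "tscale (c i) (r i \<sharp> a i) \<in> carrier T" if "i \<in> I" for i
    using is_vspace_scale[OF T_vs smash_closed[OF r a]] that by simp
  have t: "?t \<in> carrier T" by (rule is_vspace_sum[OF T_vs cl])
  have "\<phi> ?t = (\<Sum>i\<in>I. \<phi> (tscale (c i) (r i \<sharp> a i)))"
    by (rule linear_map_sum[OF T_vs \<phi>_linear cl])
  also have "\<dots> = (\<Sum>i\<in>I. scale H (c i) (elem (r i) (a i)))"
    using linear_mapD(3)[OF \<phi>_linear smash_closed[OF r a]]
    by (intro sum.cong refl) (simp add: elem_def)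
  finally have "\<phi> ?t = \<phi> 0" using zero linear_map_zero[OF T_vs \<phi>_linear] by simp
  then have t0: "?t = 0"
    using \<phi>_bij t is_vspace_zero[OF T_vs] by (auto simp: bij_betw_def inj_on_def)
  let ?\<beta> = "\<lambda>r f. \<Phi> r * Poly_Mapping.lookup f b"
  have \<beta>: "bilinear_map R K ground ?\<beta>" by (rule bilinear_map_product[OF \<Phi> linear_lookup])
  have "0 = ?t ?\<beta>" unfolding t0 by simp
  also have "\<dots> = (\<Sum>i\<in>I. c i * (\<Phi> (r i) * (if a i = b then 1 else 0)))"
    unfolding sum_tensor_apply
    by (intro sum.cong refl) (simp add: tscale_def tens_apply[OF \<beta>] lookup_single when_def)
  finally show ?thesis by simp
qed

lemma elem_mult_one:
  "r \<in> carrier R \<Longrightarrow> s \<in> carrier R \<Longrightarrow> a \<in> carrier G \<Longrightarrow>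
    elem r \<one> \<cdot>\<^bsub>H\<^esub> elem s a = elem (r \<cdot>\<^bsub>R\<^esub> s) a"
  by (simp add: elem_mult act_one_R[OF R])

lemma elem_pow: "r \<in> carrier R \<Longrightarrow> Ha.pow (elem r \<one>) n = elem (Ra.pow r n) \<one>"
proof (induction n)
  case (Suc n)
  then show ?case by (simp add: Ha.pow_Suc Ra.pow_Suc elem_mult_one)
qed (simp add: elem_unity)

lemma elem_grouplike_pow: "a \<in> carrier G \<Longrightarrow> Ha.pow (elem (unity R) a) n = elem (unity R) (a [^] n)"
proof (induction n)
  case (Suc n)
  then show ?case by (simp add: Ha.pow_Suc_right elem_mult act_R_unity[OF R])
qed (simp add: elem_unity)

text \<open>Left multiplication by \<open>elem r \<one>\<close> is multiplication in \<open>R\<close>, so relations and independence are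
  inherited from \<open>R\<close>, and the \<open>r\<close> with \<open>elem r \<one>\<close> in a given subalgebra of \<open>H\<close> form a subalgebra of \<open>R\<close>.\<close>

lemma taft_presentation:
  fixes x :: "2 \<Rightarrow> 'r"
  assumes Q: "quantum_plane R gr x \<tau> q"
    and generated: "\<And>Y. subalgebra R Y \<Longrightarrow> range x \<subseteq> Y \<Longrightarrow> carrier R \<subseteq> Y"
    and \<beta>: "\<And>i. bact R (e g) (x i) = scale R (\<beta> i) (x i)"
    and g: "g \<in> carrier G" "g [^] N = \<one>" "bij_betw (\<lambda>l. g [^] l) {..<N} (carrier G)"
    and orders: "has_order (q 1 1) Nx" "has_order (q 2 2) Ny" "q 1 1 \<noteq> 1" "q 2 2 \<noteq> 1"
    and inverse: "q 1 2 * q 2 1 = 1"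
  shows "presented_by H (case_taft_generator (elem (unity R) g) (elem (x 1) \<one>) (elem (x 2) \<one>))
    (taft_rels Nx Ny N (q 1 2) (\<beta> 1) (\<beta> 2))"
proof -
  interpret Q: quantum_plane R gr x \<tau> q by (rule Q)
  let ?g = "elem (unity R) g" and ?x = "elem (x 1) \<one>" and ?y = "elem (x 2) \<one>"
  have "N > 0"
    using g(3) one_closed by (metis bij_betw_empty1 empty_iff lessThan_0 not_gr_zero)
  have elem_0: "elem 0 a = 0" if "a \<in> carrier G" for a
    by (rule linear_map_zero[OF Ra.vs elem_linear[OF that]])
  have elem_scale: "elem (scale R c r) a = scale H c (elem r a)" if "r \<in> carrier R" "a \<in> carrier G" for c r a
    by (rule linear_mapD(3)[OF elem_linear[OF that(2)] that(1)])
  have gx: "?g \<cdot>\<^bsub>H\<^esub> elem (x i) \<one> = scale H (\<beta> i) (elem (x i) \<one> \<cdot>\<^bsub>H\<^esub> ?g)" for i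
    using g(1) by (simp add: elem_mult \<beta> act_one_R[OF R] elem_scale)
  have monomial: "Ha.pow ?x i \<cdot>\<^bsub>H\<^esub> Ha.pow ?y j \<cdot>\<^bsub>H\<^esub> Ha.pow ?g l =
      elem (Ra.pow (x 1) i \<cdot>\<^bsub>R\<^esub> Ra.pow (x 2) j) (g [^] l)" for i j l
    using g(1) by (simp add: elem_pow elem_grouplike_pow elem_mult_one)
  show ?thesis
  proof (rule Ha.presented_by_taft_rels)
    show "?g \<in> carrier H" "?x \<in> carrier H" "?y \<in> carrier H" using g(1) by simp_all
    show "Nx > 0" "Ny > 0" using orders by (simp_all add: has_order_def)
    show "N > 0" by fact
    show "q 1 2 \<noteq> 0" using inverse by auto
    show "Ha.pow ?x Nx = 0" "Ha.pow ?y Ny = 0"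
      using Q.pow_order_eq_0[OF orders(1,3)] Q.pow_order_eq_0[OF orders(2,4)] by (simp_all add: elem_pow elem_0)
    show "?x \<cdot>\<^bsub>H\<^esub> ?y = scale H (q 1 2) (?y \<cdot>\<^bsub>H\<^esub> ?x)"
      using Q.skew_commute[of 1 2] inverse by (simp add: elem_mult_one elem_scale)
    show "Ha.pow ?g N = unity H" using g by (simp add: elem_grouplike_pow elem_unity)
    show "?g \<cdot>\<^bsub>H\<^esub> ?x = scale H (\<beta> 1) (?x \<cdot>\<^bsub>H\<^esub> ?g)" "?g \<cdot>\<^bsub>H\<^esub> ?y = scale H (\<beta> 2) (?y \<cdot>\<^bsub>H\<^esub> ?g)"
      by (rule gx)+
    show "carrier H \<subseteq> Y" if Y: "subalgebra H Y" and gY: "?g \<in> Y" and xY: "?x \<in> Y" and yY: "?y \<in> Y" for Y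
    proof (rule elem_span)
      show sub: "Ha.VS.subspace Y" using Y by (simp add: subalgebra_def)
      have mulY: "a \<cdot>\<^bsub>H\<^esub> b \<in> Y" if "a \<in> Y" "b \<in> Y" for a b using Y that by (auto simp: subalgebra_def)
      have unitY: "unity H \<in> Y" using Y by (simp add: subalgebra_def)
      let ?Z = "{r \<in> carrier R. elem r \<one> \<in> Y}"
      have lin: "linear_map R H (\<lambda>r. elem r \<one>)" by (rule elem_linear) simp
      have "subalgebra R ?Z"
        unfolding subalgebra_def Ra.VS.subspace_def
        using mulY unitY Ha.VS.subspace_0[OF sub] Ha.VS.subspace_add[OF sub] Ha.VS.subspace_scale[OF sub]
        by (auto simp: elem_0 linear_mapD(2)[OF lin] elem_scale elem_unity simp flip: elem_mult_one)
      moreover have "range x \<subseteq> ?Z"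
      proof
        fix r assume "r \<in> range x"
        then obtain i where "r = x i" by blast
        then show "r \<in> ?Z" using two_cases[of i] xY yY by auto
      qed
      ultimately have RZ: "carrier R \<subseteq> ?Z" by (rule generated)
      have powY: "Ha.pow ?g l \<in> Y" for l
        using g(1) by (induction l) (simp_all add: unitY mulY gY Ha.pow_Suc)
      show "elem r a \<in> Y" if r: "r \<in> carrier R" and a: "a \<in> carrier G" for r a
      proof -
        obtain l where l: "a = g [^] (l::nat)" using g(3) a by (auto simp: bij_betw_def)
        have "elem r a = elem r \<one> \<cdot>\<^bsub>H\<^esub> Ha.pow ?g l"
          using r g(1) by (simp add: l elem_grouplike_pow elem_mult_one)
        then show ?thesis using mulY[OF _ powY] RZ r by auto
      qed
    qed
    show "\<forall>i<Nx. \<forall>j<Ny. \<forall>l<N. c i j l = 0"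
      if zero: "(\<Sum>(i, j, l)\<in>{..<Nx} \<times> {..<Ny} \<times> {..<N}. scale H (c i j l)
        (Ha.pow ?x i \<cdot>\<^bsub>H\<^esub> Ha.pow ?y j \<cdot>\<^bsub>H\<^esub> Ha.pow ?g l)) = 0" for c
    proof (intro allI impI)
      fix i0 j0 l0 assume lt: "i0 < Nx" "j0 < Ny" "l0 < N"
      let ?I = "{..<Nx} \<times> {..<Ny} \<times> {..<N}"
      let ?c = "\<lambda>(i, j, l). c i j l"
        and ?r = "\<lambda>(i, j, l). Ra.pow (x 1) i \<cdot>\<^bsub>R\<^esub> Ra.pow (x 2) j"
        and ?a = "\<lambda>(i, j, l). g [^] l"
      have "q 1 2 \<noteq> 0" using inverse by auto
      then obtain \<Phi> where \<Phi>: "linear_map R ground \<Phi>"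
        "\<And>i j. \<Phi> (Ra.pow (x 1) i \<cdot>\<^bsub>R\<^esub> Ra.pow (x 2) j) = (if i = i0 \<and> j = j0 then 1 else 0)"
        using Q.dual_functional[OF orders(1,2) _ lt(1,2)] by blast
      have "(\<Sum>i\<in>?I. scale H (?c i) (elem (?r i) (?a i))) = 0"
        using zero unfolding monomial by (simp add: case_prod_unfold)
      from elem_independent[OF _ _ _ \<Phi>(1) this, of "g [^] l0"]
      have "0 = (\<Sum>i\<in>?I. ?c i * (\<Phi> (?r i) * (if ?a i = g [^] l0 then 1 else 0)))"
        using g(1) by auto
      also have "\<dots> = (\<Sum>i\<in>?I. if i = (i0, j0, l0) then c i0 j0 l0 else 0)"
      proof (intro sum.cong refl)
        fix i assume "i \<in> ?I"
        moreover have "g [^] l = g [^] l0 \<longleftrightarrow> l = l0" if "l < N" for l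
          using g(3) that lt(3) by (auto simp: bij_betw_def inj_on_def)
        ultimately show "?c i * (\<Phi> (?r i) * (if ?a i = g [^] l0 then 1 else 0)) =
            (if i = (i0, j0, l0) then c i0 j0 l0 else 0)"
          by (cases i) (auto simp: \<Phi>(2))
      qed
      also have "\<dots> = c i0 j0 l0" using lt by simp
      finally show "c i0 j0 l0 = 0" by simp
    qed
  qed
qed

end

end

end

theorem theorem3p14:
  fixes G :: "'g monoid"
    and V :: "('k::{alg_closed_field, field_char_0}, 'g \<Rightarrow>\<^sub>0 'k, 'v::ab_group_add) yd"
    and B :: "('k, 'g \<Rightarrow>\<^sub>0 'k, 'r::ab_group_add) braided_bialg"
    and H :: "('k, 'a::ab_group_add) bialg"
  assumes "generalised_taft_algebra G V B H"
  shows "\<exists>(N::nat) (a::2 \<Rightarrow> 2 \<Rightarrow> int) (q::'k) g x y.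
    N \<ge> 2 \<and> parameter_matrix N a \<and> primitive_root_of_unity N q \<and>
    g \<in> carrier H \<and> x \<in> carrier H \<and> y \<in> carrier H \<and>
    (let Z = residue_ring (int N);
         Nx = additive_order N (a 1 1 \<otimes>\<^bsub>Z\<^esub> a 1 2);
         Ny = additive_order N (a 2 1 \<otimes>\<^bsub>Z\<^esub> a 2 2);
         M = mult_monoid H
     in presented_by H (case_taft_generator g x y)
          {(gen Gen_x ^ Nx, 0),
           (gen Gen_y ^ Ny, 0),
           (gen Gen_x * gen Gen_y, const (q powi (a 1 1 * a 2 2)) * gen Gen_y * gen Gen_x),
           (gen Gen_g ^ N, 1),
           (gen Gen_g * gen Gen_x, const (q powi (a 1 2)) * gen Gen_x * gen Gen_g),
           (gen Gen_g * gen Gen_y, const (q powi (a 2 2)) * gen Gen_y * gen Gen_g)} \<and>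
        comul H g = tens H H g g \<and>
        comul H x = tens H H (unity H) x + tens H H x (g [^]\<^bsub>M\<^esub> (a 1 1)) \<and>
        comul H y = tens H H (unity H) y + tens H H y (g [^]\<^bsub>M\<^esub> (a 2 1)) \<and>
        antipode H g = inv\<^bsub>M\<^esub> g \<and>
        antipode H x = - (x \<cdot>\<^bsub>H\<^esub> g [^]\<^bsub>M\<^esub> (- (a 1 1))) \<and>
        antipode H y = - (y \<cdot>\<^bsub>H\<^esub> g [^]\<^bsub>M\<^esub> (- (a 2 1))))"
proof -
  let ?K = "group_algebra G :: ('k, 'g \<Rightarrow>\<^sub>0 'k) bialg"
  obtain \<phi> where G: "Group.group G" "finite (carrier G)" "cyclic_group G" and D2: "D2_type ?K V"
    and nichols: "nichols_algebra ?K V B" and H: "is_hopf H"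
    and iso: "hopf_iso (coopposite (bosonisation ?K B)) H \<phi>"
    using assms unfolding generalised_taft_algebra_def by blast
  have V: "yd_module ?K V" using D2 by (simp add: D2_type_def)
  interpret comm_group G by (rule group.cyclic_imp_abelian_group[OF G(1,3)])
  interpret group_algebra_hopf G ?K
    by unfold_locales (use G V in \<open>simp_all add: yd_module_def\<close>)
  interpret H: algebra_on_carrier H by standard (use H in \<open>simp add: is_hopf_def is_bialgebra_def\<close>)
  define N where "N = card (carrier G)"
  obtain \<gamma> where \<gamma>: "\<gamma> \<in> carrier G" "\<gamma> [^]\<^bsub>G\<^esub> N = \<one>\<^bsub>G\<^esub>"
    "bij_betw (\<lambda>l::nat. \<gamma> [^]\<^bsub>G\<^esub> l) {..<N} (carrier G)"
    unfolding N_def by (rule cyclic_generator[OF G])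
  have "N > 0" using G(2) one_closed unfolding N_def by (metis card_gt_0_iff empty_iff)
  then obtain \<zeta> :: 'k where \<zeta>: "has_order \<zeta> N" using ex_has_order by blast
  have char: "of_nat N \<noteq> (0::'k)" using \<open>N > 0\<close> by simp
  have gen: "carrier G \<subseteq> (\<lambda>l::nat. \<gamma> [^]\<^bsub>G\<^esub> l) ` {..<N}" using \<gamma>(3) by (simp add: bij_betw_def)
  obtain w :: "2 \<Rightarrow> 'v" and d c :: "2 \<Rightarrow> nat" where dN: "\<And>i. d i < N" and cN: "\<And>i. c i < N"
    and w: "inj w" "\<not> module.dependent (scale V) (range w)" "module.span (scale V) (range w) = carrier V"
    and co: "\<And>i. coact V (w i) = tens ?K V (e (\<gamma> [^]\<^bsub>G\<^esub> d i)) (w i)"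
    and act: "\<And>i. e \<gamma> \<triangleright>\<^bsub>V\<^esub> w i = scale V (\<zeta> ^ c i) (w i)"
    and q: "\<zeta> ^ (d 1 * c 1) \<noteq> 1" "\<zeta> ^ (d 2 * c 2) \<noteq> 1" "\<zeta> ^ (d 1 * c 2) * \<zeta> ^ (d 2 * c 1) = 1"
    by (rule D2_type_eigenbasis[OF D2 char \<gamma>(1,2) \<zeta> gen]) blast
  let ?a = "\<lambda>i. \<gamma> [^]\<^bsub>G\<^esub> d i" and ?q = "\<lambda>i j. (\<zeta> ^ c j) ^ d i"
  have hG: "?a i \<in> carrier G" for i using \<gamma>(1) by simp
  obtain gr x where B: "braided_hopf ?K B" and Q: "quantum_plane B gr x (\<lambda>j. bact B (e (?a j))) ?q"
    and co_x: "\<And>i. bcoact B (x i) = tens ?K B (e (?a i)) (x i)"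
    and act_x: "\<And>i. bact B (e \<gamma>) (x i) = scale B (\<zeta> ^ c i) (x i)"
    and gen_x: "\<And>Y. subalgebra B Y \<Longrightarrow> range x \<subseteq> Y \<Longrightarrow> carrier B \<subseteq> Y"
    by (rule nichols_quantum_plane[OF nichols V w \<gamma>(1) co act], rule that)
  interpret Q: quantum_plane B gr x "\<lambda>j. bact B (e (?a j))" ?q by (rule Q)
  have q_eq: "?q i j = \<zeta> ^ (d i * c j)" for i j by (simp add: power_mult[symmetric] mult.commute)
  have N2: "N \<ge> 2"
  proof (rule ccontr)
    assume "\<not> N \<ge> 2"
    then have "\<zeta> = 1" using \<zeta> \<open>N > 0\<close> by (cases "N = 1") (auto simp: has_order_def)
    then show False using q(1) by simp
  qed
  let ?Z = "residue_ring (int N)"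
  define a :: "2 \<Rightarrow> 2 \<Rightarrow> int" where "a = (\<lambda>i j. if j = 1 then int (d i) else int (c i))"
  have a: "a 1 1 = int (d 1)" "a 1 2 = int (c 1)" "a 2 1 = int (d 2)" "a 2 2 = int (c 2)"
    by (simp_all add: a_def)
  have \<zeta>_dvd: "\<zeta> ^ m = 1 \<longleftrightarrow> int N dvd int m" for m
    using has_order_dvd[OF \<zeta>] by simp
  have mult_Z: "u \<otimes>\<^bsub>?Z\<^esub> v = u * v mod int N" and add_Z: "u \<oplus>\<^bsub>?Z\<^esub> v = (u + v) mod int N"
    and zero_Z: "\<zero>\<^bsub>?Z\<^esub> = 0" and carrier_Z: "carrier ?Z = {0..int N - 1}" for u v
    by (simp_all add: residue_ring_def)
  have param: "parameter_matrix N a"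
    unfolding parameter_matrix_def Let_def
  proof (intro conjI allI)
    show "a i j \<in> carrier ?Z" for i j using dN[of i] cN[of i] by (auto simp: a_def carrier_Z)
    show "a 1 1 \<otimes>\<^bsub>?Z\<^esub> a 1 2 \<noteq> \<zero>\<^bsub>?Z\<^esub>" "a 2 1 \<otimes>\<^bsub>?Z\<^esub> a 2 2 \<noteq> \<zero>\<^bsub>?Z\<^esub>"
      using q(1,2) unfolding \<zeta>_dvd a mult_Z zero_Z by (simp_all add: dvd_eq_mod_eq_0)
    show "a 1 1 \<otimes>\<^bsub>?Z\<^esub> a 2 2 \<oplus>\<^bsub>?Z\<^esub> a 1 2 \<otimes>\<^bsub>?Z\<^esub> a 2 1 = \<zero>\<^bsub>?Z\<^esub>"
      using q(3) unfolding power_add[symmetric] \<zeta>_dvd a mult_Z add_Z zero_Z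
      by (simp add: dvd_eq_mod_eq_0 mod_simps mult.commute)
  qed
  have prim: "primitive_root_of_unity N \<zeta>"
    using \<zeta> by (auto simp: primitive_root_of_unity_def has_order_def)
  have order: "has_order (\<zeta> ^ (d i * c i)) (additive_order N (int (d i) \<otimes>\<^bsub>?Z\<^esub> int (c i)))" for i
  proof (rule has_orderI)
    have cl: "int (d i) \<otimes>\<^bsub>?Z\<^esub> int (c i) \<in> carrier ?Z" using N2 by (simp add: mult_Z carrier_Z)
    show "additive_order N (int (d i) \<otimes>\<^bsub>?Z\<^esub> int (c i)) > 0" by (rule additive_order(1)[OF N2 cl])
    fix m
    have "(\<zeta> ^ (d i * c i)) ^ m = 1 \<longleftrightarrow> int N dvd int (d i * c i * m)"
      by (simp only: power_mult[symmetric] \<zeta>_dvd)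
    also have "\<dots> \<longleftrightarrow> int N dvd int m * (int (d i) \<otimes>\<^bsub>?Z\<^esub> int (c i))"
      by (simp add: mult_Z dvd_eq_mod_eq_0 mod_simps mult_ac)
    also have "\<dots> \<longleftrightarrow> additive_order N (int (d i) \<otimes>\<^bsub>?Z\<^esub> int (c i)) dvd m"
      by (rule additive_order(2)[OF N2 cl, symmetric])
    finally show "(\<zeta> ^ (d i * c i)) ^ m = 1 \<longleftrightarrow> additive_order N (int (d i) \<otimes>\<^bsub>?Z\<^esub> int (c i)) dvd m" .
  qed
  have prim_x: "x i \<in> primitives B" for i using Q.w_gr Q.gr_1 by blast
  have xB: "x i \<in> carrier B" for i by (rule Q.w_closed)
  have uB: "unity B \<in> carrier B" by (rule Q.closed(2))
  define E where "E = elem B \<phi>"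
  note E_rules = elem_closed[OF B H iso, folded E_def] elem_comul_grouplike[OF B H iso, folded E_def]
    elem_comul_primitive[OF B H iso, folded E_def] elem_counity[OF B H iso, folded E_def]
    elem_grouplike_pow[OF B H iso, folded E_def]
  let ?M = "mult_monoid H"
  let ?g = "E (unity B) \<gamma>" and ?x = "\<lambda>i. E (x i) \<one>\<^bsub>G\<^esub>" and ?h = "\<lambda>i. E (unity B) (?a i)"
  have cl: "?g \<in> carrier H" "?x i \<in> carrier H" "?h i \<in> carrier H" for i
    using \<gamma>(1) hG xB uB by (auto intro: E_rules(1))
  have grouplike: "comul H (E (unity B) b) = tens H H (E (unity B) b) (E (unity B) b)"
    "counity H (E (unity B) b) = 1" if "b \<in> carrier G" for b
    using E_rules(2)[OF that] E_rules(4)[OF uB that] Q.counity_unity by simp_all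
  have skew: "comul H (?x i) = tens H H (unity H) (?x i) + tens H H (?x i) (?h i)" for i
    by (rule E_rules(3)[OF prim_x hG co_x])
  have counity_x: "counity H (?x i) = 0" for i
    using E_rules(4)[OF xB, of "\<one>\<^bsub>G\<^esub>"] Q.counity_gr[OF _ Q.w_gr, of i] by simp
  have h_pow: "?h i = ?g [^]\<^bsub>?M\<^esub> int (d i)" for i
    using E_rules(5)[OF \<gamma>(1), of "d i"] by (simp add: int_pow_int)
  have h_inv: "inv\<^bsub>?M\<^esub> ?h i = ?g [^]\<^bsub>?M\<^esub> (- int (d i))" for i
    unfolding h_pow by (cases "d i = 0") (simp_all add: int_pow_def2 H.M.inv_one[simplified])
  have antipode_x: "antipode H (?x i) = - (?x i \<cdot>\<^bsub>H\<^esub> ?g [^]\<^bsub>?M\<^esub> (- int (d i)))" for i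
    unfolding h_inv[symmetric]
    by (rule antipode_skew_primitive[OF H cl(2) skew counity_x cl(3) grouplike[OF hG]])
  have "presented_by H (case_taft_generator ?g (?x 1) (?x 2))
    (taft_rels (additive_order N (a 1 1 \<otimes>\<^bsub>?Z\<^esub> a 1 2)) (additive_order N (a 2 1 \<otimes>\<^bsub>?Z\<^esub> a 2 2)) N
      (?q 1 2) (\<zeta> ^ c 1) (\<zeta> ^ c 2))"
    unfolding E_def
  proof (rule taft_presentation[OF B H iso Q gen_x act_x \<gamma>])
    show "has_order (?q 1 1) (additive_order N (a 1 1 \<otimes>\<^bsub>?Z\<^esub> a 1 2))"
      "has_order (?q 2 2) (additive_order N (a 2 1 \<otimes>\<^bsub>?Z\<^esub> a 2 2))"
      unfolding q_eq a by (rule order)+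
    show "?q 1 1 \<noteq> 1" "?q 2 2 \<noteq> 1" "?q 1 2 * ?q 2 1 = 1" unfolding q_eq by (rule q)+
  qed
  moreover have "?q 1 2 = \<zeta> powi (a 1 1 * a 2 2)"
    unfolding q_eq a of_nat_mult[symmetric] power_int_of_nat ..
  ultimately have pres: "presented_by H (case_taft_generator ?g (?x 1) (?x 2))
    (taft_rels (additive_order N (a 1 1 \<otimes>\<^bsub>?Z\<^esub> a 1 2)) (additive_order N (a 2 1 \<otimes>\<^bsub>?Z\<^esub> a 2 2)) N
      (\<zeta> powi (a 1 1 * a 2 2)) (\<zeta> powi a 1 2) (\<zeta> powi a 2 2))"
    by (simp only: a power_int_of_nat)
  show ?thesis
    unfolding Let_def
  proof (rule exI[of _ N], rule exI[of _ a], rule exI[of _ \<zeta>], rule exI[of _ ?g], rule exI[of _ "?x 1"],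
      rule exI[of _ "?x 2"], intro conjI)
    show "comul H ?g = tens H H ?g ?g" "antipode H ?g = inv\<^bsub>?M\<^esub> ?g"
      using grouplike[OF \<gamma>(1)] antipode_grouplike(3)[OF H cl(1) grouplike[OF \<gamma>(1)]] by simp_all
    show "comul H (?x 1) = tens H H (unity H) (?x 1) + tens H H (?x 1) (?g [^]\<^bsub>?M\<^esub> a 1 1)"
      "comul H (?x 2) = tens H H (unity H) (?x 2) + tens H H (?x 2) (?g [^]\<^bsub>?M\<^esub> a 2 1)"
      unfolding a h_pow[symmetric] by (rule skew)+
    show "antipode H (?x 1) = - (?x 1 \<cdot>\<^bsub>H\<^esub> ?g [^]\<^bsub>?M\<^esub> (- a 1 1))"
      "antipode H (?x 2) = - (?x 2 \<cdot>\<^bsub>H\<^esub> ?g [^]\<^bsub>?M\<^esub> (- a 2 1))"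
      unfolding a by (rule antipode_x)+
  qed (use N2 param prim cl pres in \<open>simp_all only: taft_rels_def\<close>)
qed

end
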